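(* Let $\eta$ be a Poisson process on a measurable space $(\mathbb{X},\mathcal{X})$ with $\sigma$-finite intensity measure $\mu$. Let $m\in\mathbb{N}$, let $\widetilde m\in\mathbb{N}$ with $\widetilde m\ge m$ be even, and let $f^{(\ell)}\in L^1_s(\mu^{q_\ell})$ with $q_\ell\in\mathbb{N}$, $\ell\in\{1,\dots,m\}$, be such that $$\int_{\mathbb{X}^{|\sigma|}}|(\otimes_{\ell=1}^{\widetilde m}f^{(i)})_\sigma|\,\mathrm{d}\mu^{|\sigma|}<\infty,\qquad\sigma\in\overline{\Pi}^{\widetilde m}(q_i),\ i\in\{1,\dots,m\},$$ $$\int_{\mathbb{X}^{|\sigma|}}|(\otimes_{\ell=1}^{m}f^{(\ell)})_\sigma|\,\mathrm{d}\mu^{|\sigma|}<\infty,\qquad\sigma\in\widetilde{\Pi}(q_1,\dots,q_m).$$ Then, for $S_\ell:=\sum_{(x_1,\dots,x_{q_\ell})\in\eta^{q_\ell}_{\neq}}f^{(\ell)}(x_1,\dots,x_{q_\ell})$, $\ell\in\{1,\dots,m\}$, $$\mathbb{E}\Big[\prod_{\ell=1}^m(S_\ell-\mathbb{E}S_\ell)\Big]=\sum_{\sigma\in\overline{\Pi}(q_1,\dots,q_m)}\int_{\mathbb{X}^{|\sigma|}}(\otimes_{\ell=1}^mf^{(\ell)})_\sigma\,\mathrm{d}\mu^{|\sigma|},$$ $$\operatorname{cum}(S_1,\dots,S_m)=\sum_{\sigma\in\widetilde{\Pi}(q_1,\dots,q_m)}\int_{\mathbb{X}^{|\sigma|}}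(\otimes_{\ell=1}^mf^{(\ell)})_\sigma\,\mathrm{d}\mu^{|\sigma|}.$$
   Context: **Poisson processes and U-statistics.** A Poisson process $\eta$ on $(\mathbb{X},\mathcal{X})$ with $\sigma$-finite intensity measure $\mu$ is a random counting measure such that $\eta(B)$ is Poisson distributed with mean $\mu(B)$ for every $B\in\mathcal{X}$ (possibly degenerate), and $\eta(B_1),\dots,\eta(B_n)$ are independent for pairwise disjoint $B_1,\dots,B_n\in\mathcal{X}$. $\mu^q$ is the $q$-fold product measure; $L^1_s(\mu^q)$ is the set of $\mu^q$-integrable symmetric functions $f:\mathbb{X}^q\to\mathbb{R}$. $\eta^q_{\neq}$ is the set of all $q$-tuples of distinct points of $\eta$; in full generality (if $\eta$ is not given by its atoms) $\sum_{(x_1,\dots,x_q)\in\eta^q_{\neq}}f(x_1,\dots,x_q)$ means $\int f\,\mathrm{d}\eta^{(q)}$ with the factorial measure $\eta^{(q)}(\cdot)=\int\cdots\int \mathbf{1}((x_1,\dots,x_q)\in\cdot)\,(\eta-\sum_{i=1}^{q-1}\delta_{x_i})(\mathrm{d}x_q)\cdots(\eta-\delta_{x_1})(\mathrm{d}x_2)\,\eta(\mathrm{d}x_1)$. **Cumulants.** $\operatorname{cum}(X_1,\dots,X_m):=(-\mathbf{i})^m\frac{\partial^m}{\partial t_1\cdots\partial t_m}\log\mathbb{E}\exp(\mathbf{i}\sum_{j=1}^mt_jX_j)\big|_{t_1=\dots=t_m=0}$, with $\mathbf{i}$ the imaginary unit. **Partitions.** For $q_1,\dots,q_m\in\mathbb{N}$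 put $N_0:=0$, $N_\ell:=\sum_{i=1}^\ell q_i$, $N:=N_m$ and $J_\ell:=\{N_{\ell-1}+1,\dots,N_\ell\}$. $\Pi(q_1,\dots,q_m)$ is the set of all partitions $\sigma$ of $\{1,\dots,N\}$ into non-empty blocks such that $|B\cap J_\ell|\le 1$ for all $\ell$ and all $B\in\sigma$; $|\sigma|$ is the number of blocks. Each $\sigma\in\Pi(q_1,\dots,q_m)$ induces the partition $\sigma^*$ of $\{1,\dots,m\}$ generated by requiring that $i,j$ lie in the same block whenever some $B\in\sigma$ meets both $J_i$ and $J_j$ (take the transitive closure). $\widetilde{\Pi}(q_1,\dots,q_m)$ is the set of $\sigma\in\Pi(q_1,\dots,q_m)$ with $|\sigma^*|=1$. $\overline{\Pi}(q_1,\dots,q_m)$ is the set of $\sigma\in\Pi(q_1,\dots,q_m)$ such that for each $\ell\in\{1,\dots,m\}$ there is a block $B\in\sigma$ with $|B|\ge2$ and $B\cap J_\ell\neq\varnothing$. $\overline{\Pi}^{m}(q)$ stands for $\overline{\Pi}(q,\dots,q)$ with $m$ entries. For functions $f^{(\ell)}:\mathbb{X}^{q_\ell}\to\mathbb{R}$, $(\otimes_{\ell=1}^m f^{(\ell)})(x_1,\dots,x_N):=\prod_{\ell=1}^m f^{(\ell)}(x_{N_{\ell-1}+1},\dots,x_{N_\ell})$, and for $\sigma\in\Pi(q_1,\dots,q_m)$ the function $(\otimes_{\ell=1}^m f^{(\ell)})_\sigma:\mathbb{X}^{|\sigma|}\to\mathbb{R}$ arises by replacing all variables whose indices belong to the same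 block of $\sigma$ by a common new variable (the order of the new variables is irrelevant). In $\otimes_{\ell=1}^{\widetilde m}f^{(i)}$ the same function $f^{(i)}$ is used $\widetilde m$ times. Empty sums are $0$. *)

theory Defs
  imports "HOL-Probability.Probability"
begin

text \<open>
  Indices start at 0: a \<open>q\<close>-tuple of points of \<open>M\<close> is an element of
  \<open>space (PiM {..<q} (\<lambda>_. M))\<close>, and the functions are \<open>f 0, \<dots>, f (m - 1)\<close>.
  The measure space \<open>M\<close> carries both the sigma-algebra and the intensity measure.
\<close>

section \<open>Poisson processes\<close>

definition random_counting_measure ::
    "'w measure \<Rightarrow> 'a measure \<Rightarrow> ('w \<Rightarrow> 'a measure) \<Rightarrow> bool" where
  "random_counting_measure P M \<eta> \<longleftrightarrow>
     (\<forall>\<omega>\<in>space P. sets (\<eta> \<omega>) = sets M) \<and>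
     (\<forall>B\<in>sets M. (\<lambda>\<omega>. emeasure (\<eta> \<omega>) B) \<in> borel_measurable P) \<and>
     (\<forall>\<omega>\<in>space P. \<forall>B\<in>sets M. emeasure (\<eta> \<omega>) B \<in> insert \<infinity> (range of_nat))"

text \<open>
  The Poisson law with mean in \<open>[0, \<infinity>]\<close>. For mean 0 the formula gives the point mass at 0
  (as \<open>0 ^ 0 = 1\<close>); for mean \<open>\<infinity>\<close> the variable is infinite almost surely.
\<close>

definition poisson_distributed ::
    "'w measure \<Rightarrow> ('w \<Rightarrow> ennreal) \<Rightarrow> ennreal \<Rightarrow> bool" where
  "poisson_distributed P X r \<longleftrightarrow>
     X \<in> borel_measurable P \<and>
     (if r = \<infinity> then AE \<omega> in P. X \<omega> = \<infinity>
      else \<forall>k::nat. measure P {\<omega> \<in> space P. X \<omega> = of_nat k} =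
             enn2real r ^ k / fact k * exp (- enn2real r))"

definition poisson_process ::
    "'w measure \<Rightarrow> 'a measure \<Rightarrow> ('w \<Rightarrow> 'a measure) \<Rightarrow> bool" where
  "poisson_process P M \<eta> \<longleftrightarrow>
     prob_space P \<and> sigma_finite_measure M \<and> random_counting_measure P M \<eta> \<and>
     (\<forall>B\<in>sets M. poisson_distributed P (\<lambda>\<omega>. emeasure (\<eta> \<omega>) B) (emeasure M B)) \<and>
     (\<forall>(n::nat) B. (\<forall>i<n. B i \<in> sets M) \<and> disjoint_family_on B {..<n} \<longrightarrow>
        prob_space.indep_vars P (\<lambda>_. borel) (\<lambda>i \<omega>. emeasure (\<eta> \<omega>) (B i)) {..<n})"

section \<open>Factorial measures and U-statistics\<close>

text \<open>
  The factorial measure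
  \<open>\<integral>\<cdots>\<integral> 1((x\<^sub>1,\<dots>,x\<^sub>q) \<in> C) (\<nu> - \<Sum>\<^sub>i\<^sub><\<^sub>q \<delta>(x\<^sub>i))(dx\<^sub>q) \<cdots> (\<nu> - \<delta>(x\<^sub>1))(dx\<^sub>2) \<nu>(dx\<^sub>1)\<close>,
  evaluated from the inside: the innermost integral is
  \<open>\<nu>(C\<^sub>x) - \<Sum>\<^sub>i 1((x,x\<^sub>i) \<in> C)\<close>, where \<open>C\<^sub>x\<close> is the section of \<open>C\<close> at \<open>x = (x\<^sub>1,\<dots>,x\<^sub>q\<^sub>-\<^sub>1)\<close>,
  and the remaining integrals are integration against the factorial measure of order \<open>q - 1\<close>.
  The subtraction in \<open>ennreal\<close> is truncated at 0. This is harmless: for a sigma-finite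
  \<open>\<nu>\<close> with values in \<open>{0,1,2,\<dots>,\<infinity>}\<close> the difference is nonnegative for almost all \<open>x\<close>, also when \<open>\<nu>\<close>
  is not a sum of point masses. The order 0 measure is the unit mass on the empty tuple.
\<close>

primrec factorial_measure :: "'a measure \<Rightarrow> nat \<Rightarrow> (nat \<Rightarrow> 'a) measure" where
  "factorial_measure \<nu> 0 = PiM {} (\<lambda>_. \<nu>)"
| "factorial_measure \<nu> (Suc q) =
     measure_of (space (PiM {..<Suc q} (\<lambda>_. \<nu>))) (sets (PiM {..<Suc q} (\<lambda>_. \<nu>)))
       (\<lambda>C. \<integral>\<^sup>+ x. (emeasure \<nu> {y \<in> space \<nu>. x(q := y) \<in> C}
                    - (\<Sum>i<q. indicator C (x(q := x i)))) \<partial>factorial_measure \<nu> q)"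

definition L1_sym :: "'a measure \<Rightarrow> nat \<Rightarrow> ((nat \<Rightarrow> 'a) \<Rightarrow> real) set" where
  "L1_sym M q = {f. integrable (PiM {..<q} (\<lambda>_. M)) f \<and>
     (\<forall>\<pi> x. \<pi> permutes {..<q} \<longrightarrow> x \<in> space (PiM {..<q} (\<lambda>_. M)) \<longrightarrow> f (x \<circ> \<pi>) = f x)}"

definition U_statistic ::
    "('w \<Rightarrow> 'a measure) \<Rightarrow> nat \<Rightarrow> ((nat \<Rightarrow> 'a) \<Rightarrow> real) \<Rightarrow> 'w \<Rightarrow> real" where
  "U_statistic \<eta> q f \<omega> = (\<integral>x. f x \<partial>factorial_measure (\<eta> \<omega>) q)"

section \<open>Joint cumulants\<close>

text \<open>
  \<open>mixed_partial m g t\<close> is the iterated derivative \<open>\<partial>\<^sub>0 (\<partial>\<^sub>1 (\<cdots> (\<partial>\<^sub>m\<^sub>-\<^sub>1 g)))\<close> at \<open>t\<close>. Since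
  \<open>vector_derivative\<close> is unspecified where there is no derivative, existence is the
  separate notion \<open>mixed_partial_exists\<close>: near \<open>t\<close> (in the product topology), every one of the
  successive derivatives exists.
\<close>

definition partial_deriv ::
    "nat \<Rightarrow> ((nat \<Rightarrow> real) \<Rightarrow> complex) \<Rightarrow> (nat \<Rightarrow> real) \<Rightarrow> complex" where
  "partial_deriv k g t = vector_derivative (\<lambda>s. g (t(k := s))) (at (t k))"

primrec mixed_partial ::
    "nat \<Rightarrow> ((nat \<Rightarrow> real) \<Rightarrow> complex) \<Rightarrow> (nat \<Rightarrow> real) \<Rightarrow> complex" where
  "mixed_partial 0 g t = g t"
| "mixed_partial (Suc k) g t = mixed_partial k (partial_deriv k g) t"

primrec mixed_partial_exists ::
    "nat \<Rightarrow> ((nat \<Rightarrow> real) \<Rightarrow> complex) \<Rightarrow> (nat \<Rightarrow> real) \<Rightarrow> bool" where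
  "mixed_partial_exists 0 g t \<longleftrightarrow> True"
| "mixed_partial_exists (Suc k) g t \<longleftrightarrow>
     (\<forall>\<^sub>F u in nhds t. (\<lambda>s. g (u(k := s))) differentiable at (u k)) \<and>
     mixed_partial_exists k (partial_deriv k g) t"

text \<open>The characteristic function is 1 at the origin, so near it the principal logarithm is the
  right branch.\<close>

definition log_char ::
    "'w measure \<Rightarrow> nat \<Rightarrow> (nat \<Rightarrow> 'w \<Rightarrow> real) \<Rightarrow> (nat \<Rightarrow> real) \<Rightarrow> complex" where
  "log_char P m X t = Ln (\<integral>\<omega>. exp (\<i> * complex_of_real (\<Sum>j<m. t j * X j \<omega>)) \<partial>P)"

definition cumulant_exists :: "'w measure \<Rightarrow> nat \<Rightarrow> (nat \<Rightarrow> 'w \<Rightarrow> real) \<Rightarrow> bool" where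
  "cumulant_exists P m X \<longleftrightarrow> mixed_partial_exists m (log_char P m X) (\<lambda>_. 0)"

definition cumulant :: "'w measure \<Rightarrow> nat \<Rightarrow> (nat \<Rightarrow> 'w \<Rightarrow> real) \<Rightarrow> complex" where
  "cumulant P m X = (- \<i>) ^ m * mixed_partial m (log_char P m X) (\<lambda>_. 0)"

section \<open>Partitions\<close>

definition offset :: "(nat \<Rightarrow> nat) \<Rightarrow> nat \<Rightarrow> nat" where
  "offset q l = (\<Sum>i<l. q i)"

definition row :: "(nat \<Rightarrow> nat) \<Rightarrow> nat \<Rightarrow> nat set" where
  "row q l = {offset q l ..< offset q (Suc l)}"

definition Part :: "nat \<Rightarrow> (nat \<Rightarrow> nat) \<Rightarrow> nat set set set" where
  "Part m q = {\<sigma>. partition_on {..<offset q m} \<sigma> \<and>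
                  (\<forall>l<m. \<forall>B\<in>\<sigma>. card (B \<inter> row q l) \<le> 1)}"

definition row_relation :: "nat \<Rightarrow> (nat \<Rightarrow> nat) \<Rightarrow> nat set set \<Rightarrow> (nat \<times> nat) set" where
  "row_relation m q \<sigma> = {(i, j). i < m \<and> j < m \<and>
     (\<exists>B\<in>\<sigma>. B \<inter> row q i \<noteq> {} \<and> B \<inter> row q j \<noteq> {})}"

definition star_partition :: "nat \<Rightarrow> (nat \<Rightarrow> nat) \<Rightarrow> nat set set \<Rightarrow> nat set set" where
  "star_partition m q \<sigma> = {..<m} // (row_relation m q \<sigma>)\<^sup>*"

definition Part_tilde :: "nat \<Rightarrow> (nat \<Rightarrow> nat) \<Rightarrow> nat set set set" where
  "Part_tilde m q = {\<sigma> \<in> Part m q. card (star_partition m q \<sigma>) = 1}"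

definition Part_bar :: "nat \<Rightarrow> (nat \<Rightarrow> nat) \<Rightarrow> nat set set set" where
  "Part_bar m q = {\<sigma> \<in> Part m q. \<forall>l<m. \<exists>B\<in>\<sigma>. 2 \<le> card B \<and> B \<inter> row q l \<noteq> {}}"

definition tensor ::
    "nat \<Rightarrow> (nat \<Rightarrow> nat) \<Rightarrow> (nat \<Rightarrow> (nat \<Rightarrow> 'a) \<Rightarrow> real) \<Rightarrow> (nat \<Rightarrow> 'a) \<Rightarrow> real" where
  "tensor m q f x = (\<Prod>l<m. f l (\<lambda>i\<in>{..<q l}. x (offset q l + i)))"

text \<open>The new variables are indexed by the blocks themselves, so the \<open>|\<sigma>|\<close>-fold product measure
  is \<open>PiM \<sigma> (\<lambda>_. M)\<close>.\<close>

definition tensor_part ::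
    "nat \<Rightarrow> (nat \<Rightarrow> nat) \<Rightarrow> (nat \<Rightarrow> (nat \<Rightarrow> 'a) \<Rightarrow> real) \<Rightarrow> nat set set
       \<Rightarrow> (nat set \<Rightarrow> 'a) \<Rightarrow> real" where
  "tensor_part m q f \<sigma> y = tensor m q f (\<lambda>k. y (THE B. B \<in> \<sigma> \<and> k \<in> B))"

end

(*
  An integer-valued sigma-finite measure looks, on any countably generated sub-sigma-algebra, like a
  countable sum of point masses. Hence, for fixed data, its factorial measures are sums over injective
  tuples of points, and a product of factorial integrals is a sum over all row-wise injective maps;
  grouping these maps by their kernel gives the sum over transversal partitions. For a Poisson process
  the factorial measure of order k has intensity mu^k: on rectangles with pairwise equal or disjoint
  sides this is the formula for Poisson factorial moments together with independence. This yields all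
  mixed moments of non-negative U-statistics, and those of integrable ones by expanding signs.

  The moments over a set L of rows satisfy two recursions, from splitting a partition into the
  component of a fixed row and the rest, or into its active rows and singletons. Centered moments obey
  the second recursion, and the mixed derivatives of the logarithm of the characteristic function obey
  the first one by the Leibniz rule, so both formulas follow by induction on L.

  The moments of order mt are finite: for truncations of |f| the centered moment formula bounds the
  even centered moment uniformly by the integrals over the partitions in Part_bar. This already
  bounds every moment that occurs.
*)
theory Submission
  imports Defs
begin

section \<open>Countably generated sub-sigma-algebras\<close>

text \<open>The measurable space is arbitrary: singletons need not be measurable, and a realisation
  of \<eta> need not be a sum of point masses. A single identity, however, involves only countably
  many sets or functions. It is therefore checked over a countable family \<open>D\<close> adapted
  to it, with points that change with \<open>D\<close> and disappear again from
  \<open>prod_factorial_integrals\<close>. Even the countable additivity behind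
  \<open>factorial_measure\<close> is tested on one sequence of sets at a time.

  The formulas for functions of varying sign presuppose finite absolute moments, which is what the
  integrals over partitions are meant to yield. Truncation breaks this circle: for bounded functions
  with support of finite measure all moments exist, so the centered formula is available. An even
  order makes the centered power nonnegative, and the mean of the truncated statistic stays below
  the norm of \<open>f\<close>, so the full power is bounded independently of the truncation.

  The statistics are formed from \<eta>, which on a null event may put infinite mass on sets of
  finite intensity. Nothing ensures measurability there, hence the completion of
  \<open>P\<close>.\<close>

lemma sets_PiM_sigma_mono:
  assumes "D \<subseteq> D'" "D' \<subseteq> Pow \<Omega>"
  shows "sets (PiM J (\<lambda>_. sigma \<Omega> D)) \<subseteq> sets (PiM J (\<lambda>_. sigma \<Omega> D'))"
proof -
  have D: "D \<subseteq> Pow \<Omega>" using assms by auto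
  have "sigma_sets \<Omega> D \<subseteq> sigma_sets \<Omega> D'"
    by (rule sigma_sets_mono') (rule assms(1))
  then show ?thesis
    unfolding sets_PiM_single using D assms(2) by (simp, intro sigma_sets_mono') blast
qed

lemma sets_PiM_sigma_subset:
  assumes "D \<subseteq> sets M"
  shows "sets (PiM J (\<lambda>_. sigma (space M) D)) \<subseteq> sets (PiM J (\<lambda>_. M))"
proof -
  have "sets (PiM J (\<lambda>_. sigma (space M) D)) \<subseteq> sets (PiM J (\<lambda>_. sigma (space M) (sets M)))"
    by (rule sets_PiM_sigma_mono) (use assms sets.space_closed in auto)
  also have "\<dots> = sets (PiM J (\<lambda>_. M))"
    by (rule sets_PiM_cong) (simp_all add: sets.space_closed sets.sigma_sets_eq)
  finally show ?thesis .
qed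

lemma space_PiM_sigma:
  "space (PiM J (\<lambda>_. sigma (space M) D)) = space (PiM J (\<lambda>_. M))"
  by (simp add: space_PiM space_measure_of_conv)

text \<open>The sets that need only countably many generators form a sigma-algebra: a complement
  keeps \<open>D\<close>, a countable union takes the union of the families. This gives access to
  point representations, which are constructed only relative to a countable
  \<open>D\<close>.\<close>

lemma countable_generated_set:
  assumes "C \<in> sets (PiM J (\<lambda>_. M))"
  shows "\<exists>D. countable D \<and> D \<subseteq> sets M \<and> C \<in> sets (PiM J (\<lambda>_. sigma (space M) D))"
  using assms unfolding sets_PiM_single
proof (induction rule: sigma_sets.induct)
  case (Basic a)
  then obtain i A where iA: "a = {f \<in> \<Pi>\<^sub>E i\<in>J. space M. f i \<in> A}" "i \<in> J" "A \<in> sets M" by auto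
  have "A \<in> sigma_sets (space M) {A}" by auto
  then have "a \<in> sigma_sets (\<Pi>\<^sub>E i\<in>J. space (sigma (space M) {A}))
    {{f \<in> \<Pi>\<^sub>E i\<in>J. space (sigma (space M) {A}). f i \<in> B} |i B. i \<in> J \<and> B \<in> sets (sigma (space M) {A})}"
  proof (intro sigma_sets.Basic CollectI exI[of _ i] exI[of _ A] conjI)
    have "{A} \<subseteq> Pow (space M)" using iA sets.sets_into_space by auto
    then show "A \<in> sets (sigma (space M) {A})" by auto
  qed (use iA in \<open>simp_all add: space_measure_of_conv\<close>)
  then show ?case using iA by (intro exI[of _ "{A}"]) auto
next
  case Empty
  show ?case by (intro exI[of _ "{}"]) (auto intro: sigma_sets.Empty)
next
  case (Compl a)
  then obtain D where D: "countable D" "D \<subseteq> sets M" "a \<in> sets (PiM J (\<lambda>_. sigma (space M) D))"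
    unfolding sets_PiM_single by blast
  have "space (PiM J (\<lambda>_. sigma (space M) D)) - a \<in> sets (PiM J (\<lambda>_. sigma (space M) D))"
    using D by auto
  then have "(\<Pi>\<^sub>E i\<in>J. space M) - a \<in> sets (PiM J (\<lambda>_. sigma (space M) D))"
    by (simp only: space_PiM_sigma) (simp add: space_PiM)
  then show ?case using D unfolding sets_PiM_single by blast
next
  case (Union a)
  then have "\<forall>n. \<exists>D. countable D \<and> D \<subseteq> sets M \<and> a n \<in> sets (PiM J (\<lambda>_. sigma (space M) D))"
    unfolding sets_PiM_single by blast
  then obtain D where D: "\<And>n. countable (D n)" "\<And>n. D n \<subseteq> sets M"
      "\<And>n. a n \<in> sets (PiM J (\<lambda>_. sigma (space M) (D n)))" by metis
  have sub: "(\<Union>n. D n) \<subseteq> sets M" using D by auto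
  have "a n \<in> sets (PiM J (\<lambda>_. sigma (space M) (\<Union>n. D n)))" for n
    using sets_PiM_sigma_mono[of "D n" "\<Union>n. D n" "space M" J] D(3)[of n] sub sets.space_closed
    by blast
  then have "(\<Union>n. a n) \<in> sets (PiM J (\<lambda>_. sigma (space M) (\<Union>n. D n)))" by auto
  then show ?case using D sub unfolding sets_PiM_single by (intro exI[of _ "\<Union>n. D n"]) auto
qed

lemma countable_generated_sets:
  fixes C :: "'i \<Rightarrow> ('j \<Rightarrow> 'a) set"
  assumes "\<And>i. i \<in> I \<Longrightarrow> C i \<in> sets (PiM (J i) (\<lambda>_. M))" "countable I"
  shows "\<exists>D. countable D \<and> D \<subseteq> sets M \<and> (\<forall>i\<in>I. C i \<in> sets (PiM (J i) (\<lambda>_. sigma (space M) D)))"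
proof -
  have "\<forall>i\<in>I. \<exists>D. countable D \<and> D \<subseteq> sets M \<and> C i \<in> sets (PiM (J i) (\<lambda>_. sigma (space M) D))"
    using countable_generated_set[OF assms(1)] by blast
  then obtain D where D: "\<And>i. i \<in> I \<Longrightarrow> countable (D i)" "\<And>i. i \<in> I \<Longrightarrow> D i \<subseteq> sets M"
      "\<And>i. i \<in> I \<Longrightarrow> C i \<in> sets (PiM (J i) (\<lambda>_. sigma (space M) (D i)))" by metis
  have sub: "(\<Union>i\<in>I. D i) \<subseteq> sets M" using D by auto
  have "C i \<in> sets (PiM (J i) (\<lambda>_. sigma (space M) (\<Union>i\<in>I. D i)))" if "i \<in> I" for i
    using sets_PiM_sigma_mono[of "D i" "\<Union>i\<in>I. D i" "space M" "J i"] D(3)[OF that] sub that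
      sets.space_closed by blast
  then show ?thesis using D sub assms(2) by (intro exI[of _ "\<Union>i\<in>I. D i"]) auto
qed

text \<open>A countable base of the target space determines measurability, so countably many
  functions produce only countably many preimages to cover.\<close>

lemma countable_generated_functions:
  fixes f :: "'i \<Rightarrow> ('j \<Rightarrow> 'a) \<Rightarrow> 'b :: second_countable_topology"
  assumes f: "\<And>i. i \<in> I \<Longrightarrow> f i \<in> borel_measurable (PiM (J i) (\<lambda>_. M))" and I: "countable I"
  shows "\<exists>D. countable D \<and> D \<subseteq> sets M \<and>
    (\<forall>i\<in>I. f i \<in> borel_measurable (PiM (J i) (\<lambda>_. sigma (space M) D)))"
proof -
  obtain B :: "'b set set" where B: "countable B" "topological_basis B"
    using ex_countable_basis by blast
  have beq: "borel = sigma UNIV B" using B by (rule borel_eq_countable_basis)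
  define C where "C = (\<lambda>(i, b). f i -` b \<inter> space (PiM (J i) (\<lambda>_. M)))"
  have "\<exists>D. countable D \<and> D \<subseteq> sets M \<and>
    (\<forall>x\<in>I \<times> B. C x \<in> sets (PiM (J (fst x)) (\<lambda>_. sigma (space M) D)))"
  proof (rule countable_generated_sets)
    show "C x \<in> sets (PiM (J (fst x)) (\<lambda>_. M))" if x: "x \<in> I \<times> B" for x
    proof -
      obtain i b where ib: "x = (i, b)" "i \<in> I" "b \<in> B" using x by auto
      have "open b" using B ib topological_basis_open by blast
      then show ?thesis unfolding C_def using ib by (auto intro!: measurable_sets[OF f])
    qed
  qed (use I B in auto)
  then obtain D where D: "countable D" "D \<subseteq> sets M"
    "\<forall>x\<in>I \<times> B. C x \<in> sets (PiM (J (fst x)) (\<lambda>_. sigma (space M) D))" by blast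
  have "f i \<in> borel_measurable (PiM (J i) (\<lambda>_. sigma (space M) D))" if i: "i \<in> I" for i
    unfolding beq
  proof (rule measurable_measure_of)
    fix y assume "y \<in> B"
    then show "f i -` y \<inter> space (PiM (J i) (\<lambda>_. sigma (space M) D)) \<in> sets (PiM (J i) (\<lambda>_. sigma (space M) D))"
      using D(3) i unfolding C_def space_PiM_sigma by force
  qed auto
  then show ?thesis using D by blast
qed

section \<open>Atomic representation of integer-valued measures\<close>

definition integer_valued :: "'a measure \<Rightarrow> bool" where
  "integer_valued \<nu> \<longleftrightarrow> (\<forall>B\<in>sets \<nu>. emeasure \<nu> B \<in> insert \<infinity> (range of_nat))"

text \<open>Bisection along \<open>D 0\<close>, \<open>D 1\<close>, and so on, always keeping a part
  of positive measure. Integer values force measure at least 1 at every stage, and since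
  \<open>B\<close> has finite measure, continuity from above carries this bound to the intersection.
  The result acts as an atom for the sets \<open>D i\<close>, although it need not be a
  point.\<close>

lemma integer_valued_atom:
  fixes D :: "nat \<Rightarrow> 'a set"
  assumes iv: "integer_valued \<nu>" and D: "\<And>i. D i \<in> sets \<nu>"
    and B: "B \<in> sets \<nu>" and pos: "emeasure \<nu> B \<noteq> 0" and fin: "emeasure \<nu> B \<noteq> \<infinity>"
  shows "\<exists>Z\<in>sets \<nu>. Z \<subseteq> B \<and> emeasure \<nu> Z \<noteq> 0 \<and> (\<forall>i. Z \<subseteq> D i \<or> Z \<inter> D i = {})"
proof -
  define G where "G = rec_nat B (\<lambda>i g. if emeasure \<nu> (g \<inter> D i) \<noteq> 0 then g \<inter> D i else g - D i)"
  have G0: "G 0 = B" by (simp add: G_def)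
  have GS: "G (Suc i) = (if emeasure \<nu> (G i \<inter> D i) \<noteq> 0 then G i \<inter> D i else G i - D i)" for i
    by (simp add: G_def)
  have Gs: "G i \<in> sets \<nu>" for i
    by (induction i) (auto simp: G0 GS B D)
  have Gpos: "emeasure \<nu> (G i) \<noteq> 0" for i
  proof (induction i)
    case (Suc i)
    have "emeasure \<nu> (G i) = emeasure \<nu> (G i \<inter> D i) + emeasure \<nu> (G i - D i)"
      using Gs D by (subst plus_emeasure) (auto intro: arg_cong[where f="emeasure \<nu>"])
    then show ?case using Suc by (auto simp: GS)
  qed (simp add: G0 pos)
  have GB: "G i \<subseteq> B" for i
    by (induction i) (auto simp: G0 GS)
  have dec: "decseq G" by (rule decseq_SucI) (auto simp: GS)
  \<comment> \<open>The gap between 0 and 1 is essential: mere positivity could be lost in the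
    limit.\<close>
  have ge1: "1 \<le> emeasure \<nu> (G i)" for i
  proof -
    have "emeasure \<nu> (G i) \<in> insert \<infinity> (range of_nat)" using iv Gs unfolding integer_valued_def by blast
    then consider "emeasure \<nu> (G i) = \<infinity>" | n :: nat where "emeasure \<nu> (G i) = of_nat n" by blast
    then show ?thesis
    proof cases
      case 2
      then have "n \<ge> 1" using Gpos[of i] by (cases n) auto
      then have "(of_nat 1 :: ennreal) \<le> of_nat n" by (simp only: of_nat_le_iff)
      then show ?thesis using 2 by simp
    qed simp
  qed
  have "emeasure \<nu> (\<Inter>i. G i) = (INF i. emeasure \<nu> (G i))"
  proof (rule INF_emeasure_decseq[symmetric])
    show "emeasure \<nu> (G i) \<noteq> \<infinity>" for i
      using emeasure_mono[OF GB[of i] B] fin by (auto simp: top_unique)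
  qed (use Gs dec in auto)
  also have "\<dots> \<ge> 1" using ge1 by (intro INF_greatest)
  finally have "emeasure \<nu> (\<Inter>i. G i) \<noteq> 0" by auto
  moreover have "(\<Inter>i. G i) \<subseteq> D i \<or> (\<Inter>i. G i) \<inter> D i = {}" for i
  proof -
    have "G (Suc i) \<subseteq> D i \<or> G (Suc i) \<inter> D i = {}" by (auto simp: GS)
    then show ?thesis by blast
  qed
  moreover have "(\<Inter>i. G i) \<in> sets \<nu>" using Gs by auto
  moreover have "(\<Inter>i. G i) \<subseteq> B" using GB by auto
  ultimately show ?thesis by blast
qed

text \<open>The property of containing or missing \<open>Z\<close> is stable under complements and
  countable unions.\<close>

lemma sigma_sets_atom:
  assumes "E \<in> sigma_sets \<Omega> D" "Z \<subseteq> \<Omega>" "\<And>A. A \<in> D \<Longrightarrow> Z \<subseteq> A \<or> Z \<inter> A = {}"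
  shows "Z \<subseteq> E \<or> Z \<inter> E = {}"
  using assms(1) by induction (use assms in \<open>blast+\<close>)

text \<open>Strong induction on the mass \<open>n\<close>: an unsplittable set \<open>Z\<close> of
  mass \<open>k > 0\<close> is removed and replaced by \<open>k\<close> copies of one of its points,
  and the induction hypothesis treats \<open>B - Z\<close>. Lists record multiplicities.\<close>

lemma integer_valued_points_finite:
  fixes D :: "'a set set"
  assumes iv: "integer_valued \<nu>" and D: "countable D" "D \<subseteq> sets \<nu>"
    and B: "B \<in> sets \<nu>" "emeasure \<nu> B = of_nat n"
  shows "\<exists>xs. set xs \<subseteq> B \<and> (\<forall>E\<in>sigma_sets (space \<nu>) D.
           emeasure \<nu> (E \<inter> B) = of_nat (length (filter (\<lambda>x. x \<in> E) xs)))"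
  using B
proof (induction n arbitrary: B rule: less_induct)
  case (less n)
  have Es: "E \<in> sets \<nu>" if "E \<in> sigma_sets (space \<nu>) D" for E
    using that D(2) sets.sigma_sets_subset by blast
  show ?case
  proof (cases "n = 0")
    case True
    have "emeasure \<nu> (E \<inter> B) = 0" for E
      using emeasure_mono[of "E \<inter> B" B \<nu>] less.prems True by auto
    then show ?thesis by (intro exI[of _ "[]"]) auto
  next
    case False
    \<comment> \<open>\<open>D\<close> may be empty; adding the empty set gives a nonempty family to
      enumerate and imposes no further condition on \<open>Z\<close>.\<close>
    define D' where "D' = from_nat_into (insert {} D)"
    have rD: "range D' = insert {} D" unfolding D'_def using D by (intro range_from_nat_into) auto
    have "D' i \<in> sets \<nu>" for i
    proof -
      have "D' i \<in> insert {} D" using rD by auto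
      then show ?thesis using D by auto
    qed
    moreover have "emeasure \<nu> B \<noteq> 0" "emeasure \<nu> B \<noteq> \<infinity>" using less.prems False by auto
    ultimately obtain Z where Z: "Z \<in> sets \<nu>" "Z \<subseteq> B" "emeasure \<nu> Z \<noteq> 0"
        "\<forall>i. Z \<subseteq> D' i \<or> Z \<inter> D' i = {}"
      using integer_valued_atom[OF iv, of D' B] less.prems by blast
    have ZD: "Z \<subseteq> A \<or> Z \<inter> A = {}" if "A \<in> D" for A
      using Z(4) that rD by (metis insertCI rangeE)
    have "emeasure \<nu> Z \<le> of_nat n" using emeasure_mono[OF Z(2) less.prems(1)] less.prems(2) by simp
    then have "emeasure \<nu> Z \<noteq> \<infinity>" by (auto simp: top_unique)
    then obtain k :: nat where k: "emeasure \<nu> Z = of_nat k"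
      using iv Z(1) unfolding integer_valued_def by blast
    have k0: "k \<noteq> 0" using Z k by auto
    have "Z \<union> (B - Z) = B" using Z by auto
    then have "emeasure \<nu> B = emeasure \<nu> Z + emeasure \<nu> (B - Z)"
      using plus_emeasure[of Z \<nu> "B - Z"] less.prems(1) Z(1) by simp
    moreover have kn: "k \<le> n" using \<open>emeasure \<nu> Z \<le> of_nat n\<close> k by simp
    moreover have "(of_nat n :: ennreal) = of_nat k + of_nat (n - k)"
      unfolding of_nat_add[symmetric] using kn by simp
    ultimately have "of_nat k + emeasure \<nu> (B - Z) = of_nat k + of_nat (n - k)"
      using k less.prems(2) by argo
    then have eBZ: "emeasure \<nu> (B - Z) = of_nat (n - k)" by (simp add: ennreal_add_left_cancel)
    then obtain xs where xs: "set xs \<subseteq> B - Z" "\<forall>E\<in>sigma_sets (space \<nu>) D.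
           emeasure \<nu> (E \<inter> (B - Z)) = of_nat (length (filter (\<lambda>x. x \<in> E) xs))"
      using less.IH[OF _ sets.Diff[OF less.prems(1) Z(1)] eBZ] k0 kn False by auto
    have "Z \<noteq> {}" using Z(3) by auto
    \<comment> \<open>Any point of \<open>Z\<close> will do: by \<open>sigma_sets_atom\<close> no
      set \<open>E\<close> of the generated sigma-algebra separates two points of
      \<open>Z\<close>.\<close>
    then obtain z where z: "z \<in> Z" by blast
    show ?thesis
    proof (intro exI[of _ "replicate k z @ xs"] conjI ballI)
      show "set (replicate k z @ xs) \<subseteq> B" using xs z Z by auto
    next
      fix E assume E: "E \<in> sigma_sets (space \<nu>) D"
      have "(E \<inter> Z) \<union> (E \<inter> (B - Z)) = E \<inter> B" "(E \<inter> Z) \<inter> (E \<inter> (B - Z)) = {}" using Z(2) by auto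
      then have "emeasure \<nu> (E \<inter> B) = emeasure \<nu> (E \<inter> Z) + emeasure \<nu> (E \<inter> (B - Z))"
        using plus_emeasure[of "E \<inter> Z" \<nu> "E \<inter> (B - Z)"] less.prems(1) Z(1) Es[OF E] by simp
      moreover have "Z \<subseteq> E \<or> Z \<inter> E = {}"
        by (rule sigma_sets_atom[OF E sets.sets_into_space[OF Z(1)] ZD])
      then have "emeasure \<nu> (E \<inter> Z) = of_nat (length (filter (\<lambda>x. x \<in> E) (replicate k z)))"
      proof
        assume "Z \<subseteq> E"
        then have "E \<inter> Z = Z" "z \<in> E" using z by auto
        then show ?thesis using k by simp
      next
        assume "Z \<inter> E = {}"
        then have "E \<inter> Z = {}" "z \<notin> E" using z by auto
        then show ?thesis by simp
      qed
      moreover have "emeasure \<nu> (E \<inter> (B - Z)) = of_nat (length (filter (\<lambda>x. x \<in> E) xs))"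
        using xs(2) E by blast
      ultimately show "emeasure \<nu> (E \<inter> B) = of_nat (length (filter (\<lambda>x. x \<in> E) (replicate k z @ xs)))"
        by (simp only: filter_append length_append of_nat_add)
    qed
  qed
qed

text \<open>Points carry indices, so that coinciding points count with multiplicity. The formula is
  asked on the sigma-algebra generated by \<open>D\<close> only; \<open>I\<close> and
  \<open>p\<close> change with \<open>D\<close>, and on all measurable sets there may be no such
  representation.\<close>

definition point_representation ::
    "'a measure \<Rightarrow> 'a set set \<Rightarrow> 'i set \<Rightarrow> ('i \<Rightarrow> 'a) \<Rightarrow> bool" where
  "point_representation \<nu> D I p \<longleftrightarrow> countable I \<and> p ` I \<subseteq> space \<nu> \<and>
     (\<forall>E\<in>sigma_sets (space \<nu>) D. emeasure \<nu> E = (\<integral>\<^sup>+ i. indicator E (p i) \<partial>count_space I))"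

text \<open>Sigma-finiteness cuts the space into disjoint pieces of finite mass. The index
  \<open>(i, j)\<close> stands for the \<open>j\<close>-th entry of the list of piece
  \<open>i\<close>, which explains the index type.\<close>

lemma point_representation_exists:
  fixes \<nu> :: "'a measure"
  assumes iv: "integer_valued \<nu>" and sf: "sigma_finite_measure \<nu>" and D: "countable D" "D \<subseteq> sets \<nu>"
  shows "\<exists>(I :: (nat \<times> nat) set) p. point_representation \<nu> D I p"
proof -
  interpret sigma_finite_measure \<nu> by fact
  obtain A :: "nat \<Rightarrow> 'a set" where A: "range A \<subseteq> sets \<nu>" "(\<Union>i. A i) = space \<nu>"
      "\<And>i. emeasure \<nu> (A i) \<noteq> \<infinity>" "disjoint_family A"
    using sigma_finite_disjoint by metis
  have "\<exists>xs. set xs \<subseteq> A i \<and> (\<forall>E\<in>sigma_sets (space \<nu>) D.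
           emeasure \<nu> (E \<inter> A i) = of_nat (length (filter (\<lambda>x. x \<in> E) xs)))" for i
  proof -
    have "A i \<in> sets \<nu>" using A by auto
    moreover then obtain n where "emeasure \<nu> (A i) = of_nat n"
      using iv A(3)[of i] unfolding integer_valued_def by blast
    ultimately show ?thesis using integer_valued_points_finite[OF iv D] by blast
  qed
  then obtain xs where xs: "\<And>i. set (xs i) \<subseteq> A i"
     "\<And>i E. E \<in> sigma_sets (space \<nu>) D \<Longrightarrow>
           emeasure \<nu> (E \<inter> A i) = of_nat (length (filter (\<lambda>x. x \<in> E) (xs i)))" by metis
  define I where "I = (SIGMA i:UNIV. {..<length (xs i)})"
  define p where "p = (\<lambda>(i, j). xs i ! j)"
  have "emeasure \<nu> E = (\<integral>\<^sup>+ i. indicator E (p i) \<partial>count_space I)"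
    if E: "E \<in> sigma_sets (space \<nu>) D" for E
  proof -
    have Es: "E \<in> sets \<nu>" using E D(2) sets.sigma_sets_subset by blast
    have "emeasure \<nu> E = emeasure \<nu> (\<Union>i. E \<inter> A i)"
      using Es A(2) sets.sets_into_space[OF Es] by (intro arg_cong[where f="emeasure \<nu>"]) auto
    also have "\<dots> = (\<Sum>i. emeasure \<nu> (E \<inter> A i))"
      using Es A by (intro suminf_emeasure[symmetric]) (fastforce simp: disjoint_family_on_def)+
    also have "\<dots> = (\<Sum>i. \<integral>\<^sup>+ j. indicator I (i, j) * indicator E (p (i, j)) \<partial>count_space UNIV)"
    proof (rule suminf_cong)
      fix i
      have "emeasure \<nu> (E \<inter> A i) = of_nat (card {j. j < length (xs i) \<and> xs i ! j \<in> E})"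
        using xs(2)[OF E] by (simp add: length_filter_conv_card)
      also have "\<dots> = (\<integral>\<^sup>+ j. indicator {j. j < length (xs i) \<and> xs i ! j \<in> E} j \<partial>count_space UNIV)"
        by (subst nn_integral_indicator) auto
      also have "\<dots> = (\<integral>\<^sup>+ j. indicator I (i, j) * indicator E (p (i, j)) \<partial>count_space UNIV)"
        by (intro nn_integral_cong) (auto simp: I_def p_def split: split_indicator)
      finally show "emeasure \<nu> (E \<inter> A i) = (\<integral>\<^sup>+ j. indicator I (i, j) * indicator E (p (i, j)) \<partial>count_space UNIV)" .
    qed
    also have "\<dots> = (\<integral>\<^sup>+ i. \<integral>\<^sup>+ j. indicator I (i, j) * indicator E (p (i, j)) \<partial>count_space UNIV \<partial>count_space UNIV)"
      by (subst nn_integral_count_space_nat) simp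
    also have "\<dots> = (\<integral>\<^sup>+ x. indicator I x * indicator E (p x) \<partial>count_space UNIV)"
      by (subst nn_integral_fst_count_space) simp
    also have "\<dots> = (\<integral>\<^sup>+ i. indicator E (p i) \<partial>count_space I)"
      by (subst nn_integral_count_space_indicator) (auto simp: mult.commute intro!: nn_integral_cong)
    finally show ?thesis .
  qed
  moreover have "p ` I \<subseteq> space \<nu>"
  proof -
    have "xs i ! j \<in> space \<nu>" if "j < length (xs i)" for i j
      using xs(1)[of i] that A(2) nth_mem by blast
    then show ?thesis by (auto simp: I_def p_def)
  qed
  moreover have "countable I" by simp
  ultimately show ?thesis unfolding point_representation_def by blast
qed

section \<open>Factorial measures as sums over injective tuples\<close>

text \<open>Applied to indices, not to points: two copies of a multiple point may both occur in a
  tuple, as they do in the factorial measure.\<close>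

definition inj_tuples :: "'j set \<Rightarrow> 'i set \<Rightarrow> ('j \<Rightarrow> 'i) set" where
  "inj_tuples J I = {k \<in> J \<rightarrow>\<^sub>E I. inj_on k J}"

definition tuple_at :: "'j set \<Rightarrow> ('i \<Rightarrow> 'a) \<Rightarrow> ('j \<Rightarrow> 'i) \<Rightarrow> 'j \<Rightarrow> 'a" where
  "tuple_at J p k = (\<lambda>j\<in>J. p (k j))"

lemma countable_inj_tuples: "finite J \<Longrightarrow> countable I \<Longrightarrow> countable (inj_tuples J I)"
  unfolding inj_tuples_def by (rule countable_subset[OF _ countable_PiE[of J "\<lambda>_. I"]]) auto

lemma tuple_at_in_PiE: "p ` I \<subseteq> X \<Longrightarrow> k \<in> inj_tuples J I \<Longrightarrow> tuple_at J p k \<in> J \<rightarrow>\<^sub>E X"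
  unfolding inj_tuples_def tuple_at_def by auto

text \<open>Extending an injective tuple means choosing an index outside its range; the excluded
  indices are those that the Dirac masses in \<open>factorial_measure\<close> take away.\<close>

lemma inj_tuples_Suc_bij:
  "bij_betw (\<lambda>(k, j). k(q := j)) (SIGMA k : inj_tuples {..<q} I. I - k ` {..<q}) (inj_tuples {..<Suc q} I)"
proof (rule bij_betwI[where g = "\<lambda>k. (restrict k {..<q}, k q)"])
  show "(\<lambda>(k, j). k(q := j)) \<in> (SIGMA k : inj_tuples {..<q} I. I - k ` {..<q}) \<rightarrow> inj_tuples {..<Suc q} I"
    by (auto simp: inj_tuples_def lessThan_Suc PiE_iff extensional_def inj_on_def)
  show "(\<lambda>k. (restrict k {..<q}, k q)) \<in> inj_tuples {..<Suc q} I \<rightarrow> (SIGMA k : inj_tuples {..<q} I. I - k ` {..<q})"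
    by (auto simp: inj_tuples_def lessThan_Suc PiE_iff extensional_def inj_on_def)
  show "(restrict ((\<lambda>(k, j). k(q := j)) x) {..<q}, ((\<lambda>(k, j). k(q := j)) x) q) = x"
    if "x \<in> (SIGMA k : inj_tuples {..<q} I. I - k ` {..<q})" for x
    using that by (auto simp: inj_tuples_def PiE_iff extensional_def fun_eq_iff)
  show "(\<lambda>(k, j). k(q := j)) (restrict k {..<q}, k q) = k" if "k \<in> inj_tuples {..<Suc q} I" for k
    using that by (auto simp: inj_tuples_def PiE_iff extensional_def fun_eq_iff)
qed

lemma nn_integral_count_space_Sigma:
  "(\<integral>\<^sup>+ a. (\<integral>\<^sup>+ b. f (a, b) \<partial>count_space (B a)) \<partial>count_space A) = (\<integral>\<^sup>+ x. f x \<partial>count_space (Sigma A B))"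
proof -
  have "(\<integral>\<^sup>+ a. (\<integral>\<^sup>+ b. f (a, b) \<partial>count_space (B a)) \<partial>count_space A) =
    (\<integral>\<^sup>+ a. (\<integral>\<^sup>+ b. f (a, b) * indicator (B a) b \<partial>count_space UNIV) * indicator A a \<partial>count_space UNIV)"
    by (simp add: nn_integral_count_space_indicator)
  also have "\<dots> = (\<integral>\<^sup>+ a. (\<integral>\<^sup>+ b. f (a, b) * indicator (Sigma A B) (a, b) \<partial>count_space UNIV) \<partial>count_space UNIV)"
    by (intro nn_integral_cong) (auto simp: indicator_def)
  also have "\<dots> = (\<integral>\<^sup>+ x. f x * indicator (Sigma A B) x \<partial>count_space UNIV)"
    by (rule nn_integral_fst_count_space)
  also have "\<dots> = (\<integral>\<^sup>+ x. f x \<partial>count_space (Sigma A B))"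
    by (simp add: nn_integral_count_space_indicator)
  finally show ?thesis .
qed

lemma nn_integral_count_space_subset:
  assumes "K \<subseteq> I"
  shows "(\<integral>\<^sup>+ i. h i * indicator K i \<partial>count_space I) = (\<integral>\<^sup>+ i. h i \<partial>count_space K)"
proof -
  have "(\<integral>\<^sup>+ i. h i * indicator K i * indicator I i \<partial>count_space UNIV) = (\<integral>\<^sup>+ i. h i * indicator K i \<partial>count_space UNIV)"
    using assms by (intro nn_integral_cong) (auto split: split_indicator)
  then show ?thesis by (simp add: nn_integral_count_space_indicator)
qed

lemma space_factorial_measure: "space (factorial_measure \<nu> q) = ({..<q} \<rightarrow>\<^sub>E space \<nu>)"
  by (cases q) (auto simp: space_PiM space_measure_of_conv)

lemma sets_factorial_measure: "sets (factorial_measure \<nu> q) = sets (PiM {..<q} (\<lambda>_. \<nu>))"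
  by (cases q) auto

text \<open>Both sides integrate \<open>g\<close> against push-forwards to the coarser product
  sigma-algebra, along the identity and along \<open>tuple_at\<close>, and these images coincide by
  \<open>F\<close>. In the induction on the order, \<open>F\<close> is the induction
  hypothesis.\<close>

lemma nn_integral_factorial_measure_aux:
  assumes D: "D \<subseteq> sets \<nu>"
    and rep: "point_representation \<nu> D I p"
    and F: "\<And>C. C \<in> sets (PiM {..<q} (\<lambda>_. sigma (space \<nu>) D)) \<Longrightarrow> emeasure (factorial_measure \<nu> q) C =
      (\<integral>\<^sup>+ k. indicator C (tuple_at {..<q} p k) \<partial>count_space (inj_tuples {..<q} I))"
    and g: "g \<in> borel_measurable (PiM {..<q} (\<lambda>_. sigma (space \<nu>) D))"
  shows "(\<integral>\<^sup>+ x. g x \<partial>factorial_measure \<nu> q) =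
    (\<integral>\<^sup>+ k. g (tuple_at {..<q} p k) \<partial>count_space (inj_tuples {..<q} I))"
proof -
  define N where "N = PiM {..<q} (\<lambda>_. sigma (space \<nu>) D)"
  let ?F = "factorial_measure \<nu> q" and ?K = "count_space (inj_tuples {..<q} I)"
  have spN: "space N = ({..<q} \<rightarrow>\<^sub>E space \<nu>)" by (simp add: N_def space_PiM space_measure_of_conv)
  have id: "(\<lambda>x. x) \<in> measurable ?F N"
  proof (rule measurableI)
    fix A assume "A \<in> sets N"
    then have "A \<in> sets (PiM {..<q} (\<lambda>_. \<nu>))" using sets_PiM_sigma_subset[OF D] unfolding N_def by blast
    then show "(\<lambda>x. x) -` A \<inter> space ?F \<in> sets ?F" by (auto simp: sets_factorial_measure[symmetric])
  qed (simp add: spN space_factorial_measure)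
  have pm: "tuple_at {..<q} p \<in> measurable ?K N"
    using rep tuple_at_in_PiE[of p I "space \<nu>"] by (auto simp: point_representation_def spN)
  have "distr ?F N (\<lambda>x. x) = distr ?K N (tuple_at {..<q} p)"
  proof (rule measure_eqI)
    fix A assume "A \<in> sets (distr ?F N (\<lambda>x. x))"
    then have A: "A \<in> sets N" by simp
    have "A \<inter> space ?F = A" using sets.sets_into_space[OF A] by (auto simp: spN space_factorial_measure)
    then have "emeasure (distr ?F N (\<lambda>x. x)) A = emeasure ?F A"
      using A id by (simp add: emeasure_distr)
    also have "\<dots> = (\<integral>\<^sup>+ k. indicator A (tuple_at {..<q} p k) \<partial>?K)"
      using F A by (auto simp: N_def)
    also have "\<dots> = (\<integral>\<^sup>+ x. indicator A x \<partial>distr ?K N (tuple_at {..<q} p))"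
      using A pm by (subst nn_integral_distr) (auto simp: borel_measurable_indicator)
    also have "\<dots> = emeasure (distr ?K N (tuple_at {..<q} p)) A"
      using A by simp
    finally show "emeasure (distr ?F N (\<lambda>x. x)) A = emeasure (distr ?K N (tuple_at {..<q} p)) A" .
  qed simp
  moreover have "(\<integral>\<^sup>+ y. g y \<partial>?F) = (\<integral>\<^sup>+ y. g y \<partial>distr ?F N (\<lambda>x. x))"
    using id g by (subst nn_integral_distr) (auto simp: N_def)
  moreover have "(\<integral>\<^sup>+ y. g y \<partial>distr ?K N (tuple_at {..<q} p)) = (\<integral>\<^sup>+ i. g (tuple_at {..<q} p i) \<partial>?K)"
    using pm g by (subst nn_integral_distr) (auto simp: N_def)
  ultimately show ?thesis by simp
qed

text \<open>Stated for the defining integral, not for \<open>emeasure\<close> of the measure of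
  order \<open>Suc q\<close>: \<open>measure_of\<close> takes these values only once countable
  additivity is known, and that will be derived from this formula.\<close>

lemma emeasure_factorial_measure_Suc_aux:
  assumes D: "D \<subseteq> sets \<nu>"
    and rep: "point_representation \<nu> D I p"
    and F: "\<And>C. C \<in> sets (PiM {..<q} (\<lambda>_. sigma (space \<nu>) D)) \<Longrightarrow> emeasure (factorial_measure \<nu> q) C =
      (\<integral>\<^sup>+ k. indicator C (tuple_at {..<q} p k) \<partial>count_space (inj_tuples {..<q} I))"
    and C: "C \<in> sets (PiM {..<Suc q} (\<lambda>_. sigma (space \<nu>) D))"
  shows "(\<integral>\<^sup>+ x. (emeasure \<nu> {y \<in> space \<nu>. x(q := y) \<in> C}
                    - (\<Sum>i<q. indicator C (x(q := x i)))) \<partial>factorial_measure \<nu> q) =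
    (\<integral>\<^sup>+ k. indicator C (tuple_at {..<Suc q} p k) \<partial>count_space (inj_tuples {..<Suc q} I))"
proof -
  define N where "N = sigma (space \<nu>) D"
  have DP: "D \<subseteq> Pow (space \<nu>)" using D sets.space_closed by blast
  have spN: "space N = space \<nu>" by (simp add: N_def space_measure_of_conv)
  have cI: "countable I" and pI: "p ` I \<subseteq> space \<nu>" using rep by (auto simp: point_representation_def)
  have C': "C \<in> sets (PiM (insert q {..<q}) (\<lambda>_. N))" using C by (simp add: N_def lessThan_Suc)
  have upd: "(\<lambda>x. x(q := h x)) \<in> measurable (PiM {..<q} (\<lambda>_. N)) (PiM (insert q {..<q}) (\<lambda>_. N))"
    if "h \<in> measurable (PiM {..<q} (\<lambda>_. N)) N" for h
    using that by (intro measurable_fun_upd[where J="{..<q}"]) auto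
  have upd2: "(\<lambda>y. x(q := y)) \<in> measurable N (PiM (insert q {..<q}) (\<lambda>_. N))"
    if "x \<in> space (PiM {..<q} (\<lambda>_. N))" for x
    using that by (intro measurable_component_update) auto
  have em: "emeasure \<nu> {y \<in> space \<nu>. x(q := y) \<in> C} = (\<integral>\<^sup>+ i. indicator C (x(q := p i)) \<partial>count_space I)"
    if x: "x \<in> space (PiM {..<q} (\<lambda>_. N))" for x
  proof -
    have "(\<lambda>y. x(q := y)) -` C \<inter> space N \<in> sets N" using measurable_sets[OF upd2[OF x] C'] .
    then have "{y \<in> space \<nu>. x(q := y) \<in> C} \<in> sigma_sets (space \<nu>) D"
      using DP by (simp add: N_def space_measure_of_conv vimage_def Int_def conj_commute)
    then have "emeasure \<nu> {y \<in> space \<nu>. x(q := y) \<in> C} =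
      (\<integral>\<^sup>+ i. indicator {y \<in> space \<nu>. x(q := y) \<in> C} (p i) \<partial>count_space I)"
      using rep by (auto simp: point_representation_def)
    also have "\<dots> = (\<integral>\<^sup>+ i. indicator C (x(q := p i)) \<partial>count_space I)"
      using pI by (intro nn_integral_cong) (auto split: split_indicator)
    finally show ?thesis .
  qed
  define g where "g = (\<lambda>x. (\<integral>\<^sup>+ i. indicator C (x(q := p i)) \<partial>count_space I) - (\<Sum>i<q. indicator C (x(q := x i)) :: ennreal))"
  have m1: "(\<lambda>x. \<integral>\<^sup>+ i. indicator C (x(q := p i)) \<partial>count_space I) \<in> borel_measurable (PiM {..<q} (\<lambda>_. N))"
  proof -
    interpret sigma_finite_measure "count_space I" using cI by (rule sigma_finite_measure_count_space_countable)
    have *: "(\<lambda>z. indicator C ((fst z)(q := p (snd z))) :: ennreal) \<in> borel_measurable (PiM {..<q} (\<lambda>_. N) \<Otimes>\<^sub>M count_space I)"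
    proof (rule measurable_compose_countable'[where I=I and f = "\<lambda>i z. indicator C ((fst z)(q := p i))" and g=snd])
      fix i assume i: "i \<in> I"
      have "(\<lambda>x. indicator C (x(q := p i)) :: ennreal) \<in> borel_measurable (PiM {..<q} (\<lambda>_. N))"
      proof (rule measurable_compose[OF upd borel_measurable_indicator[OF C']])
        show "(\<lambda>_. p i) \<in> measurable (PiM {..<q} (\<lambda>_. N)) N"
          using pI i spN by (intro measurable_const) auto
      qed
      from measurable_compose[OF measurable_fst this]
      show "(\<lambda>z. indicator C ((fst z)(q := p i)) :: ennreal) \<in> borel_measurable (PiM {..<q} (\<lambda>_. N) \<Otimes>\<^sub>M count_space I)" .
    qed (use cI in auto)
    show ?thesis using borel_measurable_nn_integral[of "\<lambda>x i. indicator C (x(q := p i))"] * by (simp add: case_prod_beta')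
  qed
  have m2: "(\<lambda>x. (\<Sum>i<q. indicator C (x(q := x i))) :: ennreal) \<in> borel_measurable (PiM {..<q} (\<lambda>_. N))"
  proof (rule borel_measurable_sum)
    fix i assume i: "i \<in> {..<q}"
    show "(\<lambda>x. indicator C (x(q := x i)) :: ennreal) \<in> borel_measurable (PiM {..<q} (\<lambda>_. N))"
      by (rule measurable_compose[OF upd borel_measurable_indicator[OF C']])
        (rule measurable_component_singleton[OF i])
  qed
  have gm: "g \<in> borel_measurable (PiM {..<q} (\<lambda>_. N))"
    unfolding g_def using m1 m2 by (rule borel_measurable_minus_ennreal)
  have "(\<integral>\<^sup>+ x. (emeasure \<nu> {y \<in> space \<nu>. x(q := y) \<in> C} - (\<Sum>i<q. indicator C (x(q := x i)))) \<partial>factorial_measure \<nu> q)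
     = (\<integral>\<^sup>+ x. g x \<partial>factorial_measure \<nu> q)"
    unfolding g_def by (rule nn_integral_cong, subst em) (auto simp: space_factorial_measure space_PiM spN)
  also have "\<dots> = (\<integral>\<^sup>+ k. g (tuple_at {..<q} p k) \<partial>count_space (inj_tuples {..<q} I))"
    by (rule nn_integral_factorial_measure_aux[OF D rep F]) (use gm N_def in auto)
  also have "\<dots> = (\<integral>\<^sup>+ k. (\<integral>\<^sup>+ i. indicator C (tuple_at {..<Suc q} p (k(q := i))) \<partial>count_space (I - k ` {..<q})) \<partial>count_space (inj_tuples {..<q} I))"
  proof (rule nn_integral_cong)
    fix k assume "k \<in> space (count_space (inj_tuples {..<q} I))"
    then have k: "k \<in> {..<q} \<rightarrow>\<^sub>E I" "inj_on k {..<q}" by (auto simp: inj_tuples_def)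
    have t: "(tuple_at {..<q} p k)(q := p i) = tuple_at {..<Suc q} p (k(q := i))" for i
      by (auto simp: tuple_at_def fun_eq_iff)
    define h where "h = (\<lambda>i. indicator C (tuple_at {..<Suc q} p (k(q := i))) :: ennreal)"
    have kI: "k ` {..<q} \<subseteq> I" using k by auto
    have s: "(\<Sum>i<q. indicator C ((tuple_at {..<q} p k)(q := tuple_at {..<q} p k i))) = (\<Sum>i\<in>k ` {..<q}. h i)"
    proof -
      have "tuple_at {..<q} p k i = p (k i)" if "i < q" for i using that by (simp add: tuple_at_def)
      then show ?thesis using k(2) by (simp add: sum.reindex h_def t)
    qed
    have "(\<integral>\<^sup>+ i. h i \<partial>count_space I) = (\<integral>\<^sup>+ i. h i * indicator (k ` {..<q}) i + h i * indicator (I - k ` {..<q}) i \<partial>count_space I)"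
      using kI by (intro nn_integral_cong) (auto split: split_indicator)
    also have "\<dots> = (\<integral>\<^sup>+ i. h i * indicator (k ` {..<q}) i \<partial>count_space I) + (\<integral>\<^sup>+ i. h i * indicator (I - k ` {..<q}) i \<partial>count_space I)"
      by (rule nn_integral_add) auto
    also have "(\<integral>\<^sup>+ i. h i * indicator (k ` {..<q}) i \<partial>count_space I) = (\<integral>\<^sup>+ i. h i \<partial>count_space (k ` {..<q}))"
      using kI by (rule nn_integral_count_space_subset)
    also have "\<dots> = (\<Sum>i\<in>k ` {..<q}. h i)"
      by (simp add: nn_integral_count_space_finite)
    also have "(\<integral>\<^sup>+ i. h i * indicator (I - k ` {..<q}) i \<partial>count_space I) = (\<integral>\<^sup>+ i. h i \<partial>count_space (I - k ` {..<q}))"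
      by (rule nn_integral_count_space_subset) auto
    finally have e: "(\<integral>\<^sup>+ i. h i \<partial>count_space I) = (\<Sum>i\<in>k ` {..<q}. h i) + (\<integral>\<^sup>+ i. h i \<partial>count_space (I - k ` {..<q}))" .
    have fin: "(\<Sum>i\<in>k ` {..<q}. h i) \<noteq> \<infinity>" by (simp add: h_def indicator_def)
    have "g (tuple_at {..<q} p k) = (\<integral>\<^sup>+ i. h i \<partial>count_space I) - (\<Sum>i\<in>k ` {..<q}. h i)"
      unfolding g_def s t h_def ..
    also have "\<dots> = (\<integral>\<^sup>+ i. h i \<partial>count_space (I - k ` {..<q}))"
      unfolding e using fin by (simp add: ennreal_add_diff_cancel_left)
    finally show "g (tuple_at {..<q} p k) = (\<integral>\<^sup>+ i. indicator C (tuple_at {..<Suc q} p (k(q := i))) \<partial>count_space (I - k ` {..<q}))"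
      unfolding h_def .
  qed
  also have "\<dots> = (\<integral>\<^sup>+ x. indicator C (tuple_at {..<Suc q} p ((\<lambda>(k, j). k(q := j)) x)) \<partial>count_space (SIGMA k : inj_tuples {..<q} I. I - k ` {..<q}))"
    by (subst nn_integral_count_space_Sigma[symmetric]) simp
  also have "\<dots> = (\<integral>\<^sup>+ k. indicator C (tuple_at {..<Suc q} p k) \<partial>count_space (inj_tuples {..<Suc q} I))"
    by (rule nn_integral_bij_count_space[OF inj_tuples_Suc_bij])
  finally show ?thesis .
qed

text \<open>Induction on the order with \<open>D\<close>, \<open>I\<close>, \<open>p\<close> and
  \<open>C\<close> arbitrary. In the step the set function must be countably additive on the full
  product sigma-algebra; each disjoint sequence is treated over a family \<open>D'\<close> of its
  own, where additivity is that of a sum over tuples.\<close>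

theorem emeasure_factorial_measure:
  assumes iv: "integer_valued \<nu>" and sf: "sigma_finite_measure \<nu>"
    and "D \<subseteq> sets \<nu>" and "point_representation \<nu> D (I :: (nat \<times> nat) set) p"
    and "C \<in> sets (PiM {..<q} (\<lambda>_. sigma (space \<nu>) D))"
  shows "emeasure (factorial_measure \<nu> q) C =
      (\<integral>\<^sup>+ k. indicator C (tuple_at {..<q} p k) \<partial>count_space (inj_tuples {..<q} I))"
  using assms(3-)
proof (induction q arbitrary: D I p C)
  case 0
  have i0: "inj_tuples {..<0::nat} I = {\<lambda>_. undefined}" by (auto simp: inj_tuples_def)
  have t: "tuple_at {..<0::nat} p k = (\<lambda>_. undefined)" for k by (auto simp: tuple_at_def)
  have "C \<in> sets (PiM {..<0::nat} (\<lambda>_. \<nu>))"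
    using 0 sets_PiM_sigma_subset by blast
  then have "C = {} \<or> C = {\<lambda>_. undefined}" by (auto simp: PiM_empty)
  then show ?case unfolding i0 t by (auto simp: PiM_empty nn_integral_count_space_finite)
next
  case (Suc q)
  define \<mu> where "\<mu> = (\<lambda>C. \<integral>\<^sup>+ x. (emeasure \<nu> {y \<in> space \<nu>. x(q := y) \<in> C}
                    - (\<Sum>i<q. indicator C (x(q := x i)))) \<partial>factorial_measure \<nu> q)"
  have \<mu>: "\<mu> C = (\<integral>\<^sup>+ k. indicator C (tuple_at {..<Suc q} p k) \<partial>count_space (inj_tuples {..<Suc q} I))"
    if "D \<subseteq> sets \<nu>" "point_representation \<nu> D I p" "C \<in> sets (PiM {..<Suc q} (\<lambda>_. sigma (space \<nu>) D))"
    for D p C and I :: "(nat \<times> nat) set"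
    unfolding \<mu>_def by (rule emeasure_factorial_measure_Suc_aux[OF that(1,2) Suc.IH[OF that(1,2)] that(3)])
  have "emeasure (factorial_measure \<nu> (Suc q)) C = \<mu> C"
  proof (rule emeasure_measure_of[where \<mu>=\<mu>])
    show "factorial_measure \<nu> (Suc q) = measure_of (space (PiM {..<Suc q} (\<lambda>_. \<nu>))) (sets (PiM {..<Suc q} (\<lambda>_. \<nu>))) \<mu>"
      unfolding \<mu>_def by simp
    show "sets (PiM {..<Suc q} (\<lambda>_. \<nu>)) \<subseteq> Pow (space (PiM {..<Suc q} (\<lambda>_. \<nu>)))" by (rule sets.space_closed)
    show "C \<in> sets (factorial_measure \<nu> (Suc q))"
      unfolding sets_factorial_measure using Suc.prems sets_PiM_sigma_subset by blast
    show "positive (sets (factorial_measure \<nu> (Suc q))) \<mu>"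
      by (simp add: positive_def \<mu>_def)
    show "countably_additive (sets (factorial_measure \<nu> (Suc q))) \<mu>"
    proof (rule countably_additiveI)
      fix A :: "nat \<Rightarrow> _" assume A: "range A \<subseteq> sets (factorial_measure \<nu> (Suc q))" "disjoint_family A"
      have "\<exists>D. countable D \<and> D \<subseteq> sets \<nu> \<and> (\<forall>i\<in>UNIV. A i \<in> sets (PiM {..<Suc q} (\<lambda>_. sigma (space \<nu>) D)))"
        by (rule countable_generated_sets[where J="\<lambda>_. {..<Suc q}"]) (use A sets_factorial_measure in blast)+
      then obtain D' where D': "countable D'" "D' \<subseteq> sets \<nu>"
          "\<And>i. A i \<in> sets (PiM {..<Suc q} (\<lambda>_. sigma (space \<nu>) D'))" by blast
      obtain I' :: "(nat \<times> nat) set" and p' where rep: "point_representation \<nu> D' I' p'"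
        using point_representation_exists[OF iv sf D'(1,2)] by blast
      have "(\<Sum>i. \<mu> (A i)) = (\<Sum>i. \<integral>\<^sup>+ k. indicator (A i) (tuple_at {..<Suc q} p' k) \<partial>count_space (inj_tuples {..<Suc q} I'))"
        using \<mu>[OF D'(2) rep] D'(3) by simp
      also have "\<dots> = (\<integral>\<^sup>+ k. (\<Sum>i. indicator (A i) (tuple_at {..<Suc q} p' k)) \<partial>count_space (inj_tuples {..<Suc q} I'))"
        by (rule nn_integral_suminf[symmetric]) auto
      also have "\<dots> = (\<integral>\<^sup>+ k. indicator (\<Union>i. A i) (tuple_at {..<Suc q} p' k) \<partial>count_space (inj_tuples {..<Suc q} I'))"
        using A(2) by (simp add: suminf_indicator)
      also have "\<dots> = \<mu> (\<Union>i. A i)"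
        by (rule \<mu>[OF D'(2) rep, symmetric]) (use D'(3) in blast)
      finally show "(\<Sum>i. \<mu> (A i)) = \<mu> (\<Union>i. A i)" .
    qed
  qed
  then show ?case using \<mu>[OF Suc.prems] by simp
qed

corollary nn_integral_factorial_measure:
  assumes "integer_valued \<nu>" and "sigma_finite_measure \<nu>"
    and "D \<subseteq> sets \<nu>" and "point_representation \<nu> D (I :: (nat \<times> nat) set) p"
    and "g \<in> borel_measurable (PiM {..<q} (\<lambda>_. sigma (space \<nu>) D))"
  shows "(\<integral>\<^sup>+ x. g x \<partial>factorial_measure \<nu> q) =
    (\<integral>\<^sup>+ k. g (tuple_at {..<q} p k) \<partial>count_space (inj_tuples {..<q} I))"
  using nn_integral_factorial_measure_aux[OF assms(3,4) emeasure_factorial_measure[OF assms(1-4)] assms(5)]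
  by blast

text \<open>Countable additivity being established, \<open>measure_of\<close> has the prescribed
  values, and the recursion can be used without reference to points.\<close>

lemma emeasure_factorial_measure_Suc:
  assumes iv: "integer_valued \<nu>" and sf: "sigma_finite_measure \<nu>"
    and C: "C \<in> sets (PiM {..<Suc q} (\<lambda>_. \<nu>))"
  shows "emeasure (factorial_measure \<nu> (Suc q)) C =
    (\<integral>\<^sup>+ x. (emeasure \<nu> {y \<in> space \<nu>. x(q := y) \<in> C}
                    - (\<Sum>i<q. indicator C (x(q := x i)))) \<partial>factorial_measure \<nu> q)"
proof -
  obtain D where D: "countable D" "D \<subseteq> sets \<nu>" "C \<in> sets (PiM {..<Suc q} (\<lambda>_. sigma (space \<nu>) D))"
    using countable_generated_set[OF C] by blast
  obtain I :: "(nat \<times> nat) set" and p where rep: "point_representation \<nu> D I p"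
    using point_representation_exists[OF iv sf D(1,2)] by blast
  show ?thesis
    using emeasure_factorial_measure_Suc_aux[OF D(2) rep emeasure_factorial_measure[OF iv sf D(2) rep] D(3)]
      emeasure_factorial_measure[OF iv sf D(2) rep D(3)] by simp
qed

section \<open>Factorial moment measures of a Poisson process\<close>

lemma card_lessThan_Suc_fibre:
  "card {k. k < Suc q \<and> u k = i} = card {k. k < q \<and> u k = i} + (if u q = i then 1 else 0)"
proof (cases "u q = i")
  case True
  then have "{k. k < Suc q \<and> u k = i} = insert q {k. k < q \<and> u k = i}" by (auto simp: less_Suc_eq)
  then show ?thesis using True by simp
next
  case False
  then have "{k. k < Suc q \<and> u k = i} = {k. k < q \<and> u k = i}" by (auto simp: less_Suc_eq)
  then show ?thesis using False by simp
qed

lemma fun_upd_mem_PiE_Suc: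
  assumes "x \<in> extensional {..<q}"
  shows "x(q := y) \<in> Pi\<^sub>E {..<Suc q} F \<longleftrightarrow> x \<in> Pi\<^sub>E {..<q} F \<and> y \<in> F q"
proof -
  have "x(q := y) \<in> extensional {..<Suc q}" using assms by (auto simp: extensional_def)
  then have "x(q := y) \<in> Pi\<^sub>E {..<Suc q} F \<longleftrightarrow> (\<forall>k<Suc q. (x(q := y)) k \<in> F k)"
    by (simp add: PiE_iff Ball_def)
  also have "\<dots> \<longleftrightarrow> (\<forall>k<q. x k \<in> F k) \<and> y \<in> F q" by (auto simp: All_less_Suc)
  finally show ?thesis using assms by (simp add: PiE_iff Ball_def)
qed

text \<open>If \<open>r\<close> earlier coordinates lie in the cell \<open>B i\<close>, the Dirac
  masses lower the measure of this cell by \<open>r\<close>, wherever in the cell these coordinates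
  are. Coordinates in other cells do not interfere because the cells are disjoint. Hence the falling
  factorials; \<open>u\<close> assigns to each coordinate its cell.\<close>

lemma emeasure_factorial_measure_cells:
  fixes B :: "'u \<Rightarrow> 'a set"
  assumes iv: "integer_valued \<nu>" and sf: "sigma_finite_measure \<nu>"
    and U: "finite U" and B: "\<And>i. i \<in> U \<Longrightarrow> B i \<in> sets \<nu>" "disjoint_family_on B U"
    and u: "\<And>k. k < q \<Longrightarrow> u k \<in> U"
  shows "emeasure (factorial_measure \<nu> q) (\<Pi>\<^sub>E k\<in>{..<q}. B (u k)) =
    (\<Prod>i\<in>U. \<Prod>r<card {k. k < q \<and> u k = i}. emeasure \<nu> (B i) - of_nat r)"
  using u
proof (induction q)
  case 0
  then show ?case by (simp add: PiM_empty)
next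
  case (Suc q)
  let ?R = "\<Pi>\<^sub>E k\<in>{..<q}. B (u k)" and ?C = "\<Pi>\<^sub>E k\<in>{..<Suc q}. B (u k)"
  let ?n = "card {k. k < q \<and> u k = u q}"
  have R: "?R \<in> sets (factorial_measure \<nu> q)" unfolding sets_factorial_measure
    using Suc.prems B by (intro sets_PiM_I_finite) auto
  have C: "?C \<in> sets (PiM {..<Suc q} (\<lambda>_. \<nu>))"
    using Suc.prems B by (intro sets_PiM_I_finite) auto
  have Cx: "x(q := y) \<in> ?C \<longleftrightarrow> x \<in> ?R \<and> y \<in> B (u q)" if "x \<in> {..<q} \<rightarrow>\<^sub>E space \<nu>" for x y
    by (rule fun_upd_mem_PiE_Suc[where F="\<lambda>k. B (u k)"]) (use that in \<open>simp add: PiE_iff\<close>)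
  have "emeasure (factorial_measure \<nu> (Suc q)) ?C =
    (\<integral>\<^sup>+ x. (emeasure \<nu> (B (u q)) - of_nat ?n) * indicator ?R x \<partial>factorial_measure \<nu> q)"
    unfolding emeasure_factorial_measure_Suc[OF iv sf C]
  proof (rule nn_integral_cong)
    fix x assume "x \<in> space (factorial_measure \<nu> q)"
    then have x: "x \<in> {..<q} \<rightarrow>\<^sub>E space \<nu>" by (simp add: space_factorial_measure)
    show "emeasure \<nu> {y \<in> space \<nu>. x(q := y) \<in> ?C} - (\<Sum>i<q. indicator ?C (x(q := x i))) =
      (emeasure \<nu> (B (u q)) - of_nat ?n) * indicator ?R x"
    proof (cases "x \<in> ?R")
      case True
      have "B (u q) \<subseteq> space \<nu>" by (rule sets.sets_into_space[OF B(1)[OF Suc.prems]]) simp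
      then have 1: "{y \<in> space \<nu>. x(q := y) \<in> ?C} = B (u q)" using True x Cx by auto
      have "indicator ?C (x(q := x i)) = (if u i = u q then 1 else 0 :: ennreal)" if i: "i < q" for i
      proof -
        have "x i \<in> B (u i)" using True i by auto
        moreover have "u i \<noteq> u q \<Longrightarrow> B (u i) \<inter> B (u q) = {}"
          using B(2) Suc.prems[of i] Suc.prems[of q] i by (auto simp: disjoint_family_on_def)
        ultimately have "x i \<in> B (u q) \<longleftrightarrow> u i = u q" by auto
        then show ?thesis using Cx[OF x, of "x i"] True by simp
      qed
      then have "(\<Sum>i<q. indicator ?C (x(q := x i))) = (\<Sum>i<q. if u i = u q then 1 else 0 :: ennreal)"
        by (intro sum.cong) auto
      also have "\<dots> = of_nat ?n"
        by (simp add: sum.If_cases Int_def)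
      finally show ?thesis unfolding 1 using True by simp
    next
      case False
      then show ?thesis using Cx[OF x] by simp
    qed
  qed
  also have "\<dots> = (emeasure \<nu> (B (u q)) - of_nat ?n) * emeasure (factorial_measure \<nu> q) ?R"
    using R by (simp add: nn_integral_cmult_indicator)
  also have "\<dots> = (emeasure \<nu> (B (u q)) - of_nat ?n) * (\<Prod>i\<in>U. \<Prod>r<card {k. k < q \<and> u k = i}. emeasure \<nu> (B i) - of_nat r)"
    using Suc by simp
  also have "\<dots> = (\<Prod>i\<in>U. \<Prod>r<card {k. k < Suc q \<and> u k = i}. emeasure \<nu> (B i) - of_nat r)"
  proof -
    have "(\<Prod>r<card {k. k < Suc q \<and> u k = i}. emeasure \<nu> (B i) - of_nat r) =
      (if i = u q then emeasure \<nu> (B (u q)) - of_nat ?n else 1) * (\<Prod>r<card {k. k < q \<and> u k = i}. emeasure \<nu> (B i) - of_nat r)" for i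
      unfolding card_lessThan_Suc_fibre by (auto simp: mult.commute)
    then show ?thesis using U Suc.prems[of q] by (simp add: prod.distrib prod.delta)
  qed
  finally show ?case .
qed

section \<open>Factorial moments of the Poisson law and of disjoint cells\<close>

lemma poisson_factorial_moment:
  assumes P: "prob_space P" and pois: "poisson_distributed P X r" and r: "r \<noteq> \<infinity>"
  shows "(\<integral>\<^sup>+ \<omega>. (\<Prod>i<n. X \<omega> - of_nat i) \<partial>P) = r ^ n"
proof -
  interpret prob_space P by fact
  define l where "l = enn2real r"
  have l: "0 \<le> l" "r = ennreal l" using r by (auto simp: l_def less_top)
  have X: "X \<in> borel_measurable P"
    and pr: "\<And>k::nat. prob {\<omega> \<in> space P. X \<omega> = of_nat k} = l ^ k / fact k * exp (- l)"
    using pois r by (auto simp: poisson_distributed_def l_def)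
  let ?E = "\<lambda>k::nat. {\<omega> \<in> space P. X \<omega> = of_nat k}"
  have E: "?E k \<in> events" for k using X by measurable
  have disj: "disjoint_family ?E" by (auto simp: disjoint_family_on_def)
  have expsum: "(\<lambda>k. l ^ k / fact k * exp (- l)) sums 1"
  proof -
    have "(\<lambda>k. l ^ k / fact k) sums exp l" using exp_converges[of l] by (simp add: divide_inverse mult.commute)
    from sums_mult2[OF this, of "exp (- l)"] show ?thesis by (simp add: exp_minus)
  qed
  \<comment> \<open>The Poisson weights sum to 1, so \<open>X\<close> is almost surely a natural
    number and the expectation becomes a series over its values.\<close>
  have "prob (\<Union>k. ?E k) = 1"
    using finite_measure_UNION[OF _ disj] E expsum pr by (auto dest: sums_unique2)
  then have ae: "AE \<omega> in P. \<omega> \<in> (\<Union>k. ?E k)" using E by (subst prob_eq_1[symmetric]) auto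
  have "(\<integral>\<^sup>+ \<omega>. (\<Prod>i<n. X \<omega> - of_nat i) \<partial>P) =
    (\<integral>\<^sup>+ \<omega>. (\<Sum>k. (\<Prod>i<n. of_nat k - of_nat i) * indicator (?E k) \<omega>) \<partial>P)"
  proof (rule nn_integral_cong_AE, use ae in eventually_elim)
    fix \<omega> assume "\<omega> \<in> (\<Union>k. ?E k)"
    then obtain k where k: "\<omega> \<in> ?E k" by auto
    have "(\<Sum>j. (\<Prod>i<n. of_nat j - of_nat i) * indicator (?E j) \<omega>) =
      (\<Sum>j\<in>{k}. (\<Prod>i<n. of_nat j - of_nat i) * indicator (?E j) \<omega> :: ennreal)"
    proof (rule suminf_finite)
      fix j assume "j \<notin> {k}"
      then have "\<omega> \<notin> ?E j" using k by simp
      then show "(\<Prod>i<n. of_nat j - of_nat i) * indicator (?E j) \<omega> = (0 :: ennreal)" by simp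
    qed simp
    also have "\<dots> = (\<Prod>i<n. of_nat k - of_nat i)"
      using k by (simp only: sum.insert sum.empty finite.emptyI empty_iff not_False_eq_True indicator_simps mult_1_right add_0_right)
    moreover have "X \<omega> = of_nat k" using k by simp
    ultimately show "(\<Prod>i<n. X \<omega> - of_nat i) = (\<Sum>k. (\<Prod>i<n. of_nat k - of_nat i) * indicator (?E k) \<omega>)"
      by (simp only:)
  qed
  also have "\<dots> = (\<Sum>k. \<integral>\<^sup>+ \<omega>. (\<Prod>i<n. of_nat k - of_nat i) * indicator (?E k) \<omega> \<partial>P)"
    by (intro nn_integral_suminf borel_measurable_times_ennreal borel_measurable_indicator borel_measurable_const E)
  also have "\<dots> = (\<Sum>k. (\<Prod>i<n. of_nat k - of_nat i) * ennreal (l ^ k / fact k * exp (- l)))"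
    using E by (subst nn_integral_cmult_indicator) (auto simp: emeasure_eq_measure pr)
  \<comment> \<open>Terms with \<open>k < n\<close> vanish, as the factor for \<open>i = k\<close>
    is 0; after a shift by \<open>n\<close> the exponential series reappears with the factor
    \<open>l ^ n\<close>.\<close>
  also have "\<dots> = (\<Sum>k. (\<Prod>i<n. of_nat (k + n) - of_nat i) * ennreal (l ^ (k + n) / fact (k + n) * exp (- l)))"
  proof (rule suminf_offset[where i=n, THEN trans])
    have "(\<Prod>i<n. of_nat k - of_nat i :: ennreal) = 0" if "k < n" for k
      using that by (intro prod_zero) (auto intro!: bexI[of _ k])
    then show "(\<Sum>k. (\<Prod>i<n. of_nat (k + n) - of_nat i) * ennreal (l ^ (k + n) / fact (k + n) * exp (- l))) +
       (\<Sum>k<n. (\<Prod>i<n. of_nat k - of_nat i) * ennreal (l ^ k / fact k * exp (- l))) =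
      (\<Sum>k. (\<Prod>i<n. of_nat (k + n) - of_nat i) * ennreal (l ^ (k + n) / fact (k + n) * exp (- l)))" by simp
  qed simp
  also have "\<dots> = (\<Sum>k. ennreal (l ^ n * (l ^ k / fact k * exp (- l))))"
  proof (rule suminf_cong)
    fix k
    have "(\<Prod>i<n. of_nat (k + n) - of_nat i :: ennreal) = (\<Prod>i<n. ennreal (real (k + n - i)))"
    proof (rule prod.cong)
      fix i assume i: "i \<in> {..<n}"
      have "(of_nat (k + n) - of_nat i :: ennreal) = ennreal (real (k + n)) - ennreal (real i)"
        by (simp only: ennreal_of_nat_eq_real_of_nat)
      also have "\<dots> = ennreal (real (k + n) - real i)" by (rule ennreal_minus) simp
      also have "real (k + n) - real i = real (k + n - i)" using i by (subst of_nat_diff) auto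
      finally show "(of_nat (k + n) - of_nat i :: ennreal) = ennreal (real (k + n - i))" .
    qed simp
    also have "\<dots> = ennreal (\<Prod>i<n. real (k + n - i))" by (rule prod_ennreal) simp
    also have "(\<Prod>i<n. real (k + n - i)) = fact (k + n) / fact k"
    proof (induction n)
      case (Suc n)
      have "(\<Prod>i<Suc n. real (k + Suc n - i)) = real (k + Suc n) * (\<Prod>i<n. real (k + n - i))"
        by (subst prod.lessThan_Suc_shift) simp
      also have "\<dots> = real (k + Suc n) * (fact (k + n) / fact k)" unfolding Suc ..
      also have "\<dots> = fact (k + Suc n) / fact k" by simp
      finally show ?case .
    qed simp
    finally show "(\<Prod>i<n. of_nat (k + n) - of_nat i) * ennreal (l ^ (k + n) / fact (k + n) * exp (- l)) =
      ennreal (l ^ n * (l ^ k / fact k * exp (- l)))"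
      using l by (simp add: ennreal_mult'[symmetric] power_add field_simps)
  qed
  also have "\<dots> = ennreal (l ^ n * 1)"
    using l by (intro suminf_ennreal_eq sums_mult expsum) auto
  also have "\<dots> = r ^ n" using l by (simp add: ennreal_power)
  finally show ?thesis .
qed

lemma borel_measurable_falling_factorial:
  "(\<lambda>x::ennreal. \<Prod>i<n. x - of_nat i) \<in> borel_measurable borel"
  by measurable

lemma poisson_process_factorial_moments:
  fixes B :: "'u \<Rightarrow> 'a set"
  assumes pp: "poisson_process P M \<eta>" and U: "finite U"
    and B: "\<And>i. i \<in> U \<Longrightarrow> B i \<in> sets M" "disjoint_family_on B U" "\<And>i. i \<in> U \<Longrightarrow> emeasure M (B i) \<noteq> \<infinity>"
  shows "(\<integral>\<^sup>+ \<omega>. (\<Prod>i\<in>U. \<Prod>r<n i. emeasure (\<eta> \<omega>) (B i) - of_nat r) \<partial>P) = (\<Prod>i\<in>U. emeasure M (B i) ^ n i)"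
proof -
  interpret prob_space P using pp by (simp add: poisson_process_def)
  \<comment> \<open>Independence in \<open>poisson_process\<close> concerns families indexed by an
    initial segment of the naturals, so the cells are enumerated.\<close>
  obtain h where h: "bij_betw h {..<card U} U"
    using U ex_bij_betw_nat_finite lessThan_atLeast0 by metis
  let ?N = "card U"
  have hU: "h i \<in> U" if "i < ?N" for i using h that by (auto simp: bij_betw_def)
  have disj: "disjoint_family_on (B \<circ> h) {..<?N}"
    unfolding disjoint_family_on_def
  proof (intro ballI impI)
    fix i j assume ij: "i \<in> {..<?N}" "j \<in> {..<?N}" "i \<noteq> j"
    then have "h i \<noteq> h j" using h by (auto simp: bij_betw_def dest: inj_onD)
    then show "(B \<circ> h) i \<inter> (B \<circ> h) j = {}"
      using B(2) hU[of i] hU[of j] ij by (auto simp: disjoint_family_on_def)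
  qed
  have ind: "indep_vars (\<lambda>_. borel) (\<lambda>i \<omega>. emeasure (\<eta> \<omega>) ((B \<circ> h) i)) {..<?N}"
  proof -
    have "\<forall>i<?N. (B \<circ> h) i \<in> sets M" using B(1) hU by auto
    then show ?thesis using pp disj unfolding poisson_process_def by blast
  qed
  have "(\<integral>\<^sup>+ \<omega>. (\<Prod>i\<in>U. \<Prod>r<n i. emeasure (\<eta> \<omega>) (B i) - of_nat r) \<partial>P) =
     (\<integral>\<^sup>+ \<omega>. (\<Prod>j<?N. \<Prod>r<n (h j). emeasure (\<eta> \<omega>) ((B \<circ> h) j) - of_nat r) \<partial>P)"
    using prod.reindex_bij_betw[OF h] by (intro nn_integral_cong) (simp add: prod.reindex_bij_betw[OF h, symmetric])
  also have "\<dots> = (\<Prod>j<?N. \<integral>\<^sup>+ \<omega>. (\<Prod>r<n (h j). emeasure (\<eta> \<omega>) ((B \<circ> h) j) - of_nat r) \<partial>P)"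
    by (rule indep_vars_nn_integral[OF _ indep_vars_compose2[OF ind borel_measurable_falling_factorial]]) auto
  also have "\<dots> = (\<Prod>j<?N. emeasure M (B (h j)) ^ n (h j))"
  proof (rule prod.cong)
    fix j assume "j \<in> {..<?N}"
    then have "poisson_distributed P (\<lambda>\<omega>. emeasure (\<eta> \<omega>) (B (h j))) (emeasure M (B (h j)))"
      using pp B(1) hU by (auto simp: poisson_process_def)
    from poisson_factorial_moment[OF prob_space_axioms this] B(3) hU \<open>j \<in> {..<?N}\<close>
    show "(\<integral>\<^sup>+ \<omega>. (\<Prod>r<n (h j). emeasure (\<eta> \<omega>) ((B \<circ> h) j) - of_nat r) \<partial>P) = emeasure M (B (h j)) ^ n (h j)"
      by simp
  qed simp
  also have "\<dots> = (\<Prod>i\<in>U. emeasure M (B i) ^ n i)"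
    by (rule prod.reindex_bij_betw[OF h])
  finally show ?thesis .
qed

text \<open>Regularity is asked for every \<omega>, not for almost every one, so that the pathwise
  formulas hold on all of \<open>space P\<close>. The Poisson law enters only through
  \<open>factorial_moments\<close>; the index type \<open>nat set\<close> is that of the cells in
  \<open>intensity_on_rectangle\<close>.\<close>

locale locally_finite_poisson = prob_space P for P :: "'w measure" +
  fixes M :: "'a measure" and \<eta> :: "'w \<Rightarrow> 'a measure" and A :: "nat \<Rightarrow> 'a set"
  assumes A_sets: "\<And>i. A i \<in> sets M" and A_inc: "incseq A" and A_UN: "(\<Union>i. A i) = space M"
    and A_fin: "\<And>i. emeasure M (A i) \<noteq> \<infinity>"
    and sets_\<eta>: "\<And>\<omega>. \<omega> \<in> space P \<Longrightarrow> sets (\<eta> \<omega>) = sets M"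
    and iv: "\<And>\<omega>. \<omega> \<in> space P \<Longrightarrow> integer_valued (\<eta> \<omega>)"
    and \<eta>_fin: "\<And>\<omega> i. \<omega> \<in> space P \<Longrightarrow> emeasure (\<eta> \<omega>) (A i) \<noteq> \<infinity>"
    and \<eta>_meas: "\<And>B. B \<in> sets M \<Longrightarrow> (\<lambda>\<omega>. emeasure (\<eta> \<omega>) B) \<in> borel_measurable P"
    and factorial_moments: "\<And>(U :: nat set set) B n. finite U \<Longrightarrow> (\<And>i. i \<in> U \<Longrightarrow> B i \<in> sets M) \<Longrightarrow>
      disjoint_family_on B U \<Longrightarrow> (\<And>i. i \<in> U \<Longrightarrow> emeasure M (B i) \<noteq> \<infinity>) \<Longrightarrow>
      (\<integral>\<^sup>+ \<omega>. (\<Prod>i\<in>U. \<Prod>r<n i. emeasure (\<eta> \<omega>) (B i) - of_nat r) \<partial>P) = (\<Prod>i\<in>U. emeasure M (B i) ^ n i)"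
begin

section \<open>Intensity of the factorial measures, from cells to measurable functions\<close>

lemma space_\<eta>: "\<omega> \<in> space P \<Longrightarrow> space (\<eta> \<omega>) = space M"
  by (rule sets_eq_imp_space_eq[OF sets_\<eta>])

lemma sigma_finite_M: "sigma_finite_measure M"
  by standard (use A_sets A_UN A_fin in \<open>auto intro!: exI[of _ "range A"]\<close>)

lemma sigma_finite_\<eta>: "\<omega> \<in> space P \<Longrightarrow> sigma_finite_measure (\<eta> \<omega>)"
  by standard (use A_sets A_UN \<eta>_fin sets_\<eta> space_\<eta> in \<open>auto intro!: exI[of _ "range A"]\<close>)

sublocale product_sigma_finite "\<lambda>_ :: 'j. M"
  by (simp add: product_sigma_finite_def sigma_finite_M)

lemma sets_factorial_\<eta>: "\<omega> \<in> space P \<Longrightarrow> sets (factorial_measure (\<eta> \<omega>) q) = sets (PiM {..<q} (\<lambda>_. M))"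
  unfolding sets_factorial_measure by (intro sets_PiM_cong sets_\<eta> refl)

lemma space_factorial_\<eta>: "\<omega> \<in> space P \<Longrightarrow> space (factorial_measure (\<eta> \<omega>) q) = ({..<q} \<rightarrow>\<^sub>E space M)"
  by (simp add: space_factorial_measure space_\<eta>)

text \<open>Measurability and mean are carried together, since each step of the extension from
  rectangles needs both.\<close>

definition intensity_on :: "nat \<Rightarrow> (nat \<Rightarrow> 'a) set \<Rightarrow> bool" where
  "intensity_on q C \<longleftrightarrow> (\<lambda>\<omega>. emeasure (factorial_measure (\<eta> \<omega>) q) C) \<in> borel_measurable P \<and>
     (\<integral>\<^sup>+ \<omega>. emeasure (factorial_measure (\<eta> \<omega>) q) C \<partial>P) = emeasure (PiM {..<q} (\<lambda>_. M)) C"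

lemma intensity_on_UN:
  fixes C :: "'i \<Rightarrow> (nat \<Rightarrow> 'a) set"
  assumes "finite F" "\<And>i. i \<in> F \<Longrightarrow> C i \<in> sets (PiM {..<q} (\<lambda>_. M))"
    "disjoint_family_on C F" "\<And>i. i \<in> F \<Longrightarrow> intensity_on q (C i)"
  shows "intensity_on q (\<Union>i\<in>F. C i)"
proof -
  have e: "emeasure (factorial_measure (\<eta> \<omega>) q) (\<Union>i\<in>F. C i) = (\<Sum>i\<in>F. emeasure (factorial_measure (\<eta> \<omega>) q) (C i))"
    if "\<omega> \<in> space P" for \<omega>
    using assms sets_factorial_\<eta>[OF that, of q] by (intro sum_emeasure[symmetric]) auto
  have "(\<lambda>\<omega>. emeasure (factorial_measure (\<eta> \<omega>) q) (\<Union>i\<in>F. C i)) \<in> borel_measurable P"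
    using assms(4) by (subst measurable_cong[OF e]) (auto simp: intensity_on_def intro!: borel_measurable_sum)
  moreover have "(\<integral>\<^sup>+ \<omega>. emeasure (factorial_measure (\<eta> \<omega>) q) (\<Union>i\<in>F. C i) \<partial>P) =
      (\<Sum>i\<in>F. \<integral>\<^sup>+ \<omega>. emeasure (factorial_measure (\<eta> \<omega>) q) (C i) \<partial>P)"
  proof -
    have "(\<integral>\<^sup>+ \<omega>. emeasure (factorial_measure (\<eta> \<omega>) q) (\<Union>i\<in>F. C i) \<partial>P) =
        (\<integral>\<^sup>+ \<omega>. (\<Sum>i\<in>F. emeasure (factorial_measure (\<eta> \<omega>) q) (C i)) \<partial>P)"
      by (rule nn_integral_cong[OF e])
    also have "\<dots> = (\<Sum>i\<in>F. \<integral>\<^sup>+ \<omega>. emeasure (factorial_measure (\<eta> \<omega>) q) (C i) \<partial>P)"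
      by (rule nn_integral_sum) (use assms(4) in \<open>auto simp: intensity_on_def\<close>)
    finally show ?thesis .
  qed
  moreover have "\<dots> = (\<Sum>i\<in>F. emeasure (PiM {..<q} (\<lambda>_. M)) (C i))"
    using assms(4) by (auto simp: intensity_on_def)
  moreover have "\<dots> = emeasure (PiM {..<q} (\<lambda>_. M)) (\<Union>i\<in>F. C i)"
    using assms by (intro sum_emeasure) auto
  ultimately show ?thesis unfolding intensity_on_def by simp
qed

lemma intensity_on_cells:
  fixes B :: "nat set \<Rightarrow> 'a set"
  assumes U: "finite U" and B: "\<And>i. i \<in> U \<Longrightarrow> B i \<in> sets M" "disjoint_family_on B U"
      "\<And>i. i \<in> U \<Longrightarrow> emeasure M (B i) \<noteq> \<infinity>"
    and u: "\<And>k. k < q \<Longrightarrow> u k \<in> U"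
  shows "intensity_on q (\<Pi>\<^sub>E k\<in>{..<q}. B (u k))"
proof -
  let ?R = "\<Pi>\<^sub>E k\<in>{..<q}. B (u k)" and ?n = "\<lambda>i. card {k. k < q \<and> u k = i}"
  have e: "emeasure (factorial_measure (\<eta> \<omega>) q) ?R = (\<Prod>i\<in>U. \<Prod>r<?n i. emeasure (\<eta> \<omega>) (B i) - of_nat r)"
    if "\<omega> \<in> space P" for \<omega>
    using B sets_\<eta>[OF that]
    by (intro emeasure_factorial_measure_cells[OF iv[OF that] sigma_finite_\<eta>[OF that] U _ _ u]) auto
  have "(\<lambda>\<omega>. \<Prod>i\<in>U. \<Prod>r<?n i. emeasure (\<eta> \<omega>) (B i) - of_nat r) \<in> borel_measurable P"
    by (intro borel_measurable_prod_ennreal borel_measurable_minus_ennreal \<eta>_meas borel_measurable_const B)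
  then have "(\<lambda>\<omega>. emeasure (factorial_measure (\<eta> \<omega>) q) ?R) \<in> borel_measurable P"
    by (subst measurable_cong[OF e])
  moreover have "(\<integral>\<^sup>+ \<omega>. emeasure (factorial_measure (\<eta> \<omega>) q) ?R \<partial>P) = (\<Prod>i\<in>U. emeasure M (B i) ^ ?n i)"
    using factorial_moments[OF U B(1,2,3), of ?n] by (subst nn_integral_cong[OF e]) auto
  moreover have "(\<Prod>i\<in>U. emeasure M (B i) ^ ?n i) = (\<Prod>k<q. emeasure M (B (u k)))"
  proof -
    have "(\<Prod>k<q. emeasure M (B (u k))) = (\<Prod>i\<in>U. \<Prod>k\<in>{k\<in>{..<q}. u k = i}. emeasure M (B (u k)))"
      by (rule prod.group[symmetric]) (use U u in auto)
    also have "\<dots> = (\<Prod>i\<in>U. emeasure M (B i) ^ ?n i)"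
      by (intro prod.cong refl) simp
    finally show ?thesis ..
  qed
  moreover have "(\<Prod>k<q. emeasure M (B (u k))) = emeasure (PiM {..<q} (\<lambda>_. M)) ?R"
    using B u by (subst emeasure_PiM) auto
  ultimately show ?thesis unfolding intensity_on_def by simp
qed

text \<open>Factorial moments are only available for sides that are pairwise equal or disjoint, so a
  general rectangle is cut along the atoms of the algebra generated by its sides.\<close>

lemma intensity_on_rectangle:
  assumes E: "\<And>k. k < q \<Longrightarrow> E k \<in> sets M" "\<And>k. k < q \<Longrightarrow> emeasure M (E k) \<noteq> \<infinity>"
  shows "intensity_on q (Pi\<^sub>E {..<q} E)"
proof -
  \<comment> \<open>\<open>B T\<close> consists of the points lying in \<open>E k\<close> for
    exactly the \<open>k\<close> in \<open>T\<close>. The set \<open>U\<close> omits the empty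
    \<open>T\<close>, whose cell meets no side and may have infinite measure.\<close>
  define B where "B = (\<lambda>T. {x \<in> space M. {k. k < q \<and> x \<in> E k} = T})"
  define U where "U = Pow {..<q} - {{}}"
  have B_sets: "B T \<in> sets M" for T
  proof -
    have "B T = (if T \<subseteq> {..<q} then {x \<in> space M. \<forall>k\<in>{..<q}. x \<in> E k \<longleftrightarrow> k \<in> T} else {})"
      by (auto simp: B_def)
    moreover have "{x \<in> space M. \<forall>k\<in>{..<q}. x \<in> E k \<longleftrightarrow> k \<in> T} \<in> sets M"
      using E(1) by (intro sets.sets_Collect_finite_All sets.sets_Collect) auto
    ultimately show ?thesis by auto
  qed
  have disj: "disjoint_family_on B V" for V by (auto simp: disjoint_family_on_def B_def)
  have BE: "B T \<subseteq> E k" if "k \<in> T" for T k using that by (auto simp: B_def)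
  have B_fin: "emeasure M (B T) \<noteq> \<infinity>" if "T \<in> U" for T
  proof -
    have "T \<noteq> {}" "T \<subseteq> {..<q}" using that by (auto simp: U_def)
    then obtain k where k: "k \<in> T" "k < q" by (meson all_not_in_conv lessThan_iff subsetD)
    then show ?thesis using emeasure_mono[OF BE[OF k(1)] E(1)[OF k(2)]] E(2)[OF k(2)] by (auto simp: top_unique)
  qed
  have Un: "E k = (\<Union>T\<in>{T\<in>U. k \<in> T}. B T)" if "k < q" for k
  proof
    show "E k \<subseteq> (\<Union>T\<in>{T\<in>U. k \<in> T}. B T)"
    proof
      fix x assume x: "x \<in> E k"
      then have "x \<in> B {j. j < q \<and> x \<in> E j}" using sets.sets_into_space[OF E(1)[OF that]] by (auto simp: B_def)
      moreover have "{j. j < q \<and> x \<in> E j} \<in> {T\<in>U. k \<in> T}" using that x by (auto simp: U_def)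
      ultimately show "x \<in> (\<Union>T\<in>{T\<in>U. k \<in> T}. B T)" by blast
    qed
  qed (use BE in blast)
  let ?F = "\<Pi>\<^sub>E k\<in>{..<q}. {T\<in>U. k \<in> T}"
  have rect: "Pi\<^sub>E {..<q} E = (\<Union>u\<in>?F. \<Pi>\<^sub>E k\<in>{..<q}. B (u k))"
  proof (intro set_eqI iffI)
    fix x assume x: "x \<in> Pi\<^sub>E {..<q} E"
    have "\<forall>k\<in>{..<q}. \<exists>T. T \<in> U \<and> k \<in> T \<and> x k \<in> B T"
    proof
      fix k assume k: "k \<in> {..<q}"
      then have "x k \<in> E k" using x by (auto simp: PiE_iff)
      then show "\<exists>T. T \<in> U \<and> k \<in> T \<and> x k \<in> B T" using Un[of k] k by auto
    qed
    then obtain u where u: "\<forall>k\<in>{..<q}. u k \<in> U \<and> k \<in> u k \<and> x k \<in> B (u k)" by metis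
    then have "restrict u {..<q} \<in> ?F" "x \<in> (\<Pi>\<^sub>E k\<in>{..<q}. B (restrict u {..<q} k))"
      using x by (auto simp: PiE_iff)
    then show "x \<in> (\<Union>u\<in>?F. \<Pi>\<^sub>E k\<in>{..<q}. B (u k))" by blast
  next
    fix x assume "x \<in> (\<Union>u\<in>?F. \<Pi>\<^sub>E k\<in>{..<q}. B (u k))"
    then obtain u where u: "u \<in> ?F" "x \<in> (\<Pi>\<^sub>E k\<in>{..<q}. B (u k))" by blast
    have "B (u k) \<subseteq> E k" if "k \<in> {..<q}" for k using u(1) that by (intro BE) (auto simp: PiE_iff)
    then have "(\<Pi>\<^sub>E k\<in>{..<q}. B (u k)) \<subseteq> Pi\<^sub>E {..<q} E" by (rule PiE_mono)
    then show "x \<in> Pi\<^sub>E {..<q} E" using u(2) by blast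
  qed
  have U: "finite U" by (simp add: U_def)
  show ?thesis unfolding rect
  proof (rule intensity_on_UN)
    show "finite ?F" using U by (intro finite_PiE) auto
    show "(\<Pi>\<^sub>E k\<in>{..<q}. B (u k)) \<in> sets (PiM {..<q} (\<lambda>_. M))" for u
      using B_sets by (intro sets_PiM_I_finite) auto
    show "disjoint_family_on (\<lambda>u. \<Pi>\<^sub>E k\<in>{..<q}. B (u k)) ?F"
      unfolding disjoint_family_on_def
    proof (intro ballI impI)
      fix u v assume uv: "u \<in> ?F" "v \<in> ?F" "u \<noteq> v"
      have "\<exists>k\<in>{..<q}. u k \<noteq> v k" using PiE_ext[OF uv(1,2)] uv(3) by blast
      then obtain k where k: "k < q" "u k \<noteq> v k" by auto
      then have "B (u k) \<inter> B (v k) = {}" by (auto simp: B_def)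
      then show "(\<Pi>\<^sub>E k\<in>{..<q}. B (u k)) \<inter> (\<Pi>\<^sub>E k\<in>{..<q}. B (v k)) = {}"
        using k(1) by (auto simp: PiE_iff)
    qed
    show "intensity_on q (\<Pi>\<^sub>E k\<in>{..<q}. B (u k))" if "u \<in> ?F" for u
      using that B_sets B_fin disj by (intro intensity_on_cells[OF U]) (auto simp: PiE_iff)
  qed
qed

text \<open>A Dynkin argument starting from rectangles. Complements require subtraction, both
  pathwise and in the mean, so everything is intersected with a window on which the factorial
  measures and the product measure are finite.\<close>

lemma intensity_on_window:
  assumes C: "C \<in> sets (PiM {..<q} (\<lambda>_. M))"
  shows "intensity_on q (C \<inter> (\<Pi>\<^sub>E k\<in>{..<q}. A n))"
proof -
  let ?W = "\<Pi>\<^sub>E k\<in>{..<q}. A n" and ?\<Omega> = "\<Pi>\<^sub>E k\<in>{..<q}. space M"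
  let ?G = "{Pi\<^sub>E {..<q} E | E. \<forall>k\<in>{..<q}. E k \<in> sets M}"
  let ?f = "\<lambda>\<omega> C. emeasure (factorial_measure (\<eta> \<omega>) q) C"
  have W: "?W \<in> sets (PiM {..<q} (\<lambda>_. M))" using A_sets by (intro sets_PiM_I_finite) auto
  have W\<Omega>: "?W \<subseteq> ?\<Omega>" using A_UN by (auto simp: PiE_iff)
  have Gs: "sets (PiM {..<q} (\<lambda>_. M)) = sigma_sets ?\<Omega> ?G"
  proof -
    have "{Pi\<^sub>E {..<q} X |X. X \<in> (\<Pi> j\<in>{..<q}. sets M)} = ?G" by (auto simp: Pi_iff)
    then show ?thesis by (simp add: sets_PiM prod_algebra_eq_finite)
  qed
  have iW: "intensity_on q ?W" using A_sets A_fin by (intro intensity_on_rectangle)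
  have finW: "?f \<omega> ?W \<noteq> \<infinity>" if \<omega>: "\<omega> \<in> space P" for \<omega>
  proof -
    \<comment> \<open>The window is a product of copies of one single cell, indexed by
      \<open>unit\<close>.\<close>
    have "?f \<omega> (\<Pi>\<^sub>E k\<in>{..<q}. (\<lambda>_::unit. A n) ()) = (\<Prod>i\<in>{()}. \<Prod>r<card {k. k < q \<and> () = i}. emeasure (\<eta> \<omega>) (A n) - of_nat r)"
      using A_sets sets_\<eta>[OF \<omega>]
      by (intro emeasure_factorial_measure_cells[OF iv[OF \<omega>] sigma_finite_\<eta>[OF \<omega>]]) (auto simp: disjoint_family_on_def)
    moreover have "emeasure (\<eta> \<omega>) (A n) - of_nat r \<noteq> \<infinity>" for r using \<eta>_fin[OF \<omega>, of n] by simp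
    ultimately show ?thesis by (simp add: ennreal_prod_eq_top)
  qed
  have finMW: "emeasure (PiM {..<q} (\<lambda>_. M)) ?W \<noteq> \<infinity>"
    using A_fin A_sets by (subst emeasure_PiM) (auto simp: power_eq_top_ennreal)
  have IS: "Int_stable ?G" by (rule Int_stable_PiE)
  have GP: "?G \<subseteq> Pow ?\<Omega>"
  proof
    fix X assume "X \<in> ?G"
    then obtain E where E: "X = Pi\<^sub>E {..<q} E" "\<forall>k\<in>{..<q}. E k \<in> sets M" by blast
    have "Pi\<^sub>E {..<q} E \<subseteq> ?\<Omega>" by (intro PiE_mono sets.sets_into_space) (use E in auto)
    then show "X \<in> Pow ?\<Omega>" using E by blast
  qed
  have C': "C \<in> sigma_sets ?\<Omega> ?G" using C Gs by simp
  show ?thesis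
    using IS GP C'
  proof (induction rule: sigma_sets_induct_disjoint)
    case (basic B)
    then obtain E where E: "B = Pi\<^sub>E {..<q} E" "\<forall>k\<in>{..<q}. E k \<in> sets M" by auto
    have "B \<inter> ?W = (\<Pi>\<^sub>E k\<in>{..<q}. E k \<inter> A n)" unfolding E by (rule PiE_Int)
    moreover have "emeasure M (E k \<inter> A n) \<noteq> \<infinity>" if "k < q" for k
      using emeasure_mono[of "E k \<inter> A n" "A n" M] A_sets A_fin[of n] by (auto simp: top_unique)
    ultimately show ?case using E A_sets by (auto intro!: intensity_on_rectangle)
  next
    case empty
    then show ?case by (simp add: intensity_on_def)
  next
    case (compl B)
    have B: "B \<in> sets (PiM {..<q} (\<lambda>_. M))" using compl Gs by simp
    have eq: "(?\<Omega> - B) \<inter> ?W = ?W - B \<inter> ?W" using W\<Omega> by auto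
    have BW: "B \<inter> ?W \<in> sets (PiM {..<q} (\<lambda>_. M))" using B W by auto
    have e: "?f \<omega> (?W - B \<inter> ?W) = ?f \<omega> ?W - ?f \<omega> (B \<inter> ?W)" if "\<omega> \<in> space P" for \<omega>
    proof (rule emeasure_Diff)
      show "?f \<omega> (B \<inter> ?W) \<noteq> \<infinity>"
        using emeasure_mono[of "B \<inter> ?W" ?W "factorial_measure (\<eta> \<omega>) q"] finW[OF that] W sets_factorial_\<eta>[OF that]
        by (auto simp: top_unique)
    qed (use W BW sets_factorial_\<eta>[OF that] in auto)
    have m: "(\<lambda>\<omega>. ?f \<omega> ?W) \<in> borel_measurable P" "(\<lambda>\<omega>. ?f \<omega> (B \<inter> ?W)) \<in> borel_measurable P"
      and i: "(\<integral>\<^sup>+ \<omega>. ?f \<omega> ?W \<partial>P) = emeasure (PiM {..<q} (\<lambda>_. M)) ?W"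
      "(\<integral>\<^sup>+ \<omega>. ?f \<omega> (B \<inter> ?W) \<partial>P) = emeasure (PiM {..<q} (\<lambda>_. M)) (B \<inter> ?W)"
      using iW compl by (auto simp: intensity_on_def)
    have fin: "emeasure (PiM {..<q} (\<lambda>_. M)) (B \<inter> ?W) \<noteq> \<infinity>"
      using emeasure_mono[of "B \<inter> ?W" ?W "PiM {..<q} (\<lambda>_. M)"] W finMW by (auto simp: top_unique)
    have "(\<lambda>\<omega>. ?f \<omega> (?W - B \<inter> ?W)) \<in> borel_measurable P"
      using m by (subst measurable_cong[OF e]) auto
    moreover have "(\<integral>\<^sup>+ \<omega>. ?f \<omega> (?W - B \<inter> ?W) \<partial>P) = (\<integral>\<^sup>+ \<omega>. ?f \<omega> ?W - ?f \<omega> (B \<inter> ?W) \<partial>P)"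
      by (rule nn_integral_cong[OF e])
    moreover have "\<dots> = (\<integral>\<^sup>+ \<omega>. ?f \<omega> ?W \<partial>P) - (\<integral>\<^sup>+ \<omega>. ?f \<omega> (B \<inter> ?W) \<partial>P)"
    proof (rule nn_integral_diff)
      show "AE \<omega> in P. ?f \<omega> (B \<inter> ?W) \<le> ?f \<omega> ?W"
        by (rule AE_I2, rule emeasure_mono) (use W sets_factorial_\<eta> in auto)
    qed (use m i fin in auto)
    moreover have "\<dots> = emeasure (PiM {..<q} (\<lambda>_. M)) (?W - B \<inter> ?W)"
      unfolding i using W BW fin by (intro emeasure_Diff[symmetric]) auto
    ultimately show ?case unfolding eq intensity_on_def by simp
  next
    case (union F)
    have F: "F i \<in> sets (PiM {..<q} (\<lambda>_. M))" for i using union(2) Gs by auto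
    have FW: "F i \<inter> ?W \<in> sets (PiM {..<q} (\<lambda>_. M))" for i using F W by auto
    have disj: "disjoint_family (\<lambda>i. F i \<inter> ?W)" using union(1) by (auto simp: disjoint_family_on_def)
    have eq: "(\<Union>i. F i) \<inter> ?W = (\<Union>i. F i \<inter> ?W)" by auto
    have e: "?f \<omega> (\<Union>i. F i \<inter> ?W) = (\<Sum>i. ?f \<omega> (F i \<inter> ?W))" if "\<omega> \<in> space P" for \<omega>
      using FW disj sets_factorial_\<eta>[OF that] by (intro suminf_emeasure[symmetric]) auto
    have m: "(\<lambda>\<omega>. ?f \<omega> (F i \<inter> ?W)) \<in> borel_measurable P" for i
      using union(3) by (auto simp: intensity_on_def)
    have "(\<lambda>\<omega>. ?f \<omega> (\<Union>i. F i \<inter> ?W)) \<in> borel_measurable P"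
      by (subst measurable_cong[OF e]) (use m in auto)
    moreover have "(\<integral>\<^sup>+ \<omega>. ?f \<omega> (\<Union>i. F i \<inter> ?W) \<partial>P) = (\<Sum>i. \<integral>\<^sup>+ \<omega>. ?f \<omega> (F i \<inter> ?W) \<partial>P)"
      using m by (subst nn_integral_cong[OF e]) (auto intro!: nn_integral_suminf)
    moreover have "\<dots> = (\<Sum>i. emeasure (PiM {..<q} (\<lambda>_. M)) (F i \<inter> ?W))"
      using union(3) by (auto simp: intensity_on_def)
    moreover have "\<dots> = emeasure (PiM {..<q} (\<lambda>_. M)) (\<Union>i. F i \<inter> ?W)"
      using FW disj by (intro suminf_emeasure) auto
    ultimately show ?case unfolding eq intensity_on_def by simp
  qed
qed

text \<open>The windows exhaust the product space because a tuple has only finitely many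
  coordinates; monotone convergence removes them.\<close>

lemma intensity_on_all:
  assumes C: "C \<in> sets (PiM {..<q} (\<lambda>_. M))"
  shows "intensity_on q C"
proof -
  let ?W = "\<lambda>n. C \<inter> (\<Pi>\<^sub>E k\<in>{..<q}. A n)"
  let ?f = "\<lambda>\<omega> C. emeasure (factorial_measure (\<eta> \<omega>) q) C"
  have W: "?W n \<in> sets (PiM {..<q} (\<lambda>_. M))" for n using A_sets C by (intro sets.Int sets_PiM_I_finite) auto
  have inc: "incseq ?W"
    unfolding incseq_def using A_inc[THEN incseqD] by (intro allI impI Int_mono order.refl PiE_mono) auto
  have UN: "(\<Union>n. ?W n) = C"
  proof
    show "C \<subseteq> (\<Union>n. ?W n)"
    proof
      fix x assume x: "x \<in> C"
      then have xs: "x \<in> {..<q} \<rightarrow>\<^sub>E space M" using sets.sets_into_space[OF C] by (auto simp: space_PiM)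
      have "\<forall>k\<in>{..<q}. \<exists>n. x k \<in> A n" using xs A_UN by (auto simp: PiE_iff)
      then obtain n where n: "\<forall>k\<in>{..<q}. x k \<in> A (n k)" by metis
      have "x k \<in> A (Max (n ` {..<q}))" if "k < q" for k
        using n that A_inc[THEN incseqD, of "n k" "Max (n ` {..<q})"] by auto
      then have "x \<in> ?W (Max (n ` {..<q}))" using x xs by (auto simp: PiE_iff)
      then show "x \<in> (\<Union>n. ?W n)" by blast
    qed
  qed auto
  have e: "?f \<omega> C = (SUP n. ?f \<omega> (?W n))" if "\<omega> \<in> space P" for \<omega>
  proof -
    have "(SUP n. ?f \<omega> (?W n)) = ?f \<omega> (\<Union>n. ?W n)"
      by (rule SUP_emeasure_incseq[OF _ inc]) (use W sets_factorial_\<eta>[OF that] in auto)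
    then show ?thesis unfolding UN by (rule sym)
  qed
  have iW: "intensity_on q (?W n)" for n by (rule intensity_on_window[OF C])
  have m: "(\<lambda>\<omega>. ?f \<omega> (?W n)) \<in> borel_measurable P" for n using iW by (simp add: intensity_on_def)
  have "(\<lambda>\<omega>. ?f \<omega> C) \<in> borel_measurable P"
    by (subst measurable_cong[OF e]) (use m in auto)
  moreover have "(\<integral>\<^sup>+ \<omega>. ?f \<omega> C \<partial>P) = (\<integral>\<^sup>+ \<omega>. (SUP n. ?f \<omega> (?W n)) \<partial>P)"
    by (rule nn_integral_cong[OF e])
  moreover have "\<dots> = (SUP n. \<integral>\<^sup>+ \<omega>. ?f \<omega> (?W n) \<partial>P)"
  proof (rule nn_integral_monotone_convergence_SUP_AE)
    show "AE \<omega> in P. ?f \<omega> (?W n) \<le> ?f \<omega> (?W (Suc n))" for n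
      by (rule AE_I2, rule emeasure_mono) (use W sets_factorial_\<eta> inc in \<open>auto simp: incseq_Suc_iff\<close>)
  qed (use m in auto)
  moreover have "\<dots> = (SUP n. emeasure (PiM {..<q} (\<lambda>_. M)) (?W n))"
    using iW by (simp add: intensity_on_def)
  moreover have "\<dots> = emeasure (PiM {..<q} (\<lambda>_. M)) C"
  proof -
    have "(SUP n. emeasure (PiM {..<q} (\<lambda>_. M)) (?W n)) = emeasure (PiM {..<q} (\<lambda>_. M)) (\<Union>n. ?W n)"
      by (rule SUP_emeasure_incseq[OF _ inc]) (use W in auto)
    then show ?thesis unfolding UN .
  qed
  ultimately show ?thesis unfolding intensity_on_def by simp
qed

text \<open>The bridge from paths to expectations: later moments are first rewritten pathwise as
  sums of factorial integrals, to which this formula applies.\<close>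

theorem Campbell:
  assumes g: "g \<in> borel_measurable (PiM {..<q} (\<lambda>_. M))"
  shows "(\<lambda>\<omega>. \<integral>\<^sup>+ x. g x \<partial>factorial_measure (\<eta> \<omega>) q) \<in> borel_measurable P"
    and "(\<integral>\<^sup>+ \<omega>. (\<integral>\<^sup>+ x. g x \<partial>factorial_measure (\<eta> \<omega>) q) \<partial>P) = (\<integral>\<^sup>+ x. g x \<partial>PiM {..<q} (\<lambda>_. M))"
proof -
  let ?f = "\<lambda>g \<omega>. \<integral>\<^sup>+ x. g x \<partial>factorial_measure (\<eta> \<omega>) q" and ?N = "PiM {..<q} (\<lambda>_. M)"
  have gm: "h \<in> borel_measurable (factorial_measure (\<eta> \<omega>) q)"
    if "h \<in> borel_measurable ?N" "\<omega> \<in> space P" for h :: "_ \<Rightarrow> ennreal" and \<omega>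
    using that(1) measurable_cong_sets[OF sets_factorial_\<eta>[OF that(2)] refl] by blast
  have sp: "space (factorial_measure (\<eta> \<omega>) q) = space ?N" if "\<omega> \<in> space P" for \<omega>
    using space_factorial_\<eta>[OF that] by (simp add: space_PiM)
  have "?f g \<in> borel_measurable P \<and> (\<integral>\<^sup>+ \<omega>. ?f g \<omega> \<partial>P) = (\<integral>\<^sup>+ x. g x \<partial>?N)"
    using g
  proof (induction rule: borel_measurable_induct)
    case (cong f g)
    have "?f f \<omega> = ?f g \<omega>" if "\<omega> \<in> space P" for \<omega>
      using cong(3) sp[OF that] by (intro nn_integral_cong) auto
    moreover have "(\<integral>\<^sup>+ x. f x \<partial>?N) = (\<integral>\<^sup>+ x. g x \<partial>?N)" using cong(3) by (rule nn_integral_cong)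
    ultimately show ?case using cong(4) by (simp cong: measurable_cong nn_integral_cong)
  next
    case (set C)
    have "?f (indicator C) \<omega> = emeasure (factorial_measure (\<eta> \<omega>) q) C" if "\<omega> \<in> space P" for \<omega>
      using set sets_factorial_\<eta>[OF that] by (intro nn_integral_indicator) auto
    then show ?case using intensity_on_all[OF set] set
      by (simp add: intensity_on_def cong: measurable_cong nn_integral_cong)
  next
    case (mult u c)
    have "?f (\<lambda>x. c * u x) \<omega> = c * ?f u \<omega>" if "\<omega> \<in> space P" for \<omega>
      by (rule nn_integral_cmult[OF gm[OF mult(2) that]])
    moreover have "(\<lambda>\<omega>. c * ?f u \<omega>) \<in> borel_measurable P"
      using mult(4) by (intro borel_measurable_times_ennreal borel_measurable_const) blast
    ultimately show ?case using mult(4) mult(2)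
      by (simp add: nn_integral_cmult cong: measurable_cong nn_integral_cong)
  next
    case (add u v)
    have "?f (\<lambda>x. v x + u x) \<omega> = ?f v \<omega> + ?f u \<omega>" if "\<omega> \<in> space P" for \<omega>
      by (rule nn_integral_add[OF gm[OF \<open>v \<in> borel_measurable ?N\<close> that] gm[OF \<open>u \<in> borel_measurable ?N\<close> that]])
    moreover have "(\<lambda>\<omega>. ?f v \<omega> + ?f u \<omega>) \<in> borel_measurable P"
      using add.IH by (intro borel_measurable_add) blast+
    ultimately show ?case using add
      by (simp add: nn_integral_add cong: measurable_cong nn_integral_cong)
  next
    case (seq U)
    have e: "?f (SUP i. U i) \<omega> = (SUP i. ?f (U i) \<omega>)" if "\<omega> \<in> space P" for \<omega>
      unfolding SUP_apply by (rule nn_integral_monotone_convergence_SUP[OF \<open>incseq U\<close> gm[OF seq(1) that]])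
    have inc: "incseq (\<lambda>i. ?f (U i))"
      using \<open>incseq U\<close> by (intro incseq_SucI le_funI nn_integral_mono) (auto simp: incseq_Suc_iff le_fun_def)
    have m: "?f (U i) \<in> borel_measurable P" for i using seq.IH by blast
    have "(\<integral>\<^sup>+ \<omega>. ?f (SUP i. U i) \<omega> \<partial>P) = (\<integral>\<^sup>+ \<omega>. (SUP i. ?f (U i) \<omega>) \<partial>P)" by (rule nn_integral_cong[OF e])
    also have "\<dots> = (SUP i. \<integral>\<^sup>+ \<omega>. ?f (U i) \<omega> \<partial>P)"
      by (rule nn_integral_monotone_convergence_SUP[OF inc m])
    also have "\<dots> = (SUP i. \<integral>\<^sup>+ x. U i x \<partial>?N)" using seq.IH by simp
    also have "\<dots> = (\<integral>\<^sup>+ x. (SUP i. U i) x \<partial>?N)"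
      unfolding SUP_apply by (rule nn_integral_monotone_convergence_SUP[OF \<open>incseq U\<close> seq(1), symmetric])
    finally have "(\<integral>\<^sup>+ \<omega>. ?f (SUP i. U i) \<omega> \<partial>P) = (\<integral>\<^sup>+ x. (SUP i. U i) x \<partial>?N)" .
    moreover have "?f (SUP i. U i) \<in> borel_measurable P"
      by (subst measurable_cong[OF e]) (use m in auto)
    ultimately show ?case by blast
  qed
  then show "?f g \<in> borel_measurable P" "(\<integral>\<^sup>+ \<omega>. ?f g \<omega> \<partial>P) = (\<integral>\<^sup>+ x. g x \<partial>?N)" by auto
qed

end

lemma integer_valued_null_measure: "integer_valued (null_measure M)"
  unfolding integer_valued_def by (auto intro!: image_eqI[of _ _ 0])

text \<open>Off the null event where the counting measure is infinite on some \<open>A i\<close>, replace it by 0.\<close>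

lemma poisson_process_locally_finite:
  assumes pp: "poisson_process P M \<eta>"
  obtains \<eta>' A where "locally_finite_poisson P M \<eta>' A" "AE \<omega> in P. \<eta>' \<omega> = \<eta> \<omega>"
proof -
  interpret P: prob_space P using pp by (simp add: poisson_process_def)
  interpret M: sigma_finite_measure M using pp by (simp add: poisson_process_def)
  obtain A :: "nat \<Rightarrow> _" where A: "range A \<subseteq> sets M" "(\<Union>i. A i) = space M"
      "\<And>i. emeasure M (A i) \<noteq> \<infinity>" "incseq A"
    using M.sigma_finite_incseq by metis
  have As: "A i \<in> sets M" for i using A(1) by auto
  have rc: "random_counting_measure P M \<eta>" using pp by (simp add: poisson_process_def)
  have meas: "(\<lambda>\<omega>. emeasure (\<eta> \<omega>) B) \<in> borel_measurable P" if "B \<in> sets M" for B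
    using rc that by (auto simp: random_counting_measure_def)
  define good where "good = {\<omega> \<in> space P. \<forall>i. emeasure (\<eta> \<omega>) (A i) \<noteq> \<infinity>}"
  have good: "good \<in> sets P"
  proof -
    have "{\<omega> \<in> space P. emeasure (\<eta> \<omega>) (A i) \<noteq> \<infinity>} \<in> sets P" for i
      using meas[OF As[of i]] by measurable
    then show ?thesis unfolding good_def by (rule sets.sets_Collect_countable_All)
  qed
  have ae: "AE \<omega> in P. \<omega> \<in> good"
  proof -
    have "AE \<omega> in P. emeasure (\<eta> \<omega>) (A i) \<noteq> \<infinity>" for i
    proof -
      \<comment> \<open>The factorial moment of order 1 is the mean. It is finite for
        \<open>A i\<close>, so the mass of \<open>A i\<close> is almost surely finite.\<close>
      have pd: "poisson_distributed P (\<lambda>\<omega>. emeasure (\<eta> \<omega>) (A i)) (emeasure M (A i))"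
        using pp As by (auto simp: poisson_process_def)
      have "(\<integral>\<^sup>+ \<omega>. emeasure (\<eta> \<omega>) (A i) \<partial>P) = emeasure M (A i)"
        using poisson_factorial_moment[OF P.prob_space_axioms pd A(3), of 1] by simp
      then show ?thesis using A(3)[of i] meas[OF As[of i]] by (intro nn_integral_PInf_AE) auto
    qed
    then have "AE \<omega> in P. \<forall>i. emeasure (\<eta> \<omega>) (A i) \<noteq> \<infinity>" by (simp add: AE_all_countable)
    then show ?thesis using AE_space by eventually_elim (simp add: good_def)
  qed
  define \<eta>' where "\<eta>' = (\<lambda>\<omega>. if \<omega> \<in> good then \<eta> \<omega> else null_measure M)"
  have ae': "AE \<omega> in P. \<eta>' \<omega> = \<eta> \<omega>"
    using ae by eventually_elim (simp add: \<eta>'_def)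
  have "locally_finite_poisson P M \<eta>' A"
  proof
    show "A i \<in> sets M" for i by (rule As)
    show "incseq A" "(\<Union>i. A i) = space M" using A by auto
    show "emeasure M (A i) \<noteq> \<infinity>" for i by (rule A)
    fix \<omega> assume \<omega>: "\<omega> \<in> space P"
    show "sets (\<eta>' \<omega>) = sets M" using rc \<omega> by (auto simp: \<eta>'_def random_counting_measure_def)
    show "integer_valued (\<eta>' \<omega>)"
      using rc \<omega> integer_valued_null_measure by (auto simp: \<eta>'_def random_counting_measure_def integer_valued_def)
    show "emeasure (\<eta>' \<omega>) (A i) \<noteq> \<infinity>" for i
      by (cases "\<omega> \<in> good") (auto simp: \<eta>'_def good_def)
  next
    fix B assume B: "B \<in> sets M"
    have "(\<lambda>\<omega>. if \<omega> \<in> good then emeasure (\<eta> \<omega>) B else 0) \<in> borel_measurable P"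
      using good meas[OF B] by (intro measurable_If_set) auto
    moreover have "(\<lambda>\<omega>. emeasure (\<eta>' \<omega>) B) = (\<lambda>\<omega>. if \<omega> \<in> good then emeasure (\<eta> \<omega>) B else 0)"
      by (auto simp: \<eta>'_def)
    ultimately show "(\<lambda>\<omega>. emeasure (\<eta>' \<omega>) B) \<in> borel_measurable P" by simp
  next
    fix U :: "nat set set" and B n
    assume U: "finite U" and B: "\<And>i. i \<in> U \<Longrightarrow> B i \<in> sets M" "disjoint_family_on B U"
      "\<And>i. i \<in> U \<Longrightarrow> emeasure M (B i) \<noteq> \<infinity>"
    have "(\<integral>\<^sup>+ \<omega>. (\<Prod>i\<in>U. \<Prod>r<n i. emeasure (\<eta>' \<omega>) (B i) - of_nat r) \<partial>P) =
        (\<integral>\<^sup>+ \<omega>. (\<Prod>i\<in>U. \<Prod>r<n i. emeasure (\<eta> \<omega>) (B i) - of_nat r) \<partial>P)"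
      by (rule nn_integral_cong_AE) (use ae' in eventually_elim, simp)
    also have "\<dots> = (\<Prod>i\<in>U. emeasure M (B i) ^ n i)"
      by (rule poisson_process_factorial_moments[OF pp U B])
    finally show "(\<integral>\<^sup>+ \<omega>. (\<Prod>i\<in>U. \<Prod>r<n i. emeasure (\<eta>' \<omega>) (B i) - of_nat r) \<partial>P) = (\<Prod>i\<in>U. emeasure M (B i) ^ n i)" .
  qed
  then show ?thesis using ae' by (rule that)
qed

section \<open>Products of U-statistics\<close>

text \<open>Renaming of coordinates. It converts tuples indexed by the blocks of a partition into
  tuples indexed by an initial segment, the form in which \<open>factorial_measure\<close> is
  defined.\<close>

lemma nn_integral_inj_tuples_reindex:
  assumes e: "bij_betw e J J'"
  shows "(\<integral>\<^sup>+ k. g (tuple_at J p k) \<partial>count_space (inj_tuples J I)) =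
    (\<integral>\<^sup>+ k. g (\<lambda>j\<in>J. tuple_at J' p k (e j)) \<partial>count_space (inj_tuples J' I))"
proof -
  have eJ: "e j \<in> J'" if "j \<in> J" for j using e that by (auto simp: bij_betw_def)
  let ?i = "inv_into J e"
  have iJ: "?i j \<in> J" "e (?i j) = j" if "j \<in> J'" for j
    using e that by (auto simp: bij_betw_def inv_into_into f_inv_into_f)
  have ie: "?i (e j) = j" if "j \<in> J" for j using e that by (simp add: bij_betw_inv_into_left)
  have "bij_betw (\<lambda>k. \<lambda>j\<in>J. k (e j)) (inj_tuples J' I) (inj_tuples J I)"
  proof (rule bij_betwI[where g = "\<lambda>k. \<lambda>j\<in>J'. k (?i j)"])
    show "(\<lambda>k. \<lambda>j\<in>J. k (e j)) \<in> inj_tuples J' I \<rightarrow> inj_tuples J I"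
    proof
      fix k assume k: "k \<in> inj_tuples J' I"
      have "inj_on (\<lambda>j\<in>J. k (e j)) J"
      proof (rule inj_onI)
        fix x y assume xy: "x \<in> J" "y \<in> J" "(\<lambda>j\<in>J. k (e j)) x = (\<lambda>j\<in>J. k (e j)) y"
        then have "e x = e y" using k eJ by (auto simp: inj_tuples_def dest: inj_onD)
        then show "x = y" using ie xy by metis
      qed
      then show "(\<lambda>j\<in>J. k (e j)) \<in> inj_tuples J I" using k eJ by (auto simp: inj_tuples_def)
    qed
    show "(\<lambda>k. \<lambda>j\<in>J'. k (?i j)) \<in> inj_tuples J I \<rightarrow> inj_tuples J' I"
    proof
      fix k assume k: "k \<in> inj_tuples J I"
      have "inj_on (\<lambda>j\<in>J'. k (?i j)) J'"
      proof (rule inj_onI)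
        fix x y assume xy: "x \<in> J'" "y \<in> J'" "(\<lambda>j\<in>J'. k (?i j)) x = (\<lambda>j\<in>J'. k (?i j)) y"
        then have "?i x = ?i y" using k iJ(1) by (auto simp: inj_tuples_def dest: inj_onD)
        then show "x = y" using iJ(2) xy by metis
      qed
      then show "(\<lambda>j\<in>J'. k (?i j)) \<in> inj_tuples J' I" using k iJ(1) by (auto simp: inj_tuples_def)
    qed
    show "(\<lambda>j\<in>J'. (\<lambda>j\<in>J. k (e j)) (?i j)) = k" if "k \<in> inj_tuples J' I" for k
      using that iJ by (auto simp: inj_tuples_def PiE_iff extensional_def fun_eq_iff)
    show "(\<lambda>j\<in>J. (\<lambda>j\<in>J'. k (?i j)) (e j)) = k" if "k \<in> inj_tuples J I" for k
      using that eJ ie by (auto simp: inj_tuples_def PiE_iff extensional_def fun_eq_iff)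
  qed
  from nn_integral_bij_count_space[OF this, of "\<lambda>k. g (tuple_at J p k)"]
  have "(\<integral>\<^sup>+ k. g (tuple_at J p k) \<partial>count_space (inj_tuples J I)) =
    (\<integral>\<^sup>+ k. g (tuple_at J p (\<lambda>j\<in>J. k (e j))) \<partial>count_space (inj_tuples J' I))" ..
  also have "\<dots> = (\<integral>\<^sup>+ k. g (\<lambda>j\<in>J. tuple_at J' p k (e j)) \<partial>count_space (inj_tuples J' I))"
    using eJ by (intro nn_integral_cong arg_cong[where f=g]) (auto simp: tuple_at_def fun_eq_iff)
  finally show ?thesis .
qed

lemma measurable_PiM_reindex:
  assumes "\<And>j. j \<in> J \<Longrightarrow> e j \<in> J'"
  shows "(\<lambda>x. \<lambda>j\<in>J. x (e j)) \<in> measurable (PiM J' (\<lambda>_. N)) (PiM J (\<lambda>_. N))"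
  using assms by (intro measurable_restrict measurable_component_singleton) auto

text \<open>The same renaming for the product measure, checked on rectangles; it leads from the
  result of \<open>Campbell\<close> back to the block-indexed product.\<close>

lemma distr_PiM_reindex_sigma_finite:
  fixes J :: "'j set" and J' :: "'k set"
  assumes M: "sigma_finite_measure M" and J: "finite J" and e: "bij_betw e J J'"
  shows "distr (PiM J' (\<lambda>_. M)) (PiM J (\<lambda>_. M)) (\<lambda>x. \<lambda>j\<in>J. x (e j)) = PiM J (\<lambda>_. M)"
proof -
  interpret product_sigma_finite "\<lambda>_ :: 'j. M" using M by (simp add: product_sigma_finite_def)
  interpret R: product_sigma_finite "\<lambda>_ :: 'k. M" using M by (simp add: product_sigma_finite_def)
  have eJ: "e j \<in> J'" if "j \<in> J" for j using e that by (auto simp: bij_betw_def)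
  have J': "finite J'" using J e bij_betw_finite by blast
  let ?h = "\<lambda>x. \<lambda>j\<in>J. x (e j)"
  have h: "?h \<in> measurable (PiM J' (\<lambda>_. M)) (PiM J (\<lambda>_. M))"
    using eJ by (rule measurable_PiM_reindex)
  show ?thesis
  proof (rule PiM_eqI[OF J])
    fix A assume A: "\<And>i. i \<in> J \<Longrightarrow> A i \<in> sets M"
    let ?i = "inv_into J e"
    have iJ: "?i j \<in> J" "e (?i j) = j" if "j \<in> J'" for j
      using e that by (auto simp: bij_betw_def inv_into_into f_inv_into_f)
    have ie: "?i (e j) = j" if "j \<in> J" for j using e that by (simp add: bij_betw_inv_into_left)
    have AM: "A j \<subseteq> space M" if "j \<in> J" for j using sets.sets_into_space[OF A[OF that]] .
    have "?h -` Pi\<^sub>E J A \<inter> space (PiM J' (\<lambda>_. M)) = (\<Pi>\<^sub>E j\<in>J'. A (?i j))"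
    proof (intro set_eqI iffI)
      fix x assume "x \<in> ?h -` Pi\<^sub>E J A \<inter> space (PiM J' (\<lambda>_. M))"
      then have x: "\<And>j. j \<in> J \<Longrightarrow> x (e j) \<in> A j" "x \<in> extensional J'" by (auto simp: space_PiM PiE_iff)
      show "x \<in> (\<Pi>\<^sub>E j\<in>J'. A (?i j))"
        unfolding PiE_iff using x(2) x(1)[OF iJ(1)] iJ(2) by auto
    next
      fix x assume x: "x \<in> (\<Pi>\<^sub>E j\<in>J'. A (?i j))"
      then have "x (e j) \<in> A j" if "j \<in> J" for j using eJ[OF that] ie[OF that] by (metis PiE_mem)
      moreover have "x j \<in> space M" if "j \<in> J'" for j using x AM iJ(1) that by (auto simp: PiE_iff)
      ultimately show "x \<in> ?h -` Pi\<^sub>E J A \<inter> space (PiM J' (\<lambda>_. M))" using x by (auto simp: space_PiM PiE_iff)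
    qed
    then have "emeasure (distr (PiM J' (\<lambda>_. M)) (PiM J (\<lambda>_. M)) ?h) (Pi\<^sub>E J A) = emeasure (PiM J' (\<lambda>_. M)) (\<Pi>\<^sub>E j\<in>J'. A (?i j))"
      using h A J by (subst emeasure_distr) (auto intro!: sets_PiM_I_finite)
    also have "\<dots> = (\<Prod>j\<in>J'. emeasure M (A (?i j)))"
      using J' A iJ(1) by (intro R.emeasure_PiM) auto
    also have "\<dots> = (\<Prod>j\<in>J. emeasure M (A (?i (e j))))"
      by (rule prod.reindex_bij_betw[OF e, symmetric])
    also have "\<dots> = (\<Prod>j\<in>J. emeasure M (A j))" using ie by (intro prod.cong) auto
    finally show "emeasure (distr (PiM J' (\<lambda>_. M)) (PiM J (\<lambda>_. M)) ?h) (Pi\<^sub>E J A) = (\<Prod>j\<in>J. emeasure M (A j))" .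
  qed simp
qed

subsection \<open>Rows and transversal partitions\<close>

text \<open>The notions are relativised to a set \<open>L\<close> of rows because the recursions
  remove arbitrary sets of rows. The numbering of the variables by \<open>offset\<close> is kept, so
  nothing has to be renumbered.\<close>

definition rows :: "(nat \<Rightarrow> nat) \<Rightarrow> nat set \<Rightarrow> nat set" where
  "rows q L = (\<Union>l\<in>L. row q l)"

definition Part_on :: "(nat \<Rightarrow> nat) \<Rightarrow> nat set \<Rightarrow> nat set set set" where
  "Part_on q L = {\<sigma>. partition_on (rows q L) \<sigma> \<and> (\<forall>l\<in>L. \<forall>B\<in>\<sigma>. card (B \<inter> row q l) \<le> 1)}"

definition block :: "nat set set \<Rightarrow> nat \<Rightarrow> nat set" where
  "block \<sigma> n = (THE B. B \<in> \<sigma> \<and> n \<in> B)"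

definition tensor_on ::
    "(nat \<Rightarrow> nat) \<Rightarrow> nat set \<Rightarrow> (nat \<Rightarrow> (nat \<Rightarrow> 'a) \<Rightarrow> real) \<Rightarrow> nat set set \<Rightarrow> (nat set \<Rightarrow> 'a) \<Rightarrow> real" where
  "tensor_on q L f \<sigma> y = (\<Prod>l\<in>L. f l (\<lambda>i\<in>{..<q l}. y (block \<sigma> (offset q l + i))))"

lemma tensor_part_eq: "tensor_part m q f \<sigma> = tensor_on q {..<m} f \<sigma>"
  by (simp add: fun_eq_iff tensor_part_def tensor_def tensor_on_def block_def)

lemma finite_row [simp]: "finite (row q l)"
  by (simp add: row_def)

lemma finite_rows [simp]: "finite L \<Longrightarrow> finite (rows q L)"
  by (simp add: rows_def)

lemma mem_row_iff: "n \<in> row q l \<longleftrightarrow> (\<exists>i<q l. n = offset q l + i)"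
proof
  assume "n \<in> row q l"
  then show "\<exists>i<q l. n = offset q l + i"
    by (intro exI[of _ "n - offset q l"]) (auto simp: row_def offset_def)
qed (auto simp: row_def offset_def)

lemma offset_mono: "l \<le> l' \<Longrightarrow> offset q l \<le> offset q l'"
  unfolding offset_def by (rule sum_mono2) auto

lemma row_disjoint:
  assumes "l \<noteq> l'" shows "row q l \<inter> row q l' = {}"
proof -
  have *: "row q l \<inter> row q l' = {}" if "l < l'" for l l'
    using offset_mono[of "Suc l" l' q] that by (auto simp: row_def)
  show ?thesis using *[of l l'] *[of l' l] assms by (cases l l' rule: linorder_cases) auto
qed

lemma rows_lessThan: "rows q {..<m} = {..<offset q m}"
proof (induction m)
  case (Suc m)
  have "rows q {..<Suc m} = rows q {..<m} \<union> row q m" by (auto simp: rows_def lessThan_Suc)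
  also have "\<dots> = {..<offset q (Suc m)}"
    using offset_mono[of m "Suc m" q] unfolding Suc row_def by auto
  finally show ?case .
qed (simp add: rows_def offset_def)

lemma Part_eq: "Part m q = Part_on q {..<m}"
  by (auto simp: Part_def Part_on_def rows_lessThan)

lemma rows_Un: "rows q (C \<union> D) = rows q C \<union> rows q D"
  by (auto simp: rows_def)

lemma rows_mono: "C \<subseteq> D \<Longrightarrow> rows q C \<subseteq> rows q D"
  by (auto simp: rows_def)

lemma rows_disjoint: "C \<inter> D = {} \<Longrightarrow> rows q C \<inter> rows q D = {}"
proof (rule ccontr)
  assume CD: "C \<inter> D = {}" and "rows q C \<inter> rows q D \<noteq> {}"
  then obtain x l l' where x: "x \<in> row q l" "l \<in> C" "x \<in> row q l'" "l' \<in> D" unfolding rows_def by blast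
  then have "l \<noteq> l'" using CD by auto
  from row_disjoint[OF this, of q] show False using x by auto
qed

lemma finite_Part_on: "finite L \<Longrightarrow> finite (Part_on q L)"
  unfolding Part_on_def
  by (rule finite_subset[of _ "Pow (Pow (rows q L))"]) (auto simp: partition_on_def)

lemma block_eq:
  assumes "partition_on A \<sigma>" "B \<in> \<sigma>" "n \<in> B"
  shows "block \<sigma> n = B"
  unfolding block_def using assms partition_onD2[OF assms(1)]
  by (intro the_equality) (auto simp: disjoint_def)

lemma block_in:
  assumes "partition_on A \<sigma>" "n \<in> A"
  shows "block \<sigma> n \<in> \<sigma>" "n \<in> block \<sigma> n"
proof -
  obtain B where "B \<in> \<sigma>" "n \<in> B" using assms by (auto simp: partition_on_def)
  then show "block \<sigma> n \<in> \<sigma>" "n \<in> block \<sigma> n" using block_eq[OF assms(1)] by auto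
qed

lemma finite_Part_on_elem: "finite L \<Longrightarrow> \<sigma> \<in> Part_on q L \<Longrightarrow> finite \<sigma>"
  unfolding Part_on_def using finite_elements finite_rows by blast

text \<open>Injectivity is asked within each row only: different rows may use the same index, and it
  is these coincidences that the partitions record.\<close>

definition row_inj_maps :: "(nat \<Rightarrow> nat) \<Rightarrow> nat set \<Rightarrow> 'i set \<Rightarrow> (nat \<Rightarrow> 'i) set" where
  "row_inj_maps q L I = {k \<in> rows q L \<rightarrow>\<^sub>E I. \<forall>l\<in>L. inj_on k (row q l)}"

lemma row_inj_maps_curry:
  fixes I :: "'i set"
  shows "bij_betw (\<lambda>h. \<lambda>l\<in>L. \<lambda>i\<in>{..<q l}. h (offset q l + i)) (row_inj_maps q L I)
     (\<Pi>\<^sub>E l\<in>L. inj_tuples {..<q l} I)"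
proof -
  \<comment> \<open>Rows are disjoint, so \<open>w n\<close> is the unique row containing
    \<open>n\<close>; with it a family of tuples is glued into one map.\<close>
  define w where "w = (\<lambda>n. THE l. l \<in> L \<and> n \<in> row q l)"
  have w: "w n = l" if "l \<in> L" "n \<in> row q l" for n l
    unfolding w_def using that row_disjoint[of _ l q] by (intro the_equality) auto
  define g where "g = (\<lambda>(h :: nat \<Rightarrow> nat \<Rightarrow> 'i). \<lambda>n\<in>rows q L. h (w n) (n - offset q (w n)))"
  have gv: "g h (offset q l + i) = h l i" if "l \<in> L" "i < q l" for h l i
  proof -
    have n: "offset q l + i \<in> row q l" using that by (auto simp: mem_row_iff)
    then show ?thesis using w[OF that(1) n] that by (auto simp: g_def rows_def)
  qed
  show ?thesis
  proof (rule bij_betwI[where g = g])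
    show "(\<lambda>h. \<lambda>l\<in>L. \<lambda>i\<in>{..<q l}. h (offset q l + i)) \<in> row_inj_maps q L I \<rightarrow> (\<Pi>\<^sub>E l\<in>L. inj_tuples {..<q l} I)"
    proof
      fix h assume h: "h \<in> row_inj_maps q L I"
      have "(\<lambda>i\<in>{..<q l}. h (offset q l + i)) \<in> inj_tuples {..<q l} I" if l: "l \<in> L" for l
      proof -
        have n: "offset q l + i \<in> row q l" "offset q l + i \<in> rows q L" if "i < q l" for i
          using that l by (auto simp: mem_row_iff rows_def)
        have "inj_on h (row q l)" "h \<in> rows q L \<rightarrow>\<^sub>E I" using h l by (auto simp: row_inj_maps_def)
        moreover have "inj_on (\<lambda>i\<in>{..<q l}. h (offset q l + i)) {..<q l}"
        proof (rule inj_onI)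
          fix x y assume "x \<in> {..<q l}" "y \<in> {..<q l}"
            "(\<lambda>i\<in>{..<q l}. h (offset q l + i)) x = (\<lambda>i\<in>{..<q l}. h (offset q l + i)) y"
          then show "x = y"
            using inj_onD[OF \<open>inj_on h (row q l)\<close> _ n(1)[of x] n(1)[of y]] by simp
        qed
        ultimately show ?thesis
          using n by (auto simp: inj_tuples_def PiE_iff)
      qed
      then show "(\<lambda>l\<in>L. \<lambda>i\<in>{..<q l}. h (offset q l + i)) \<in> (\<Pi>\<^sub>E l\<in>L. inj_tuples {..<q l} I)" by auto
    qed
    show "g \<in> (\<Pi>\<^sub>E l\<in>L. inj_tuples {..<q l} I) \<rightarrow> row_inj_maps q L I"
    proof
      fix h assume h: "h \<in> (\<Pi>\<^sub>E l\<in>L. inj_tuples {..<q l} I)"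
      have hl: "h l \<in> inj_tuples {..<q l} I" if "l \<in> L" for l using h that by (auto simp: PiE_iff)
      have "inj_on (g h) (row q l)" if l: "l \<in> L" for l
      proof (rule inj_onI)
        fix x y assume "x \<in> row q l" "y \<in> row q l" and e: "g h x = g h y"
        then obtain i j where ij: "i < q l" "x = offset q l + i" "j < q l" "y = offset q l + j"
          by (auto simp: mem_row_iff)
        then have "h l i = h l j" using e gv[OF l] by simp
        then show "x = y" using hl[OF l] ij by (auto simp: inj_tuples_def dest: inj_onD)
      qed
      moreover have "g h x \<in> I" if x: "x \<in> rows q L" for x
      proof -
        obtain l i where li: "l \<in> L" "i < q l" "x = offset q l + i" using x by (auto simp: rows_def mem_row_iff)
        then show ?thesis using gv[OF li(1,2)] hl[OF li(1)] by (auto simp: inj_tuples_def)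
      qed
      moreover have "g h \<in> extensional (rows q L)" by (simp add: g_def)
      ultimately show "g h \<in> row_inj_maps q L I" by (simp add: row_inj_maps_def PiE_iff)
    qed
    show "g (\<lambda>l\<in>L. \<lambda>i\<in>{..<q l}. h (offset q l + i)) = h" if h: "h \<in> row_inj_maps q L I" for h
    proof (rule extensionalityI[where A = "rows q L"])
      fix x assume x: "x \<in> rows q L"
      then obtain l i where li: "l \<in> L" "i < q l" "x = offset q l + i" by (auto simp: rows_def mem_row_iff)
      then show "g (\<lambda>l\<in>L. \<lambda>i\<in>{..<q l}. h (offset q l + i)) x = h x" using gv[OF li(1,2)] by simp
    qed (use h in \<open>auto simp: g_def row_inj_maps_def PiE_iff\<close>)
    show "(\<lambda>l\<in>L. \<lambda>i\<in>{..<q l}. g h (offset q l + i)) = h" if h: "h \<in> (\<Pi>\<^sub>E l\<in>L. inj_tuples {..<q l} I)" for h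
    proof (rule extensionalityI[where A = L])
      fix l assume l: "l \<in> L"
      have "(\<lambda>i\<in>{..<q l}. g h (offset q l + i)) = h l"
        by (rule extensionalityI[where A = "{..<q l}"]) (use h l gv in \<open>auto simp: inj_tuples_def PiE_iff\<close>)
      then show "(\<lambda>l\<in>L. \<lambda>i\<in>{..<q l}. g h (offset q l + i)) l = h l" using l by simp
    qed (use h in \<open>auto simp: PiE_iff\<close>)
  qed
qed

text \<open>A map factors uniquely through its kernel: a partition into fibres and an injective map
  on the blocks. Injectivity on each row says exactly that no fibre meets a row twice.\<close>

lemma row_inj_maps_kernel:
  assumes L: "finite L"
  shows "bij_betw (\<lambda>(\<sigma>, k). \<lambda>n\<in>rows q L. k (block \<sigma> n)) (SIGMA \<sigma>:Part_on q L. inj_tuples \<sigma> I)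
     (row_inj_maps q L I)"
proof (rule bij_betwI')
  fix x y assume "x \<in> (SIGMA \<sigma>:Part_on q L. inj_tuples \<sigma> I)" "y \<in> (SIGMA \<sigma>:Part_on q L. inj_tuples \<sigma> I)"
  then obtain \<sigma> k \<tau> h where x: "x = (\<sigma>, k)" "\<sigma> \<in> Part_on q L" "k \<in> inj_tuples \<sigma> I"
    and y: "y = (\<tau>, h)" "\<tau> \<in> Part_on q L" "h \<in> inj_tuples \<tau> I" by auto
  have p: "partition_on (rows q L) \<sigma>" "partition_on (rows q L) \<tau>" using x y by (auto simp: Part_on_def)
  \<comment> \<open>Since \<open>k\<close> is injective, the blocks are the fibres of the composed
    map, which therefore determines the partition.\<close>
  have ker: "B \<in> \<sigma> \<longleftrightarrow> (\<exists>n\<in>rows q L. B = {n'\<in>rows q L. k (block \<sigma> n') = k (block \<sigma> n)})"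
    if p: "partition_on (rows q L) \<sigma>" and k: "k \<in> inj_tuples \<sigma> I" for \<sigma> k B
  proof -
    have b: "{n'\<in>rows q L. k (block \<sigma> n') = k (block \<sigma> n)} = block \<sigma> n" if "n \<in> rows q L" for n
    proof (intro set_eqI iffI)
      fix n' assume "n' \<in> {n'\<in>rows q L. k (block \<sigma> n') = k (block \<sigma> n)}"
      then have n': "n' \<in> rows q L" "k (block \<sigma> n') = k (block \<sigma> n)" by auto
      then have "block \<sigma> n' = block \<sigma> n" using k block_in[OF p] that by (auto simp: inj_tuples_def dest: inj_onD)
      then show "n' \<in> block \<sigma> n" using block_in[OF p n'(1)] by simp
    next
      fix n' assume n': "n' \<in> block \<sigma> n"
      have "block \<sigma> n \<subseteq> rows q L" using block_in(1)[OF p that] p by (auto simp: partition_on_def)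
      moreover have "block \<sigma> n' = block \<sigma> n" by (rule block_eq[OF p block_in(1)[OF p that] n'])
      ultimately have "n' \<in> rows q L" "block \<sigma> n' = block \<sigma> n" using n' by auto
      then show "n' \<in> {n'\<in>rows q L. k (block \<sigma> n') = k (block \<sigma> n)}" by simp
    qed
    have "B \<in> \<sigma> \<longleftrightarrow> (\<exists>n\<in>rows q L. B = block \<sigma> n)"
    proof
      assume B: "B \<in> \<sigma>"
      then have "B \<noteq> {}" "B \<subseteq> rows q L" using p by (auto simp: partition_on_def)
      then show "\<exists>n\<in>rows q L. B = block \<sigma> n" using block_eq[OF p B] by (metis all_not_in_conv subsetD)
    qed (use block_in[OF p] in auto)
    then show ?thesis using b by auto
  qed
  show "((case x of (\<sigma>, k) \<Rightarrow> \<lambda>n\<in>rows q L. k (block \<sigma> n)) = (case y of (\<sigma>, k) \<Rightarrow> \<lambda>n\<in>rows q L. k (block \<sigma> n))) = (x = y)"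
  proof
    assume e': "(case x of (\<sigma>, k) \<Rightarrow> \<lambda>n\<in>rows q L. k (block \<sigma> n)) = (case y of (\<sigma>, k) \<Rightarrow> \<lambda>n\<in>rows q L. k (block \<sigma> n))"
    have e: "k (block \<sigma> n) = h (block \<tau> n)" if "n \<in> rows q L" for n
      using fun_cong[OF e', of n] that x(1) y(1) by simp
    have "B \<in> \<sigma> \<longleftrightarrow> B \<in> \<tau>" for B
      unfolding ker[OF p(1) x(3)] ker[OF p(2) y(3)] using e by (intro bex_cong refl) auto
    then have "\<sigma> = \<tau>" by blast
    moreover have "k = h"
    proof (rule extensionalityI[where A = \<sigma>])
      fix B assume B: "B \<in> \<sigma>"
      then have "B \<noteq> {}" "B \<subseteq> rows q L" using p(1) by (auto simp: partition_on_def)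
      then obtain n where n: "n \<in> B" "n \<in> rows q L" by blast
      then show "k B = h B" using e[OF n(2)] block_eq[OF p(1) B n(1)] \<open>\<sigma> = \<tau>\<close> by simp
    qed (use x y \<open>\<sigma> = \<tau>\<close> in \<open>auto simp: inj_tuples_def PiE_iff\<close>)
    ultimately show "x = y" using x y by simp
  qed simp
next
  fix x assume "x \<in> (SIGMA \<sigma>:Part_on q L. inj_tuples \<sigma> I)"
  then obtain \<sigma> k where x: "x = (\<sigma>, k)" "\<sigma> \<in> Part_on q L" "k \<in> inj_tuples \<sigma> I" by auto
  have p: "partition_on (rows q L) \<sigma>" using x by (auto simp: Part_on_def)
  have "inj_on (\<lambda>n\<in>rows q L. k (block \<sigma> n)) (row q l)" if l: "l \<in> L" for l
  proof (rule inj_onI)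
    fix n n' assume n: "n \<in> row q l" "n' \<in> row q l" and e: "(\<lambda>n\<in>rows q L. k (block \<sigma> n)) n = (\<lambda>n\<in>rows q L. k (block \<sigma> n)) n'"
    have nr: "n \<in> rows q L" "n' \<in> rows q L" using n l by (auto simp: rows_def)
    then have "block \<sigma> n = block \<sigma> n'" using e x(3) block_in[OF p] by (auto simp: inj_tuples_def dest: inj_onD)
    then have "{n, n'} \<subseteq> block \<sigma> n \<inter> row q l" using block_in[OF p] nr n by auto
    then have "card {n, n'} \<le> card (block \<sigma> n \<inter> row q l)" by (rule card_mono[rotated]) simp
    also have "\<dots> \<le> 1" using x(2) block_in(1)[OF p nr(1)] l by (auto simp: Part_on_def)
    finally show "n = n'" by (cases "n = n'") auto
  qed
  moreover have "k (block \<sigma> n) \<in> I" if "n \<in> rows q L" for n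
    using x(3) block_in(1)[OF p that] by (auto simp: inj_tuples_def)
  ultimately show "(case x of (\<sigma>, k) \<Rightarrow> \<lambda>n\<in>rows q L. k (block \<sigma> n)) \<in> row_inj_maps q L I"
    using x by (auto simp: row_inj_maps_def)
next
  fix h assume h: "h \<in> row_inj_maps q L I"
  let ?R = "rows q L"
  define c where "c = (\<lambda>n. {n'\<in>?R. h n' = h n})"
  define \<sigma> where "\<sigma> = c ` ?R"
  have p: "partition_on ?R \<sigma>"
    by (rule partition_onI) (auto simp: \<sigma>_def c_def disjnt_def)
  have bl: "block \<sigma> n = c n" if "n \<in> ?R" for n
    by (rule block_eq[OF p]) (use that in \<open>auto simp: \<sigma>_def c_def\<close>)
  have "card (B \<inter> row q l) \<le> 1" if B: "B \<in> \<sigma>" and l: "l \<in> L" for B l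
  proof -
    have "x = y" if "x \<in> B \<inter> row q l" "y \<in> B \<inter> row q l" for x y
    proof -
      have "h x = h y" using that B by (auto simp: \<sigma>_def c_def)
      then show ?thesis using h l that by (auto simp: row_inj_maps_def dest: inj_onD)
    qed
    then show ?thesis by (simp add: card_le_Suc0_iff_eq)
  qed
  then have \<sigma>: "\<sigma> \<in> Part_on q L" using p by (auto simp: Part_on_def)
  define k where "k = (\<lambda>B\<in>\<sigma>. h (SOME n. n \<in> B))"
  have kc: "k (c n) = h n" if "n \<in> ?R" for n
  proof -
    have "n \<in> c n" using that by (simp add: c_def)
    then have "(SOME n'. n' \<in> c n) \<in> c n" by (rule someI)
    then have "h (SOME n'. n' \<in> c n) = h n" by (simp add: c_def)
    then show ?thesis using that by (simp add: k_def \<sigma>_def)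
  qed
  have "inj_on k \<sigma>"
    by (rule inj_onI) (auto simp: \<sigma>_def kc, auto simp: c_def)
  moreover have "k \<in> \<sigma> \<rightarrow>\<^sub>E I"
  proof
    fix B assume "B \<in> \<sigma>"
    then show "k B \<in> I" using h by (auto simp: \<sigma>_def kc row_inj_maps_def)
  qed (simp add: k_def)
  ultimately have k: "k \<in> inj_tuples \<sigma> I" by (simp add: inj_tuples_def)
  have "h = (\<lambda>n\<in>?R. k (block \<sigma> n))"
    by (rule extensionalityI[where A = ?R]) (use h in \<open>auto simp: bl kc row_inj_maps_def PiE_iff\<close>)
  then show "\<exists>x\<in>(SIGMA \<sigma>:Part_on q L. inj_tuples \<sigma> I). h = (case x of (\<sigma>, k) \<Rightarrow> \<lambda>n\<in>?R. k (block \<sigma> n))"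
    using \<sigma> k by (intro bexI[of _ "(\<sigma>, k)"]) auto
qed

text \<open>Tonelli for counting measures turns the product of sums into one sum over families of
  tuples; concatenation and the kernel bijection then sort it by partitions.\<close>

lemma prod_nn_integral_inj_tuples:
  fixes F :: "nat \<Rightarrow> (nat \<Rightarrow> 'i) \<Rightarrow> ennreal"
  assumes L: "finite L" and I: "countable I"
  shows "(\<Prod>l\<in>L. \<integral>\<^sup>+ k. F l k \<partial>count_space (inj_tuples {..<q l} I)) =
    (\<Sum>\<sigma>\<in>Part_on q L. \<integral>\<^sup>+ k. (\<Prod>l\<in>L. F l (\<lambda>i\<in>{..<q l}. k (block \<sigma> (offset q l + i)))) \<partial>count_space (inj_tuples \<sigma> I))"
proof -
  let ?c = "\<lambda>h. \<lambda>l\<in>L. \<lambda>i\<in>{..<q l}. h (offset q l + i)"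
  let ?G = "\<lambda>h. \<Prod>l\<in>L. F l (\<lambda>i\<in>{..<q l}. h (offset q l + i))"
  have ct: "countable (inj_tuples {..<q l} I)" for l using I by (simp add: countable_inj_tuples)
  interpret product_sigma_finite "\<lambda>l. count_space (inj_tuples {..<q l} I)"
    by (simp add: product_sigma_finite_def sigma_finite_measure_count_space_countable ct)
  have "(\<Prod>l\<in>L. \<integral>\<^sup>+ k. F l k \<partial>count_space (inj_tuples {..<q l} I)) =
      (\<integral>\<^sup>+ h. (\<Prod>l\<in>L. F l (h l)) \<partial>PiM L (\<lambda>l. count_space (inj_tuples {..<q l} I)))"
    using L by (intro product_nn_integral_prod[symmetric]) auto
  also have "PiM L (\<lambda>l. count_space (inj_tuples {..<q l} I)) = count_space (\<Pi>\<^sub>E l\<in>L. inj_tuples {..<q l} I)"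
    using L ct by (rule count_space_PiM_finite)
  also have "(\<integral>\<^sup>+ h. (\<Prod>l\<in>L. F l (h l)) \<partial>count_space (\<Pi>\<^sub>E l\<in>L. inj_tuples {..<q l} I)) =
      (\<integral>\<^sup>+ h. (\<Prod>l\<in>L. F l (?c h l)) \<partial>count_space (row_inj_maps q L I))"
    by (rule nn_integral_bij_count_space[OF row_inj_maps_curry, symmetric])
  also have "\<dots> = (\<integral>\<^sup>+ h. ?G h \<partial>count_space (row_inj_maps q L I))"
    by (intro nn_integral_cong prod.cong) auto
  also have "\<dots> = (\<integral>\<^sup>+ x. ?G ((\<lambda>(\<sigma>, k). \<lambda>n\<in>rows q L. k (block \<sigma> n)) x) \<partial>count_space (SIGMA \<sigma>:Part_on q L. inj_tuples \<sigma> I))"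
    by (rule nn_integral_bij_count_space[OF row_inj_maps_kernel[OF L], symmetric])
  also have "\<dots> = (\<integral>\<^sup>+ \<sigma>. (\<integral>\<^sup>+ k. ?G (\<lambda>n\<in>rows q L. k (block \<sigma> n)) \<partial>count_space (inj_tuples \<sigma> I)) \<partial>count_space (Part_on q L))"
    by (subst nn_integral_count_space_Sigma[symmetric]) simp
  also have "\<dots> = (\<Sum>\<sigma>\<in>Part_on q L. \<integral>\<^sup>+ k. ?G (\<lambda>n\<in>rows q L. k (block \<sigma> n)) \<partial>count_space (inj_tuples \<sigma> I))"
    using L by (simp add: nn_integral_count_space_finite finite_Part_on)
  also have "\<dots> = (\<Sum>\<sigma>\<in>Part_on q L. \<integral>\<^sup>+ k. (\<Prod>l\<in>L. F l (\<lambda>i\<in>{..<q l}. k (block \<sigma> (offset q l + i)))) \<partial>count_space (inj_tuples \<sigma> I))"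
  proof (intro sum.cong nn_integral_cong prod.cong refl arg_cong[where f = "F _"] restrict_ext)
    fix \<sigma> k l i assume "l \<in> L" "i \<in> {..<q l}"
    then have "offset q l + i \<in> rows q L" by (auto simp: rows_def mem_row_iff)
    then show "(\<lambda>n\<in>rows q L. k (block \<sigma> n)) (offset q l + i) = k (block \<sigma> (offset q l + i))" by simp
  qed
  finally show ?thesis .
qed

lemma measurable_tensor_on:
  assumes f: "\<And>l. l \<in> L \<Longrightarrow> f l \<in> borel_measurable (PiM {..<q l} (\<lambda>_. N))" and \<sigma>: "\<sigma> \<in> Part_on q L"
  shows "tensor_on q L f \<sigma> \<in> borel_measurable (PiM \<sigma> (\<lambda>_. N))"
  unfolding tensor_on_def
proof (rule borel_measurable_prod)
  fix l assume l: "l \<in> L"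
  have p: "partition_on (rows q L) \<sigma>" using \<sigma> by (simp add: Part_on_def)
  have "block \<sigma> (offset q l + i) \<in> \<sigma>" if "i \<in> {..<q l}" for i
    using l that by (intro block_in(1)[OF p]) (auto simp: rows_def mem_row_iff)
  from measurable_compose[OF measurable_PiM_reindex[OF this] f[OF l]]
  show "(\<lambda>y. f l (\<lambda>i\<in>{..<q l}. y (block \<sigma> (offset q l + i)))) \<in> borel_measurable (PiM \<sigma> (\<lambda>_. N))" .
qed

text \<open>An arbitrary enumeration of the blocks. The sums over tuples and the product measure are
  invariant under renaming, so the choice affects no integral.\<close>

definition block_index :: "nat set set \<Rightarrow> nat set \<Rightarrow> nat" where
  "block_index \<sigma> = (SOME e. bij_betw e \<sigma> {..<card \<sigma>})"

lemma bij_block_index: "finite \<sigma> \<Longrightarrow> bij_betw (block_index \<sigma>) \<sigma> {..<card \<sigma>}"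
  unfolding block_index_def
  using ex_bij_betw_finite_nat[of \<sigma>] by (intro someI_ex[of "\<lambda>e. bij_betw e \<sigma> {..<card \<sigma>}"]) (simp add: lessThan_atLeast0)

text \<open>A deterministic identity for one counting measure. \<open>D\<close> is chosen for all
  \<open>f l\<close> at once, so that the same points serve every row. The result is again expressed
  by factorial measures, so the points leave no trace and \<open>Campbell\<close> applies to each
  term.\<close>

theorem prod_factorial_integrals:
  fixes f :: "nat \<Rightarrow> (nat \<Rightarrow> 'a) \<Rightarrow> real"
  assumes iv: "integer_valued \<nu>" and sf: "sigma_finite_measure \<nu>" and L: "finite L"
    and f: "\<And>l. l \<in> L \<Longrightarrow> f l \<in> borel_measurable (PiM {..<q l} (\<lambda>_. \<nu>))"
    and f0: "\<And>l x. l \<in> L \<Longrightarrow> 0 \<le> f l x"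
  shows "(\<Prod>l\<in>L. \<integral>\<^sup>+ x. ennreal (f l x) \<partial>factorial_measure \<nu> (q l)) =
    (\<Sum>\<sigma>\<in>Part_on q L. \<integral>\<^sup>+ x. ennreal (tensor_on q L f \<sigma> (\<lambda>B\<in>\<sigma>. x (block_index \<sigma> B))) \<partial>factorial_measure \<nu> (card \<sigma>))"
proof -
  obtain D where D: "countable D" "D \<subseteq> sets \<nu>"
      "\<forall>l\<in>L. f l \<in> borel_measurable (PiM {..<q l} (\<lambda>_. sigma (space \<nu>) D))"
    using countable_generated_functions[of L f "\<lambda>l. {..<q l}" \<nu>] f L by (auto simp: countable_finite)
  obtain I :: "(nat \<times> nat) set" and p where rep: "point_representation \<nu> D I p"
    using point_representation_exists[OF iv sf D(1,2)] by blast
  have I: "countable I" using rep by (simp add: point_representation_def)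
  have "(\<Prod>l\<in>L. \<integral>\<^sup>+ x. ennreal (f l x) \<partial>factorial_measure \<nu> (q l)) =
      (\<Prod>l\<in>L. \<integral>\<^sup>+ k. ennreal (f l (tuple_at {..<q l} p k)) \<partial>count_space (inj_tuples {..<q l} I))"
    using D(3) by (intro prod.cong refl nn_integral_factorial_measure[OF iv sf D(2) rep]) auto
  also have "\<dots> = (\<Sum>\<sigma>\<in>Part_on q L. \<integral>\<^sup>+ k. (\<Prod>l\<in>L. ennreal (f l (tuple_at {..<q l} p (\<lambda>i\<in>{..<q l}. k (block \<sigma> (offset q l + i)))))) \<partial>count_space (inj_tuples \<sigma> I))"
    by (rule prod_nn_integral_inj_tuples[OF L I])
  also have "\<dots> = (\<Sum>\<sigma>\<in>Part_on q L. \<integral>\<^sup>+ k. ennreal (tensor_on q L f \<sigma> (tuple_at \<sigma> p k)) \<partial>count_space (inj_tuples \<sigma> I))"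
  proof (intro sum.cong nn_integral_cong refl)
    fix \<sigma> k assume \<sigma>: "\<sigma> \<in> Part_on q L"
    then have part: "partition_on (rows q L) \<sigma>" by (simp add: Part_on_def)
    have "tuple_at {..<q l} p (\<lambda>i\<in>{..<q l}. k (block \<sigma> (offset q l + i))) = (\<lambda>i\<in>{..<q l}. tuple_at \<sigma> p k (block \<sigma> (offset q l + i)))"
      if l: "l \<in> L" for l
    proof -
      have "block \<sigma> (offset q l + i) \<in> \<sigma>" if "i < q l" for i
        using l that by (intro block_in(1)[OF part]) (auto simp: rows_def mem_row_iff)
      then show ?thesis by (auto simp: tuple_at_def fun_eq_iff)
    qed
    then show "(\<Prod>l\<in>L. ennreal (f l (tuple_at {..<q l} p (\<lambda>i\<in>{..<q l}. k (block \<sigma> (offset q l + i)))))) = ennreal (tensor_on q L f \<sigma> (tuple_at \<sigma> p k))"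
      unfolding tensor_on_def using f0 by (subst prod_ennreal[symmetric]) (auto intro!: prod.cong)
  qed
  also have "\<dots> = (\<Sum>\<sigma>\<in>Part_on q L. \<integral>\<^sup>+ x. ennreal (tensor_on q L f \<sigma> (\<lambda>B\<in>\<sigma>. x (block_index \<sigma> B))) \<partial>factorial_measure \<nu> (card \<sigma>))"
  proof (intro sum.cong refl)
    fix \<sigma> assume \<sigma>: "\<sigma> \<in> Part_on q L"
    have e: "bij_betw (block_index \<sigma>) \<sigma> {..<card \<sigma>}" using bij_block_index finite_Part_on_elem[OF L \<sigma>] .
    then have eb: "block_index \<sigma> B \<in> {..<card \<sigma>}" if "B \<in> \<sigma>" for B using that by (auto simp: bij_betw_def)
    have "tensor_on q L f \<sigma> \<in> borel_measurable (PiM \<sigma> (\<lambda>_. sigma (space \<nu>) D))"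
      using D(3) \<sigma> by (intro measurable_tensor_on) auto
    from measurable_compose[OF measurable_PiM_reindex[OF eb] this]
    have m: "(\<lambda>x. ennreal (tensor_on q L f \<sigma> (\<lambda>B\<in>\<sigma>. x (block_index \<sigma> B)))) \<in> borel_measurable (PiM {..<card \<sigma>} (\<lambda>_. sigma (space \<nu>) D))"
      by simp
    show "(\<integral>\<^sup>+ k. ennreal (tensor_on q L f \<sigma> (tuple_at \<sigma> p k)) \<partial>count_space (inj_tuples \<sigma> I)) =
      (\<integral>\<^sup>+ x. ennreal (tensor_on q L f \<sigma> (\<lambda>B\<in>\<sigma>. x (block_index \<sigma> B))) \<partial>factorial_measure \<nu> (card \<sigma>))"
      unfolding nn_integral_factorial_measure[OF iv sf D(2) rep m]
      by (rule nn_integral_inj_tuples_reindex[OF e])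
  qed
  finally show ?thesis .
qed

context locally_finite_poisson
begin

text \<open>Both sides may be infinite, which is what permits the use of this formula to prove
  finiteness of moments.\<close>

theorem moment_formula_nonneg:
  assumes L: "finite L"
    and f: "\<And>l. l \<in> L \<Longrightarrow> f l \<in> borel_measurable (PiM {..<q l} (\<lambda>_. M))"
    and f0: "\<And>l x. l \<in> L \<Longrightarrow> 0 \<le> f l x"
  shows "(\<integral>\<^sup>+ \<omega>. (\<Prod>l\<in>L. \<integral>\<^sup>+ x. ennreal (f l x) \<partial>factorial_measure (\<eta> \<omega>) (q l)) \<partial>P) =
    (\<Sum>\<sigma>\<in>Part_on q L. \<integral>\<^sup>+ y. ennreal (tensor_on q L f \<sigma> y) \<partial>PiM \<sigma> (\<lambda>_. M))"
proof -
  let ?g = "\<lambda>\<sigma> x. ennreal (tensor_on q L f \<sigma> (\<lambda>B\<in>\<sigma>. x (block_index \<sigma> B)))"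
  have e: "bij_betw (block_index \<sigma>) \<sigma> {..<card \<sigma>}" if "\<sigma> \<in> Part_on q L" for \<sigma>
    using bij_block_index finite_Part_on_elem[OF L that] .
  have re: "(\<lambda>x. \<lambda>B\<in>\<sigma>. x (block_index \<sigma> B)) \<in> measurable (PiM {..<card \<sigma>} (\<lambda>_. M)) (PiM \<sigma> (\<lambda>_. M))"
    if "\<sigma> \<in> Part_on q L" for \<sigma>
    by (rule measurable_PiM_reindex) (use e[OF that] in \<open>auto simp: bij_betw_def\<close>)
  have t: "(\<lambda>y. ennreal (tensor_on q L f \<sigma> y)) \<in> borel_measurable (PiM \<sigma> (\<lambda>_. M))"
    if "\<sigma> \<in> Part_on q L" for \<sigma> using measurable_tensor_on[OF f that] by simp
  have g: "?g \<sigma> \<in> borel_measurable (PiM {..<card \<sigma>} (\<lambda>_. M))" if "\<sigma> \<in> Part_on q L" for \<sigma>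
    by (rule measurable_compose[OF re[OF that] t[OF that]])
  have "(\<integral>\<^sup>+ \<omega>. (\<Prod>l\<in>L. \<integral>\<^sup>+ x. ennreal (f l x) \<partial>factorial_measure (\<eta> \<omega>) (q l)) \<partial>P) =
    (\<integral>\<^sup>+ \<omega>. (\<Sum>\<sigma>\<in>Part_on q L. \<integral>\<^sup>+ x. ?g \<sigma> x \<partial>factorial_measure (\<eta> \<omega>) (card \<sigma>)) \<partial>P)"
  proof (rule nn_integral_cong)
    fix \<omega> assume \<omega>: "\<omega> \<in> space P"
    have "f l \<in> borel_measurable (PiM {..<q l} (\<lambda>_. \<eta> \<omega>))" if "l \<in> L" for l
    proof -
      have "sets (PiM {..<q l} (\<lambda>_. \<eta> \<omega>)) = sets (PiM {..<q l} (\<lambda>_. M))"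
        by (intro sets_PiM_cong sets_\<eta>[OF \<omega>] refl)
      then show ?thesis using f[OF that] measurable_cong_sets by blast
    qed
    then show "(\<Prod>l\<in>L. \<integral>\<^sup>+ x. ennreal (f l x) \<partial>factorial_measure (\<eta> \<omega>) (q l)) =
      (\<Sum>\<sigma>\<in>Part_on q L. \<integral>\<^sup>+ x. ?g \<sigma> x \<partial>factorial_measure (\<eta> \<omega>) (card \<sigma>))"
      by (intro prod_factorial_integrals[OF iv[OF \<omega>] sigma_finite_\<eta>[OF \<omega>] L _ f0])
  qed
  also have "\<dots> = (\<Sum>\<sigma>\<in>Part_on q L. \<integral>\<^sup>+ \<omega>. (\<integral>\<^sup>+ x. ?g \<sigma> x \<partial>factorial_measure (\<eta> \<omega>) (card \<sigma>)) \<partial>P)"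
    by (rule nn_integral_sum) (rule Campbell(1)[OF g])
  also have "\<dots> = (\<Sum>\<sigma>\<in>Part_on q L. \<integral>\<^sup>+ x. ?g \<sigma> x \<partial>PiM {..<card \<sigma>} (\<lambda>_. M))"
    by (intro sum.cong refl Campbell(2)[OF g])
  also have "\<dots> = (\<Sum>\<sigma>\<in>Part_on q L. \<integral>\<^sup>+ y. ennreal (tensor_on q L f \<sigma> y) \<partial>PiM \<sigma> (\<lambda>_. M))"
  proof (intro sum.cong refl)
    fix \<sigma> assume \<sigma>: "\<sigma> \<in> Part_on q L"
    have "(\<integral>\<^sup>+ y. ennreal (tensor_on q L f \<sigma> y) \<partial>PiM \<sigma> (\<lambda>_. M)) =
      (\<integral>\<^sup>+ y. ennreal (tensor_on q L f \<sigma> y) \<partial>distr (PiM {..<card \<sigma>} (\<lambda>_. M)) (PiM \<sigma> (\<lambda>_. M)) (\<lambda>x. \<lambda>B\<in>\<sigma>. x (block_index \<sigma> B)))"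
      unfolding distr_PiM_reindex_sigma_finite[OF sigma_finite_M finite_Part_on_elem[OF L \<sigma>] e[OF \<sigma>]] ..
    also have "\<dots> = (\<integral>\<^sup>+ x. ?g \<sigma> x \<partial>PiM {..<card \<sigma>} (\<lambda>_. M))"
      using t[OF \<sigma>] by (intro nn_integral_distr[OF re[OF \<sigma>]]) simp
    finally show "(\<integral>\<^sup>+ x. ?g \<sigma> x \<partial>PiM {..<card \<sigma>} (\<lambda>_. M)) = (\<integral>\<^sup>+ y. ennreal (tensor_on q L f \<sigma> y) \<partial>PiM \<sigma> (\<lambda>_. M))" ..
  qed
  finally show ?thesis .
qed

end

section \<open>Decomposition of partitions\<close>

text \<open>No block links a row of \<open>D\<close> to a row outside \<open>D\<close>. Such sets
  replace the unions of classes of \<open>star_partition\<close>.\<close>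

definition row_closed :: "(nat \<Rightarrow> nat) \<Rightarrow> nat set set \<Rightarrow> nat set \<Rightarrow> bool" where
  "row_closed q \<sigma> D \<longleftrightarrow> (\<forall>B\<in>\<sigma>. B \<subseteq> rows q D \<or> B \<inter> rows q D = {})"

text \<open>Connectedness expressed through closed row sets, which makes sense for every
  \<open>L\<close> and avoids transitive closures; \<open>Part_tilde_eq\<close> gives the agreement
  with \<open>Part_tilde\<close>.\<close>

definition Part_tilde_on :: "(nat \<Rightarrow> nat) \<Rightarrow> nat set \<Rightarrow> nat set set set" where
  "Part_tilde_on q L = {\<sigma> \<in> Part_on q L. \<forall>D\<subseteq>L. D \<noteq> {} \<longrightarrow> row_closed q \<sigma> D \<longrightarrow> D = L}"

definition Part_bar_on :: "(nat \<Rightarrow> nat) \<Rightarrow> nat set \<Rightarrow> nat set set set" where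
  "Part_bar_on q L = {\<sigma> \<in> Part_on q L. \<forall>l\<in>L. \<exists>B\<in>\<sigma>. 2 \<le> card B \<and> B \<inter> row q l \<noteq> {}}"

lemma Part_bar_eq: "Part_bar m q = Part_bar_on q {..<m}"
  by (auto simp: Part_bar_def Part_bar_on_def Part_eq)

lemma row_mem_rowsD:
  assumes "n \<in> row q l" "n \<in> rows q D"
  shows "l \<in> D"
proof -
  obtain l' where "l' \<in> D" "n \<in> row q l'" using assms(2) by (auto simp: rows_def)
  then show ?thesis using row_disjoint[of l l' q] assms(1) by (cases "l = l'") auto
qed

lemma rows_Diff: "rows q (L - D) = rows q L - rows q D"
proof (intro set_eqI iffI)
  fix n assume "n \<in> rows q (L - D)"
  then obtain l where "l \<in> L" "l \<notin> D" "n \<in> row q l" by (auto simp: rows_def)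
  then show "n \<in> rows q L - rows q D" using row_mem_rowsD[of n q l D] by (auto simp: rows_def)
qed (auto simp: rows_def)

lemma Part_on_block_subset: "\<sigma> \<in> Part_on q L \<Longrightarrow> B \<in> \<sigma> \<Longrightarrow> B \<subseteq> rows q L"
  by (auto simp: Part_on_def partition_on_def)

lemma Part_on_block_nonempty: "\<sigma> \<in> Part_on q L \<Longrightarrow> B \<in> \<sigma> \<Longrightarrow> B \<noteq> {}"
  by (auto simp: Part_on_def partition_on_def)

text \<open>The last two claims recover both partitions from their union, because blocks are
  nonempty and lie either inside or outside the rows of \<open>D\<close>. Together with
  \<open>Part_on_split\<close> this is a bijection onto the partitions for which \<open>D\<close> is
  closed.\<close>

lemma Part_on_Un:
  assumes D: "D \<subseteq> L" and \<sigma>: "\<sigma> \<in> Part_on q D" and \<tau>: "\<tau> \<in> Part_on q (L - D)"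
  shows "\<sigma> \<union> \<tau> \<in> Part_on q L" and "row_closed q (\<sigma> \<union> \<tau>) D"
    and "{B \<in> \<sigma> \<union> \<tau>. B \<subseteq> rows q D} = \<sigma>" and "{B \<in> \<sigma> \<union> \<tau>. B \<inter> rows q D = {}} = \<tau>"
proof -
  have R: "rows q L = rows q D \<union> rows q (L - D)" using D rows_Un[of q D "L - D"] by (simp add: Un_absorb1)
  have dis: "rows q D \<inter> rows q (L - D) = {}" by (rule rows_disjoint) auto
  have s: "B \<subseteq> rows q D" "B \<noteq> {}" if "B \<in> \<sigma>" for B
    using that Part_on_block_subset[OF \<sigma>] Part_on_block_nonempty[OF \<sigma>] by auto
  have t: "B \<subseteq> rows q (L - D)" "B \<noteq> {}" if "B \<in> \<tau>" for B
    using that Part_on_block_subset[OF \<tau>] Part_on_block_nonempty[OF \<tau>] by auto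
  have t': "B \<inter> rows q D = {}" if "B \<in> \<tau>" for B using t(1)[OF that] dis by blast
  have p: "partition_on (rows q L) (\<sigma> \<union> \<tau>)"
    unfolding R
    using disjoint_union[of \<sigma> \<tau>] \<sigma> \<tau> dis by (simp add: Part_on_def partition_on_def)
  have "card (B \<inter> row q l) \<le> 1" if B: "B \<in> \<sigma> \<union> \<tau>" and l: "l \<in> L" for B l
  proof (cases "B \<inter> row q l = {}")
    case False
    then obtain n where n: "n \<in> B" "n \<in> row q l" by auto
    show ?thesis
    proof (cases "B \<in> \<sigma>")
      case True
      then have "l \<in> D" using s n row_mem_rowsD by blast
      then show ?thesis using True \<sigma> by (auto simp: Part_on_def)
    next
      case False
      then have "B \<in> \<tau>" using B by simp
      then have "l \<in> L - D" using t n row_mem_rowsD by blast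
      then show ?thesis using \<open>B \<in> \<tau>\<close> \<tau> by (auto simp: Part_on_def)
    qed
  qed simp
  then show "\<sigma> \<union> \<tau> \<in> Part_on q L" using p by (simp add: Part_on_def)
  show "row_closed q (\<sigma> \<union> \<tau>) D" using s t' by (auto simp: row_closed_def)
  show "{B \<in> \<sigma> \<union> \<tau>. B \<subseteq> rows q D} = \<sigma>"
  proof (intro set_eqI iffI)
    fix B assume "B \<in> {B \<in> \<sigma> \<union> \<tau>. B \<subseteq> rows q D}"
    then have "B \<in> \<sigma> \<union> \<tau>" "B \<subseteq> rows q D" by auto
    then show "B \<in> \<sigma>" using t(2)[of B] t'[of B] by blast
  qed (use s in auto)
  show "{B \<in> \<sigma> \<union> \<tau>. B \<inter> rows q D = {}} = \<tau>"
  proof (intro set_eqI iffI)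
    fix B assume "B \<in> {B \<in> \<sigma> \<union> \<tau>. B \<inter> rows q D = {}}"
    then have "B \<in> \<sigma> \<union> \<tau>" "B \<inter> rows q D = {}" by auto
    then show "B \<in> \<tau>" using s[of B] by blast
  qed (use t' in auto)
qed

lemma Part_on_split:
  assumes D: "D \<subseteq> L" and \<sigma>: "\<sigma> \<in> Part_on q L" and c: "row_closed q \<sigma> D"
  shows "{B \<in> \<sigma>. B \<subseteq> rows q D} \<in> Part_on q D" (is "?S \<in> _")
    and "{B \<in> \<sigma>. B \<inter> rows q D = {}} \<in> Part_on q (L - D)" (is "?T \<in> _")
    and "\<sigma> = {B \<in> \<sigma>. B \<subseteq> rows q D} \<union> {B \<in> \<sigma>. B \<inter> rows q D = {}}"
proof -
  have p: "partition_on (rows q L) \<sigma>" using \<sigma> by (simp add: Part_on_def)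
  have DL: "rows q D \<subseteq> rows q L" using D by (rule rows_mono)
  have U: "\<Union>\<sigma> = rows q L" using p by (simp add: partition_on_def)
  have ne: "{} \<notin> \<sigma>" and dj: "disjoint \<sigma>" using p by (auto simp: partition_on_def)
  have "\<Union>?S = rows q D"
  proof (intro set_eqI iffI)
    fix n assume n: "n \<in> rows q D"
    then obtain B where "B \<in> \<sigma>" "n \<in> B" using U DL by blast
    then show "n \<in> \<Union>?S" using c n unfolding row_closed_def by blast
  qed auto
  then have "partition_on (rows q D) ?S"
    using ne dj by (auto simp: partition_on_def disjoint_def)
  then show "?S \<in> Part_on q D" using \<sigma> D by (auto simp: Part_on_def)
  have "\<Union>?T = rows q (L - D)"
  proof (intro set_eqI iffI)
    fix n assume n: "n \<in> rows q (L - D)"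
    then have n': "n \<in> rows q L" "n \<notin> rows q D" by (auto simp: rows_Diff)
    then obtain B where "B \<in> \<sigma>" "n \<in> B" using U by blast
    then show "n \<in> \<Union>?T" using c n' unfolding row_closed_def by blast
  next
    fix n assume "n \<in> \<Union>?T"
    then show "n \<in> rows q (L - D)" using U by (auto simp: rows_Diff)
  qed
  then have "partition_on (rows q (L - D)) ?T"
    using ne dj by (auto simp: partition_on_def disjoint_def)
  then show "?T \<in> Part_on q (L - D)" using \<sigma> by (auto simp: Part_on_def)
  show "\<sigma> = ?S \<union> ?T" using c by (auto simp: row_closed_def)
qed

lemma inj_on_Un_Part_on:
  assumes "D \<subseteq> L" "S \<subseteq> Part_on q D" "T \<subseteq> Part_on q (L - D)"
  shows "inj_on (\<lambda>(\<sigma>, \<tau>). \<sigma> \<union> \<tau>) (S \<times> T)"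
proof (rule inj_onI)
  fix x y assume "x \<in> S \<times> T" "y \<in> S \<times> T" and e: "(\<lambda>(\<sigma>, \<tau>). \<sigma> \<union> \<tau>) x = (\<lambda>(\<sigma>, \<tau>). \<sigma> \<union> \<tau>) y"
  obtain \<sigma> \<tau> where x0: "x = (\<sigma>, \<tau>)" "\<sigma> \<in> S" "\<tau> \<in> T" using \<open>x \<in> S \<times> T\<close> by (rule SigmaE)
  obtain \<sigma>' \<tau>' where y0: "y = (\<sigma>', \<tau>')" "\<sigma>' \<in> S" "\<tau>' \<in> T" using \<open>y \<in> S \<times> T\<close> by (rule SigmaE)
  note x = x0(1) subsetD[OF assms(2) x0(2)] subsetD[OF assms(3) x0(3)]
  note y = y0(1) subsetD[OF assms(2) y0(2)] subsetD[OF assms(3) y0(3)]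
  have "\<sigma> \<union> \<tau> = \<sigma>' \<union> \<tau>'" using e x y by simp
  then show "x = y"
    using Part_on_Un(3,4)[OF assms(1) x(2,3)] Part_on_Un(3,4)[OF assms(1) y(2,3)] x(1) y(1) by simp
qed

section \<open>The connected component of a row\<close>

definition row_component :: "(nat \<Rightarrow> nat) \<Rightarrow> nat set \<Rightarrow> nat \<Rightarrow> nat set set \<Rightarrow> nat set" where
  "row_component q L l \<sigma> = \<Inter>{D. D \<subseteq> L \<and> l \<in> D \<and> row_closed q \<sigma> D}"

text \<open>Closed row sets are stable under intersection: a block inside the rows of all of them
  stays inside, because every variable belongs to a single row, and a block not inside one of them
  misses that one entirely.\<close>

lemma row_component:
  assumes l: "l \<in> L" and \<sigma>: "\<sigma> \<in> Part_on q L"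
  shows "row_component q L l \<sigma> \<subseteq> L" "l \<in> row_component q L l \<sigma>"
    "row_closed q \<sigma> (row_component q L l \<sigma>)"
proof -
  let ?F = "{D. D \<subseteq> L \<and> l \<in> D \<and> row_closed q \<sigma> D}"
  have "L \<in> ?F" using l Part_on_block_subset[OF \<sigma>] by (auto simp: row_closed_def)
  then show C: "row_component q L l \<sigma> \<subseteq> L" unfolding row_component_def by blast
  show "l \<in> row_component q L l \<sigma>" by (auto simp: row_component_def)
  show "row_closed q \<sigma> (row_component q L l \<sigma>)" unfolding row_closed_def
  proof
    fix B assume B: "B \<in> \<sigma>"
    show "B \<subseteq> rows q (row_component q L l \<sigma>) \<or> B \<inter> rows q (row_component q L l \<sigma>) = {}"
    proof (cases "\<forall>D\<in>?F. B \<subseteq> rows q D")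
      case True
      have "n \<in> rows q (row_component q L l \<sigma>)" if n: "n \<in> B" for n
      proof -
        obtain w where w: "n \<in> row q w" using n Part_on_block_subset[OF \<sigma> B] by (auto simp: rows_def)
        have "w \<in> D" if "D \<in> ?F" for D using True that n w row_mem_rowsD by blast
        then have "w \<in> row_component q L l \<sigma>" by (auto simp: row_component_def)
        then show ?thesis using w by (auto simp: rows_def)
      qed
      then show ?thesis by blast
    next
      case False
      then obtain D where D: "D \<in> ?F" "\<not> B \<subseteq> rows q D" by blast
      then have "B \<inter> rows q D = {}" using B by (auto simp: row_closed_def)
      moreover have "row_component q L l \<sigma> \<subseteq> D" using D(1) unfolding row_component_def by blast
      then have "rows q (row_component q L l \<sigma>) \<subseteq> rows q D" by (rule rows_mono)
      ultimately show ?thesis by blast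
    qed
  qed
qed

lemma row_component_least:
  "D \<subseteq> L \<Longrightarrow> l \<in> D \<Longrightarrow> row_closed q \<sigma> D \<Longrightarrow> row_component q L l \<sigma> \<subseteq> D"
  unfolding row_component_def by blast

text \<open>Minimality of the component yields connectedness. If \<open>D\<close> is a nonempty
  closed part of \<open>C\<close>, then \<open>D\<close> and \<open>C - D\<close> are both closed;
  the one that contains \<open>l\<close> is all of \<open>C\<close>, and as \<open>D\<close> is
  nonempty this must be \<open>D\<close>.\<close>

lemma Part_on_component_eq:
  assumes l: "l \<in> C" and C: "C \<subseteq> L"
  shows "{\<sigma> \<in> Part_on q L. row_component q L l \<sigma> = C} =
    (\<lambda>(\<sigma>, \<tau>). \<sigma> \<union> \<tau>) ` (Part_tilde_on q C \<times> Part_on q (L - C))"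
proof (intro set_eqI iffI)
  fix \<sigma> assume "\<sigma> \<in> {\<sigma> \<in> Part_on q L. row_component q L l \<sigma> = C}"
  then have \<sigma>: "\<sigma> \<in> Part_on q L" and comp: "row_component q L l \<sigma> = C" by auto
  have lL: "l \<in> L" using l C by auto
  have cl: "row_closed q \<sigma> C" using row_component(3)[OF lL \<sigma>] comp by simp
  let ?S = "{B \<in> \<sigma>. B \<subseteq> rows q C}" and ?T = "{B \<in> \<sigma>. B \<inter> rows q C = {}}"
  note sp = Part_on_split[OF C \<sigma> cl]
  have "D = C" if D: "D \<subseteq> C" "D \<noteq> {}" "row_closed q ?S D" for D
  proof -
    have sub: "rows q D \<subseteq> rows q C" by (rule rows_mono[OF D(1)])
    have cD: "row_closed q \<sigma> D" unfolding row_closed_def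
    proof
      fix B assume "B \<in> \<sigma>"
      then show "B \<subseteq> rows q D \<or> B \<inter> rows q D = {}"
        using D(3) cl sub unfolding row_closed_def by blast
    qed
    show ?thesis
    proof (cases "l \<in> D")
      case True
      then have "C \<subseteq> D" using row_component_least[OF _ True cD, of L] D C comp by auto
      then show ?thesis using D by auto
    next
      case False
      have "row_closed q \<sigma> (C - D)" unfolding row_closed_def rows_Diff
      proof
        fix B assume "B \<in> \<sigma>"
        then show "B \<subseteq> rows q C - rows q D \<or> B \<inter> (rows q C - rows q D) = {}"
          using cD cl unfolding row_closed_def by blast
      qed
      then have "C \<subseteq> C - D" using row_component_least[of "C - D" L l q \<sigma>] False l C comp by auto
      then show ?thesis using D by auto
    qed
  qed
  then have "?S \<in> Part_tilde_on q C" using sp(1) by (auto simp: Part_tilde_on_def)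
  then show "\<sigma> \<in> (\<lambda>(\<sigma>, \<tau>). \<sigma> \<union> \<tau>) ` (Part_tilde_on q C \<times> Part_on q (L - C))"
    using sp(2,3) by (intro image_eqI[of _ _ "(?S, ?T)"]) auto
next
  fix \<rho> assume "\<rho> \<in> (\<lambda>(\<sigma>, \<tau>). \<sigma> \<union> \<tau>) ` (Part_tilde_on q C \<times> Part_on q (L - C))"
  then obtain \<sigma> \<tau> where r: "\<rho> = \<sigma> \<union> \<tau>" "\<sigma> \<in> Part_tilde_on q C" "\<tau> \<in> Part_on q (L - C)" by auto
  have \<sigma>: "\<sigma> \<in> Part_on q C" using r by (simp add: Part_tilde_on_def)
  note un = Part_on_Un[OF C \<sigma> r(3)]
  have lL: "l \<in> L" using l C by auto
  have R: "\<rho> \<in> Part_on q L" using un(1) r by simp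
  note rc = row_component[OF lL R]
  have sub: "row_component q L l \<rho> \<subseteq> C" using row_component_least[OF C l] un(2) r by simp
  moreover have "row_closed q \<sigma> (row_component q L l \<rho>)" using rc(3) r by (auto simp: row_closed_def)
  ultimately have "row_component q L l \<rho> = C" using r(2) rc(2) by (auto simp: Part_tilde_on_def)
  then show "\<rho> \<in> {\<sigma> \<in> Part_on q L. row_component q L l \<sigma> = C}" using R by simp
qed

section \<open>Active rows and singleton blocks\<close>

definition singletons :: "'b set \<Rightarrow> 'b set set" where
  "singletons A = (\<lambda>n. {n}) ` A"

lemma singletons_Part_on: "singletons (rows q E) \<in> Part_on q E"
proof -
  have "partition_on (rows q E) (singletons (rows q E))"
    by (rule partition_onI) (auto simp: singletons_def disjnt_def)
  moreover have "card ({n} \<inter> X) \<le> 1" for n :: nat and X by (rule order.trans[OF card_mono[of "{n}"]]) auto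
  ultimately show ?thesis by (auto simp: Part_on_def singletons_def)
qed

lemma partition_on_eq_singletons:
  assumes p: "partition_on A \<sigma>" and c: "\<And>B. B \<in> \<sigma> \<Longrightarrow> \<exists>n. B = {n}"
  shows "\<sigma> = singletons A"
proof (intro set_eqI iffI)
  fix B assume B: "B \<in> \<sigma>"
  then obtain n where "B = {n}" using c by blast
  then show "B \<in> singletons A" using B p by (auto simp: singletons_def partition_on_def)
next
  fix B assume "B \<in> singletons A"
  then obtain n where n: "B = {n}" "n \<in> A" by (auto simp: singletons_def)
  then obtain B' where "B' \<in> \<sigma>" "n \<in> B'" using p by (auto simp: partition_on_def)
  then show "B \<in> \<sigma>" using c[of B'] n by auto
qed

definition active_rows :: "(nat \<Rightarrow> nat) \<Rightarrow> nat set \<Rightarrow> nat set set \<Rightarrow> nat set" where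
  "active_rows q L \<sigma> = {l \<in> L. \<exists>B\<in>\<sigma>. 2 \<le> card B \<and> B \<inter> row q l \<noteq> {}}"

text \<open>Every row met by a block of at least two elements is active, so such blocks stay inside
  the active rows and all variables of the other rows are singletons. Hence the set of active rows
  is closed, and the part on it determines the partition.\<close>

lemma Part_on_active_eq:
  assumes L: "finite L" and A: "A \<subseteq> L"
  shows "{\<sigma> \<in> Part_on q L. active_rows q L \<sigma> = A} =
    (\<lambda>(\<sigma>, \<tau>). \<sigma> \<union> \<tau>) ` (Part_bar_on q A \<times> {singletons (rows q (L - A))})"
proof (intro set_eqI iffI)
  fix \<sigma> assume "\<sigma> \<in> {\<sigma> \<in> Part_on q L. active_rows q L \<sigma> = A}"
  then have \<sigma>: "\<sigma> \<in> Part_on q L" and act: "active_rows q L \<sigma> = A" by auto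
  have single: "\<exists>n. B = {n}" if "B \<in> \<sigma>" "\<not> 2 \<le> card B" for B
  proof -
    have "finite B" using Part_on_block_subset[OF \<sigma> that(1)] L finite_rows finite_subset by blast
    then have "card B = 1" using Part_on_block_nonempty[OF \<sigma> that(1)] that(2) by (simp add: Suc_leI card_gt_0_iff le_antisym not_less_eq_eq numeral_2_eq_2)
    then show ?thesis by (rule card_1_singletonE) blast
  qed
  have big: "B \<subseteq> rows q A" if B: "B \<in> \<sigma>" "2 \<le> card B" for B
  proof
    fix n assume n: "n \<in> B"
    then obtain l where l: "l \<in> L" "n \<in> row q l" using Part_on_block_subset[OF \<sigma> B(1)] by (auto simp: rows_def)
    then have "l \<in> A" using act[symmetric] B n by (auto simp: active_rows_def)
    then show "n \<in> rows q A" using l by (auto simp: rows_def)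
  qed
  have cl: "row_closed q \<sigma> A" unfolding row_closed_def
  proof
    fix B assume B: "B \<in> \<sigma>"
    show "B \<subseteq> rows q A \<or> B \<inter> rows q A = {}"
      using big[OF B] single[OF B] by (cases "2 \<le> card B") auto
  qed
  let ?S = "{B \<in> \<sigma>. B \<subseteq> rows q A}" and ?T = "{B \<in> \<sigma>. B \<inter> rows q A = {}}"
  note sp = Part_on_split[OF A \<sigma> cl]
  have "\<exists>B\<in>?S. 2 \<le> card B \<and> B \<inter> row q l \<noteq> {}" if "l \<in> A" for l
  proof -
    have "l \<in> active_rows q L \<sigma>" using that act by simp
    then obtain B where "B \<in> \<sigma>" "2 \<le> card B" "B \<inter> row q l \<noteq> {}" by (auto simp: active_rows_def)
    then show ?thesis using big by blast
  qed
  then have S: "?S \<in> Part_bar_on q A" using sp(1) by (auto simp: Part_bar_on_def)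
  have "?T = singletons (rows q (L - A))"
  proof (rule partition_on_eq_singletons)
    show "partition_on (rows q (L - A)) ?T" using sp(2) by (simp add: Part_on_def)
    fix B assume B: "B \<in> ?T"
    then have "\<not> 2 \<le> card B" using big[of B] Part_on_block_nonempty[OF \<sigma>, of B] by auto
    then show "\<exists>n. B = {n}" using single B by blast
  qed
  then show "\<sigma> \<in> (\<lambda>(\<sigma>, \<tau>). \<sigma> \<union> \<tau>) ` (Part_bar_on q A \<times> {singletons (rows q (L - A))})"
    using sp(3) S by (intro image_eqI[of _ _ "(?S, ?T)"]) auto
next
  fix \<rho> assume "\<rho> \<in> (\<lambda>(\<sigma>, \<tau>). \<sigma> \<union> \<tau>) ` (Part_bar_on q A \<times> {singletons (rows q (L - A))})"
  then obtain \<sigma> where r: "\<rho> = \<sigma> \<union> singletons (rows q (L - A))" "\<sigma> \<in> Part_bar_on q A" by auto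
  have \<sigma>: "\<sigma> \<in> Part_on q A" using r by (simp add: Part_bar_on_def)
  note un = Part_on_Un[OF A \<sigma> singletons_Part_on]
  have "active_rows q L \<rho> = A"
  proof (intro set_eqI iffI)
    fix l assume "l \<in> active_rows q L \<rho>"
    then obtain B where B: "B \<in> \<rho>" "2 \<le> card B" "B \<inter> row q l \<noteq> {}" by (auto simp: active_rows_def)
    have "B \<in> \<sigma>" using B r(1) by (auto simp: singletons_def)
    then show "l \<in> A" using B(3) Part_on_block_subset[OF \<sigma>] row_mem_rowsD by blast
  next
    fix l assume l: "l \<in> A"
    then obtain B where "B \<in> \<sigma>" "2 \<le> card B" "B \<inter> row q l \<noteq> {}"
      using r(2) l unfolding Part_bar_on_def by blast
    then show "l \<in> active_rows q L \<rho>" using l A r(1) unfolding active_rows_def by blast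
  qed
  then show "\<rho> \<in> {\<sigma> \<in> Part_on q L. active_rows q L \<sigma> = A}" using un(1) r by simp
qed

lemma Part_on_single_row: "Part_on q {l} = {singletons (rows q {l})}"
proof -
  have "\<sigma> = singletons (rows q {l})" if \<sigma>: "\<sigma> \<in> Part_on q {l}" for \<sigma>
  proof (rule partition_on_eq_singletons)
    show "partition_on (rows q {l}) \<sigma>" using \<sigma> by (simp add: Part_on_def)
    fix B assume B: "B \<in> \<sigma>"
    have "B \<subseteq> row q l" using Part_on_block_subset[OF \<sigma> B] by (simp add: rows_def)
    then have c: "card B \<le> 1" "finite B"
      using \<sigma> B finite_subset[OF _ finite_row] by (auto simp: Part_on_def Int_absorb2)
    have "card B \<noteq> 0" using Part_on_block_nonempty[OF \<sigma> B] c(2) by simp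
    then have "card B = 1" using c(1) by simp
    then show "\<exists>n. B = {n}" by (rule card_1_singletonE) blast
  qed
  then have "Part_on q {l} \<subseteq> {singletons (rows q {l})}" by (intro subsetI) (simp only: singleton_iff)
  moreover have "{singletons (rows q {l})} \<subseteq> Part_on q {l}" using singletons_Part_on by (simp only: insert_subset empty_subsetI)
  ultimately show ?thesis by (rule equalityI)
qed

text \<open>A row set is closed iff it is stable under \<open>row_relation\<close>, so the absence
  of proper nonempty closed sets means that every row reaches every other one.
  \<open>1 \<le> m\<close> guarantees that there is a class at all.\<close>

lemma Part_tilde_eq:
  assumes m: "1 \<le> m"
  shows "Part_tilde m q = Part_tilde_on q {..<m}"
proof -
  have "card (star_partition m q \<sigma>) = 1 \<longleftrightarrow> (\<forall>D\<subseteq>{..<m}. D \<noteq> {} \<longrightarrow> row_closed q \<sigma> D \<longrightarrow> D = {..<m})"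
    if \<sigma>: "\<sigma> \<in> Part_on q {..<m}" for \<sigma>
  proof -
    let ?r = "row_relation m q \<sigma>"
    have sym: "sym ?r" by (auto simp: sym_def row_relation_def)
    have r_sub: "j < m" if "(i, j) \<in> ?r\<^sup>*" "i < m" for i j
      using that by (induction rule: rtrancl_induct) (auto simp: row_relation_def)
    have cls: "row_closed q \<sigma> D \<longleftrightarrow> (\<forall>(i, j)\<in>?r. i \<in> D \<longrightarrow> j \<in> D)" if D: "D \<subseteq> {..<m}" for D
    proof
      assume c: "row_closed q \<sigma> D"
      show "\<forall>(i, j)\<in>?r. i \<in> D \<longrightarrow> j \<in> D"
      proof clarify
        fix i j assume "(i, j) \<in> ?r" "i \<in> D"
        then obtain B a b where B: "B \<in> \<sigma>" "a \<in> B" "a \<in> row q i" "b \<in> B" "b \<in> row q j"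
          by (auto simp: row_relation_def)
        then have "a \<in> rows q D" using \<open>i \<in> D\<close> by (auto simp: rows_def)
        then have "b \<in> rows q D" using c B unfolding row_closed_def by blast
        then show "j \<in> D" using B row_mem_rowsD by blast
      qed
    next
      assume c: "\<forall>(i, j)\<in>?r. i \<in> D \<longrightarrow> j \<in> D"
      show "row_closed q \<sigma> D" unfolding row_closed_def
      proof
        fix B assume B: "B \<in> \<sigma>"
        have "B \<subseteq> rows q D" if "B \<inter> rows q D \<noteq> {}"
        proof
          fix b assume b: "b \<in> B"
          obtain a i where a: "a \<in> B" "i \<in> D" "a \<in> row q i" using \<open>B \<inter> rows q D \<noteq> {}\<close> by (auto simp: rows_def)
          obtain j where j: "j < m" "b \<in> row q j" using b Part_on_block_subset[OF \<sigma> B] by (auto simp: rows_def)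
          have "(i, j) \<in> ?r" using a b j B D by (auto simp: row_relation_def)
          then have "j \<in> D" using c a by auto
          then show "b \<in> rows q D" using j by (auto simp: rows_def)
        qed
        then show "B \<subseteq> rows q D \<or> B \<inter> rows q D = {}" by blast
      qed
    qed
    have "card (star_partition m q \<sigma>) = 1 \<longleftrightarrow> (\<forall>i<m. \<forall>j<m. (i, j) \<in> ?r\<^sup>*)"
    proof
      assume "card (star_partition m q \<sigma>) = 1"
      then obtain X where X: "star_partition m q \<sigma> = {X}" by (auto simp: card_1_singleton_iff)
      have "?r\<^sup>* `` {i} = X" if "i < m" for i
      proof -
        have "?r\<^sup>* `` {i} \<in> star_partition m q \<sigma>"
          unfolding star_partition_def by (rule quotientI) (use that in simp)
        then show ?thesis using X by simp
      qed
      then show "\<forall>i<m. \<forall>j<m. (i, j) \<in> ?r\<^sup>*" by blast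
    next
      assume c: "\<forall>i<m. \<forall>j<m. (i, j) \<in> ?r\<^sup>*"
      have "?r\<^sup>* `` {i} = {..<m}" if "i < m" for i using c that r_sub by auto
      then have "star_partition m q \<sigma> = {{..<m}}"
        using m unfolding star_partition_def quotient_def by (auto intro!: bexI[of _ 0])
      then show "card (star_partition m q \<sigma>) = 1" by simp
    qed
    also have "\<dots> \<longleftrightarrow> (\<forall>D\<subseteq>{..<m}. D \<noteq> {} \<longrightarrow> row_closed q \<sigma> D \<longrightarrow> D = {..<m})"
    proof
      assume c: "\<forall>i<m. \<forall>j<m. (i, j) \<in> ?r\<^sup>*"
      show "\<forall>D\<subseteq>{..<m}. D \<noteq> {} \<longrightarrow> row_closed q \<sigma> D \<longrightarrow> D = {..<m}"
      proof (intro allI impI)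
        fix D assume D: "D \<subseteq> {..<m}" "D \<noteq> {}" "row_closed q \<sigma> D"
        have st: "j \<in> D" if "(i, j) \<in> ?r\<^sup>*" "i \<in> D" for i j
          using that by (induction rule: rtrancl_induct) (use D(3) cls[OF D(1)] in auto)
        obtain i where "i \<in> D" using D by auto
        then show "D = {..<m}" using st c D(1) by blast
      qed
    next
      assume c: "\<forall>D\<subseteq>{..<m}. D \<noteq> {} \<longrightarrow> row_closed q \<sigma> D \<longrightarrow> D = {..<m}"
      show "\<forall>i<m. \<forall>j<m. (i, j) \<in> ?r\<^sup>*"
      proof (intro allI impI)
        fix i j assume ij: "i < m" "j < m"
        \<comment> \<open>The rows reachable from \<open>i\<close> form a closed set, nonempty since
          it contains \<open>i\<close>.\<close>
        let ?D = "?r\<^sup>* `` {i}"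
        have sub: "?D \<subseteq> {..<m}" using r_sub ij by auto
        have "row_closed q \<sigma> ?D" unfolding cls[OF sub] by (auto intro: rtrancl_into_rtrancl)
        then have "?D = {..<m}" using c sub by blast
        then show "(i, j) \<in> ?r\<^sup>*" using ij by auto
      qed
    qed
    finally show ?thesis .
  qed
  then show ?thesis by (auto simp: Part_tilde_def Part_tilde_on_def Part_eq)
qed

section \<open>Moments of U-statistics\<close>

text \<open>Fubini, with integrability required of the product only. If a factor fails to be
  integrable, its integral is 0 by default and the identity persists.\<close>

lemma (in product_sigma_finite) product_integral_Un_mult:
  fixes g h :: "_ \<Rightarrow> real"
  assumes IJ: "I \<inter> J = {}" "finite I" "finite J"
    and int: "integrable (PiM (I \<union> J) M) (\<lambda>x. g (restrict x I) * h (restrict x J))"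
  shows "(\<integral>x. g (restrict x I) * h (restrict x J) \<partial>PiM (I \<union> J) M) = (\<integral>x. g x \<partial>PiM I M) * (\<integral>x. h x \<partial>PiM J M)"
proof -
  have "(\<integral>x. g (restrict x I) * h (restrict x J) \<partial>PiM (I \<union> J) M) =
    (\<integral>x. (\<integral>y. g (restrict (merge I J (x, y)) I) * h (restrict (merge I J (x, y)) J) \<partial>PiM J M) \<partial>PiM I M)"
    by (rule product_integral_fold[OF IJ int])
  also have "\<dots> = (\<integral>x. (\<integral>y. g x * h y \<partial>PiM J M) \<partial>PiM I M)"
  proof (intro Bochner_Integration.integral_cong refl)
    fix x y assume "x \<in> space (PiM I M)" "y \<in> space (PiM J M)"
    then have "restrict x I = x" "restrict y J = y" by (auto simp: space_PiM PiE_iff extensional_restrict)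
    then show "g (restrict (merge I J (x, y)) I) * h (restrict (merge I J (x, y)) J) = g x * h y"
      using IJ(1) by simp
  qed
  also have "\<dots> = (\<integral>x. g x \<partial>PiM I M) * (\<integral>x. h x \<partial>PiM J M)" by simp
  finally show ?thesis .
qed

lemma block_Un:
  assumes D: "D \<subseteq> L" and \<sigma>: "\<sigma> \<in> Part_on q D" and \<tau>: "\<tau> \<in> Part_on q (L - D)"
  shows "n \<in> rows q D \<Longrightarrow> block (\<sigma> \<union> \<tau>) n = block \<sigma> n"
    and "n \<in> rows q (L - D) \<Longrightarrow> block (\<sigma> \<union> \<tau>) n = block \<tau> n"
proof -
  have p: "partition_on (rows q L) (\<sigma> \<union> \<tau>)" "partition_on (rows q D) \<sigma>" "partition_on (rows q (L - D)) \<tau>"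
    using Part_on_Un(1)[OF assms] \<sigma> \<tau> by (auto simp: Part_on_def)
  show "block (\<sigma> \<union> \<tau>) n = block \<sigma> n" if "n \<in> rows q D"
    using block_in[OF p(2) that] by (intro block_eq[OF p(1)]) auto
  show "block (\<sigma> \<union> \<tau>) n = block \<tau> n" if "n \<in> rows q (L - D)"
    using block_in[OF p(3) that] by (intro block_eq[OF p(1)]) auto
qed

lemma Part_on_Un_disjoint:
  assumes "D \<subseteq> L" "\<sigma> \<in> Part_on q D" "\<tau> \<in> Part_on q (L - D)"
  shows "\<sigma> \<inter> \<tau> = {}"
proof (rule ccontr)
  assume "\<sigma> \<inter> \<tau> \<noteq> {}"
  then obtain B where B: "B \<in> \<sigma>" "B \<in> \<tau>" by auto
  have "B \<subseteq> rows q D" "B \<subseteq> rows q (L - D)" "B \<noteq> {}"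
    using Part_on_block_subset[OF assms(2) B(1)] Part_on_block_subset[OF assms(3) B(2)]
      Part_on_block_nonempty[OF assms(2) B(1)] by auto
  then show False by (auto simp: rows_Diff)
qed

lemma row_index_in_rows: "l \<in> L \<Longrightarrow> i < q l \<Longrightarrow> offset q l + i \<in> rows q L"
  by (auto simp: rows_def mem_row_iff)

lemma tensor_on_Un:
  assumes L: "finite L" and D: "D \<subseteq> L" and \<sigma>: "\<sigma> \<in> Part_on q D" and \<tau>: "\<tau> \<in> Part_on q (L - D)"
  shows "tensor_on q L f (\<sigma> \<union> \<tau>) y = tensor_on q D f \<sigma> (restrict y \<sigma>) * tensor_on q (L - D) f \<tau> (restrict y \<tau>)"
proof -
  have p: "partition_on (rows q D) \<sigma>" "partition_on (rows q (L - D)) \<tau>"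
    using \<sigma> \<tau> by (auto simp: Part_on_def)
  have "tensor_on q L f (\<sigma> \<union> \<tau>) y =
    (\<Prod>l\<in>D. f l (\<lambda>i\<in>{..<q l}. y (block (\<sigma> \<union> \<tau>) (offset q l + i)))) *
    (\<Prod>l\<in>L - D. f l (\<lambda>i\<in>{..<q l}. y (block (\<sigma> \<union> \<tau>) (offset q l + i))))"
    unfolding tensor_on_def by (subst prod.subset_diff[OF D L]) (rule mult.commute)
  also have "(\<Prod>l\<in>D. f l (\<lambda>i\<in>{..<q l}. y (block (\<sigma> \<union> \<tau>) (offset q l + i)))) = tensor_on q D f \<sigma> (restrict y \<sigma>)"
    unfolding tensor_on_def
  proof (intro prod.cong refl arg_cong[where f = "f _"] restrict_ext)
    fix l i assume "l \<in> D" "i \<in> {..<q l}"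
    then have n: "offset q l + i \<in> rows q D" by (simp add: row_index_in_rows)
    show "y (block (\<sigma> \<union> \<tau>) (offset q l + i)) = restrict y \<sigma> (block \<sigma> (offset q l + i))"
      using block_Un(1)[OF D \<sigma> \<tau> n] block_in(1)[OF p(1) n] by simp
  qed
  also have "(\<Prod>l\<in>L - D. f l (\<lambda>i\<in>{..<q l}. y (block (\<sigma> \<union> \<tau>) (offset q l + i)))) = tensor_on q (L - D) f \<tau> (restrict y \<tau>)"
    unfolding tensor_on_def
  proof (intro prod.cong refl arg_cong[where f = "f _"] restrict_ext)
    fix l i assume "l \<in> L - D" "i \<in> {..<q l}"
    then have n: "offset q l + i \<in> rows q (L - D)" by (simp add: row_index_in_rows)
    show "y (block (\<sigma> \<union> \<tau>) (offset q l + i)) = restrict y \<tau> (block \<tau> (offset q l + i))"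
      using block_Un(2)[OF D \<sigma> \<tau> n] block_in(1)[OF p(2) n] by simp
  qed
  finally show ?thesis .
qed

text \<open>Serves two kinds of functions: truncations, for which \<open>abs_moments\<close> is
  checked directly, and then the given functions, for which it follows from the bounds obtained with
  the truncations. All subsets of \<open>R\<close> are included because the recursions pass to
  subsets.\<close>

locale U_statistic_moments = locally_finite_poisson P M \<eta> A
  for P :: "'w measure" and M :: "'a measure" and \<eta> A +
  fixes q :: "nat \<Rightarrow> nat" and f :: "nat \<Rightarrow> (nat \<Rightarrow> 'a) \<Rightarrow> real" and R :: "nat set"
  assumes R: "finite R"
    and f_meas: "\<And>l. l \<in> R \<Longrightarrow> f l \<in> borel_measurable (PiM {..<q l} (\<lambda>_. M))"
    and abs_moments: "\<And>B. B \<subseteq> R \<Longrightarrow>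
      (\<integral>\<^sup>+ \<omega>. (\<Prod>l\<in>B. \<integral>\<^sup>+ x. ennreal \<bar>f l x\<bar> \<partial>factorial_measure (\<eta> \<omega>) (q l)) \<partial>P) < \<infinity>"
begin

section \<open>Positive and negative parts of the U-statistics\<close>

abbreviation "T l \<omega> \<equiv> \<integral>\<^sup>+ x. ennreal \<bar>f l x\<bar> \<partial>factorial_measure (\<eta> \<omega>) (q l)"
abbreviation "S l \<equiv> U_statistic \<eta> (q l) (f l)"

definition block_integral :: "nat set \<Rightarrow> nat set set \<Rightarrow> real" where
  "block_integral L \<sigma> = (\<integral>y. tensor_on q L f \<sigma> y \<partial>PiM \<sigma> (\<lambda>_. M))"

text \<open>Positive part for \<open>True\<close>, negative part for \<open>False\<close>. The
  boolean index lets a product over \<open>B\<close> expand into a sum over the sign patterns in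
  \<open>B \<rightarrow>\<^sub>E UNIV\<close>.\<close>

definition half :: "bool \<Rightarrow> nat \<Rightarrow> (nat \<Rightarrow> 'a) \<Rightarrow> real" where
  "half e l x = max 0 (if e then f l x else - f l x)"

definition sg :: "bool \<Rightarrow> real" where "sg e = (if e then 1 else -1)"

definition half_statistic :: "bool \<Rightarrow> nat \<Rightarrow> 'w \<Rightarrow> real" where
  "half_statistic e l \<omega> = enn2real (\<integral>\<^sup>+ x. ennreal (half e l x) \<partial>factorial_measure (\<eta> \<omega>) (q l))"

lemma half_nonneg: "0 \<le> half e l x" by (simp add: half_def)

lemma half_le: "half e l x \<le> \<bar>f l x\<bar>" by (auto simp: half_def)

lemma sum_half: "(\<Sum>e\<in>UNIV. sg e * half e l x) = f l x"
  by (simp add: UNIV_bool sg_def half_def max_def)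

lemma half_meas: "l \<in> R \<Longrightarrow> half e l \<in> borel_measurable (PiM {..<q l} (\<lambda>_. M))"
  using f_meas unfolding half_def[abs_def] by simp

lemma finite_sub: "B \<subseteq> R \<Longrightarrow> finite B"
  using R finite_subset by blast

lemma T_meas: "l \<in> R \<Longrightarrow> T l \<in> borel_measurable P"
  using f_meas by (intro Campbell(1)) simp

lemma half_statistic_meas: assumes l: "l \<in> R" shows "half_statistic e l \<in> borel_measurable P"
proof -
  have "(\<lambda>\<omega>. \<integral>\<^sup>+ x. ennreal (half e l x) \<partial>factorial_measure (\<eta> \<omega>) (q l)) \<in> borel_measurable P"
    using half_meas[OF l] by (intro Campbell(1)) simp
  then show ?thesis unfolding half_statistic_def[abs_def] by measurable
qed

lemma T_finite_AE: assumes l: "l \<in> R" shows "AE \<omega> in P. T l \<omega> \<noteq> \<infinity>"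
  using abs_moments[of "{l}"] l T_meas by (intro nn_integral_PInf_AE) auto

lemma half_integral_le_T: "(\<integral>\<^sup>+ x. ennreal (half e l x) \<partial>factorial_measure (\<eta> \<omega>) (q l)) \<le> T l \<omega>"
  using half_le by (intro nn_integral_mono ennreal_leI)

lemma f_meas_factorial:
  assumes "\<omega> \<in> space P" "g \<in> borel_measurable (PiM {..<n} (\<lambda>_. M))"
  shows "g \<in> borel_measurable (factorial_measure (\<eta> \<omega>) n)"
  using assms(2) measurable_cong_sets[OF sets_factorial_\<eta>[OF assms(1)] refl] by blast

lemma integrable_f:
  assumes l: "l \<in> R" and \<omega>: "\<omega> \<in> space P" and "T l \<omega> \<noteq> \<infinity>"
  shows "integrable (factorial_measure (\<eta> \<omega>) (q l)) (f l)"
  using assms(3) f_meas_factorial[OF \<omega> f_meas[OF l]] by (intro integrableI_bounded) (auto simp: less_top)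

lemma integrable_f_AE:
  assumes l: "l \<in> R"
  shows "AE \<omega> in P. integrable (factorial_measure (\<eta> \<omega>) (q l)) (f l)"
  using T_finite_AE[OF l] AE_space by eventually_elim (simp add: integrable_f[OF l])

lemma S_eq:
  assumes l: "l \<in> R" and \<omega>: "\<omega> \<in> space P" and "T l \<omega> \<noteq> \<infinity>"
  shows "S l \<omega> = (\<Sum>e\<in>UNIV. sg e * half_statistic e l \<omega>)"
proof -
  have "ennreal (half True l x) = ennreal (f l x)" "ennreal (half False l x) = ennreal (- f l x)" for x
    by (auto simp: half_def max_def ennreal_neg)
  then show ?thesis
    unfolding U_statistic_def real_lebesgue_integral_def[OF integrable_f[OF assms]]
    by (simp add: UNIV_bool sg_def half_statistic_def)
qed

lemma S_meas: assumes l: "l \<in> R" shows "S l \<in> borel_measurable P"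
proof -
  \<comment> \<open>Where \<open>T l\<close> is infinite, \<open>f l\<close> is not integrable and
    the Bochner integral is 0 by convention; this gives a measurable formula for \<open>S l\<close>
    on the whole space.\<close>
  have "(\<lambda>\<omega>. if T l \<omega> = \<infinity> then 0 else \<Sum>e\<in>UNIV. sg e * half_statistic e l \<omega>) \<in> borel_measurable P"
    using T_meas[OF l] half_statistic_meas[OF l] by measurable
  moreover have "S l \<omega> = (if T l \<omega> = \<infinity> then 0 else \<Sum>e\<in>UNIV. sg e * half_statistic e l \<omega>)" if "\<omega> \<in> space P" for \<omega>
  proof (cases "T l \<omega> = \<infinity>")
    case True
    then have "\<not> integrable (factorial_measure (\<eta> \<omega>) (q l)) (f l)"
      by (auto simp: integrable_iff_bounded)
    then show ?thesis using True by (simp add: U_statistic_def not_integrable_integral_eq)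
  qed (simp add: S_eq[OF l that])
  ultimately show ?thesis by (subst measurable_cong)
qed

lemma ennreal_half_statistic:
  assumes "T l \<omega> \<noteq> \<infinity>"
  shows "ennreal (half_statistic e l \<omega>) = (\<integral>\<^sup>+ x. ennreal (half e l x) \<partial>factorial_measure (\<eta> \<omega>) (q l))"
  unfolding half_statistic_def
proof (rule ennreal_enn2real)
  have "T l \<omega> < \<infinity>" using assms by (simp add: less_top)
  then show "(\<integral>\<^sup>+ x. ennreal (half e l x) \<partial>factorial_measure (\<eta> \<omega>) (q l)) < top"
    using half_integral_le_T by (metis infinity_ennreal_def le_less_trans)
qed

lemma T_finite_all_AE: "B \<subseteq> R \<Longrightarrow> AE \<omega> in P. \<forall>l\<in>B. T l \<omega> \<noteq> \<infinity>"
  using T_finite_AE finite_sub by (subst AE_finite_all) auto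

lemma tensor_half_integral:
  assumes B: "B \<subseteq> R"
  shows "(\<integral>\<^sup>+ \<omega>. (\<Prod>l\<in>B. ennreal (half_statistic (e l) l \<omega>)) \<partial>P) =
      (\<Sum>\<sigma>\<in>Part_on q B. \<integral>\<^sup>+ y. ennreal (tensor_on q B (\<lambda>l. half (e l) l) \<sigma> y) \<partial>PiM \<sigma> (\<lambda>_. M))"
    and "(\<integral>\<^sup>+ \<omega>. (\<Prod>l\<in>B. ennreal (half_statistic (e l) l \<omega>)) \<partial>P) < \<infinity>"
proof -
  have eq: "(\<integral>\<^sup>+ \<omega>. (\<Prod>l\<in>B. ennreal (half_statistic (e l) l \<omega>)) \<partial>P) =
    (\<integral>\<^sup>+ \<omega>. (\<Prod>l\<in>B. \<integral>\<^sup>+ x. ennreal (half (e l) l x) \<partial>factorial_measure (\<eta> \<omega>) (q l)) \<partial>P)"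
    by (rule nn_integral_cong_AE, use T_finite_all_AE[OF B] in eventually_elim)
      (auto intro!: prod.cong ennreal_half_statistic)
  also have "\<dots> = (\<Sum>\<sigma>\<in>Part_on q B. \<integral>\<^sup>+ y. ennreal (tensor_on q B (\<lambda>l. half (e l) l) \<sigma> y) \<partial>PiM \<sigma> (\<lambda>_. M))"
    using half_meas B by (intro moment_formula_nonneg[OF finite_sub[OF B]] half_nonneg) auto
  finally show "(\<integral>\<^sup>+ \<omega>. (\<Prod>l\<in>B. ennreal (half_statistic (e l) l \<omega>)) \<partial>P) =
      (\<Sum>\<sigma>\<in>Part_on q B. \<integral>\<^sup>+ y. ennreal (tensor_on q B (\<lambda>l. half (e l) l) \<sigma> y) \<partial>PiM \<sigma> (\<lambda>_. M))" .
  have "(\<integral>\<^sup>+ \<omega>. (\<Prod>l\<in>B. \<integral>\<^sup>+ x. ennreal (half (e l) l x) \<partial>factorial_measure (\<eta> \<omega>) (q l)) \<partial>P) \<le>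
      (\<integral>\<^sup>+ \<omega>. (\<Prod>l\<in>B. T l \<omega>) \<partial>P)"
    by (intro nn_integral_mono prod_mono_ennreal half_integral_le_T)
  also have "\<dots> < \<infinity>" by (rule abs_moments[OF B])
  finally show "(\<integral>\<^sup>+ \<omega>. (\<Prod>l\<in>B. ennreal (half_statistic (e l) l \<omega>)) \<partial>P) < \<infinity>" unfolding eq .
qed

text \<open>Domination by \<open>T\<close> makes the moment finite. Then every summand of the
  nonnegative formula is finite, and the identity passes from \<open>ennreal\<close> to the
  reals.\<close>

lemma half_moment:
  assumes B: "B \<subseteq> R"
  shows "integrable P (\<lambda>\<omega>. \<Prod>l\<in>B. half_statistic (e l) l \<omega>)" (is ?A)
    and "\<And>\<sigma>. \<sigma> \<in> Part_on q B \<Longrightarrow> integrable (PiM \<sigma> (\<lambda>_. M)) (tensor_on q B (\<lambda>l. half (e l) l) \<sigma>)" (is "PROP ?B")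
    and "(\<integral>\<omega>. (\<Prod>l\<in>B. half_statistic (e l) l \<omega>) \<partial>P) =
      (\<Sum>\<sigma>\<in>Part_on q B. \<integral>y. tensor_on q B (\<lambda>l. half (e l) l) \<sigma> y \<partial>PiM \<sigma> (\<lambda>_. M))" (is ?C)
proof -
  have 0: "0 \<le> half_statistic e l \<omega>" for e l \<omega> by (simp add: half_statistic_def)
  have m: "(\<lambda>\<omega>. \<Prod>l\<in>B. half_statistic (e l) l \<omega>) \<in> borel_measurable P"
    using half_statistic_meas B by (intro borel_measurable_prod) auto
  have pe: "ennreal (\<Prod>l\<in>B. half_statistic (e l) l \<omega>) = (\<Prod>l\<in>B. ennreal (half_statistic (e l) l \<omega>))" for \<omega>
    by (rule prod_ennreal[symmetric]) (rule 0)
  show A: ?A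
  proof (rule integrableI_nonneg[OF m])
    show "AE \<omega> in P. 0 \<le> (\<Prod>l\<in>B. half_statistic (e l) l \<omega>)" using 0 by (intro AE_I2 prod_nonneg) auto
    show "(\<integral>\<^sup>+ \<omega>. ennreal (\<Prod>l\<in>B. half_statistic (e l) l \<omega>) \<partial>P) < \<infinity>"
      unfolding pe by (rule tensor_half_integral(2)[OF B])
  qed
  have tn: "0 \<le> tensor_on q B (\<lambda>l. half (e l) l) \<sigma> y" for \<sigma> y
    unfolding tensor_on_def by (intro prod_nonneg) (simp add: half_nonneg)
  show Bn: "PROP ?B"
  proof -
    fix \<sigma> assume \<sigma>: "\<sigma> \<in> Part_on q B"
    have "(\<integral>\<^sup>+ y. ennreal (tensor_on q B (\<lambda>l. half (e l) l) \<sigma> y) \<partial>PiM \<sigma> (\<lambda>_. M)) \<le>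
      (\<Sum>\<sigma>\<in>Part_on q B. \<integral>\<^sup>+ y. ennreal (tensor_on q B (\<lambda>l. half (e l) l) \<sigma> y) \<partial>PiM \<sigma> (\<lambda>_. M))"
      using \<sigma> finite_Part_on[OF finite_sub[OF B]] by (intro member_le_sum) auto
    also have "\<dots> < \<infinity>" using tensor_half_integral[OF B, of e] by simp
    finally show "integrable (PiM \<sigma> (\<lambda>_. M)) (tensor_on q B (\<lambda>l. half (e l) l) \<sigma>)"
      using tn half_meas B \<sigma> by (intro integrableI_nonneg measurable_tensor_on) auto
  qed
  have "ennreal (\<integral>\<omega>. (\<Prod>l\<in>B. half_statistic (e l) l \<omega>) \<partial>P) = (\<integral>\<^sup>+ \<omega>. ennreal (\<Prod>l\<in>B. half_statistic (e l) l \<omega>) \<partial>P)"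
    using A 0 by (intro nn_integral_eq_integral[symmetric] AE_I2 prod_nonneg) auto
  also have "\<dots> = (\<Sum>\<sigma>\<in>Part_on q B. \<integral>\<^sup>+ y. ennreal (tensor_on q B (\<lambda>l. half (e l) l) \<sigma> y) \<partial>PiM \<sigma> (\<lambda>_. M))"
    unfolding pe by (rule tensor_half_integral(1)[OF B])
  also have "\<dots> = (\<Sum>\<sigma>\<in>Part_on q B. ennreal (\<integral>y. tensor_on q B (\<lambda>l. half (e l) l) \<sigma> y \<partial>PiM \<sigma> (\<lambda>_. M)))"
    using Bn tn by (intro sum.cong refl nn_integral_eq_integral AE_I2) auto
  also have "\<dots> = ennreal (\<Sum>\<sigma>\<in>Part_on q B. \<integral>y. tensor_on q B (\<lambda>l. half (e l) l) \<sigma> y \<partial>PiM \<sigma> (\<lambda>_. M))"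
    using tn by (intro sum_ennreal integral_nonneg_AE AE_I2) auto
  finally show ?C
    using 0 tn by (subst (asm) ennreal_inj) (auto intro!: integral_nonneg_AE AE_I2 prod_nonneg sum_nonneg)
qed

lemma prod_signed_sum:
  fixes a :: "bool \<Rightarrow> nat \<Rightarrow> real"
  assumes "finite B"
  shows "(\<Prod>l\<in>B. \<Sum>e\<in>UNIV. sg e * a e l) = (\<Sum>e\<in>B \<rightarrow>\<^sub>E UNIV. (\<Prod>l\<in>B. sg (e l)) * (\<Prod>l\<in>B. a (e l) l))"
  using assms by (simp add: prod_sum_PiE prod.distrib)

lemma tensor_on_signed_sum:
  assumes "finite B"
  shows "tensor_on q B f \<sigma> y = (\<Sum>e\<in>B \<rightarrow>\<^sub>E UNIV. (\<Prod>l\<in>B. sg (e l)) * tensor_on q B (\<lambda>l. half (e l) l) \<sigma> y)"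
proof -
  let ?y = "\<lambda>l. \<lambda>i\<in>{..<q l}. y (block \<sigma> (offset q l + i))"
  have "tensor_on q B f \<sigma> y = (\<Prod>l\<in>B. \<Sum>e\<in>UNIV. sg e * half e l (?y l))"
    by (simp only: tensor_on_def sum_half)
  also have "\<dots> = (\<Sum>e\<in>B \<rightarrow>\<^sub>E UNIV. (\<Prod>l\<in>B. sg (e l)) * (\<Prod>l\<in>B. half (e l) l (?y l)))"
    by (rule prod_signed_sum[OF assms])
  finally show ?thesis by (simp only: tensor_on_def)
qed

lemma integrable_tensor_on:
  assumes B: "B \<subseteq> R" and \<sigma>: "\<sigma> \<in> Part_on q B"
  shows "integrable (PiM \<sigma> (\<lambda>_. M)) (tensor_on q B f \<sigma>)"
  unfolding tensor_on_signed_sum[OF finite_sub[OF B], abs_def] using half_moment(2)[OF B \<sigma>]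
  by (intro Bochner_Integration.integrable_sum integrable_mult_right) auto

text \<open>The product of statistics and the tensor expand over the same sign patterns. The
  nonnegative formula holds for each pattern, and after exchanging two finite sums the tensor of
  \<open>f\<close> reassembles.\<close>

theorem moment_formula:
  assumes B: "B \<subseteq> R"
  shows "integrable P (\<lambda>\<omega>. \<Prod>l\<in>B. S l \<omega>)"
    and "(\<integral>\<omega>. (\<Prod>l\<in>B. S l \<omega>) \<partial>P) = (\<Sum>\<sigma>\<in>Part_on q B. block_integral B \<sigma>)"
proof -
  note fB = finite_sub[OF B]
  let ?E = "B \<rightarrow>\<^sub>E (UNIV :: bool set)"
  let ?r = "\<lambda>\<omega>. \<Sum>e\<in>?E. (\<Prod>l\<in>B. sg (e l)) * (\<Prod>l\<in>B. half_statistic (e l) l \<omega>)"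
  have ae: "AE \<omega> in P. (\<Prod>l\<in>B. S l \<omega>) = ?r \<omega>"
    using T_finite_all_AE[OF B] AE_space
  proof eventually_elim
    case (elim \<omega>)
    have "(\<Prod>l\<in>B. S l \<omega>) = (\<Prod>l\<in>B. \<Sum>e\<in>UNIV. sg e * half_statistic e l \<omega>)"
      using elim B by (intro prod.cong refl S_eq) auto
    then show ?case using prod_signed_sum[OF fB, of "\<lambda>e l. half_statistic e l \<omega>"] by simp
  qed
  have int: "integrable P (\<lambda>\<omega>. (\<Prod>l\<in>B. sg (e l)) * (\<Prod>l\<in>B. half_statistic (e l) l \<omega>))" for e
    by (intro integrable_mult_right half_moment(1)[OF B])
  have m: "(\<lambda>\<omega>. \<Prod>l\<in>B. S l \<omega>) \<in> borel_measurable P"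
    using S_meas B by (intro borel_measurable_prod) auto
  have ir: "integrable P ?r" using int by (rule Bochner_Integration.integrable_sum)
  show "integrable P (\<lambda>\<omega>. \<Prod>l\<in>B. S l \<omega>)"
    using integrable_cong_AE[OF m borel_measurable_integrable[OF ir] ae] ir by simp
  have "(\<integral>\<omega>. (\<Prod>l\<in>B. S l \<omega>) \<partial>P) = (\<integral>\<omega>. ?r \<omega> \<partial>P)"
    by (rule integral_cong_AE[OF m borel_measurable_integrable[OF ir] ae])
  also have "\<dots> = (\<Sum>e\<in>?E. (\<Prod>l\<in>B. sg (e l)) * (\<Sum>\<sigma>\<in>Part_on q B. \<integral>y. tensor_on q B (\<lambda>l. half (e l) l) \<sigma> y \<partial>PiM \<sigma> (\<lambda>_. M)))"
    by (subst Bochner_Integration.integral_sum[OF int]) (simp add: half_moment(3)[OF B])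
  also have "\<dots> = (\<Sum>\<sigma>\<in>Part_on q B. \<Sum>e\<in>?E. (\<Prod>l\<in>B. sg (e l)) * (\<integral>y. tensor_on q B (\<lambda>l. half (e l) l) \<sigma> y \<partial>PiM \<sigma> (\<lambda>_. M)))"
    unfolding sum_distrib_left by (rule sum.swap)
  also have "\<dots> = (\<Sum>\<sigma>\<in>Part_on q B. block_integral B \<sigma>)"
  proof (intro sum.cong refl)
    fix \<sigma> assume \<sigma>: "\<sigma> \<in> Part_on q B"
    have "block_integral B \<sigma> = (\<integral>y. (\<Sum>e\<in>?E. (\<Prod>l\<in>B. sg (e l)) * tensor_on q B (\<lambda>l. half (e l) l) \<sigma> y) \<partial>PiM \<sigma> (\<lambda>_. M))"
      unfolding block_integral_def by (intro Bochner_Integration.integral_cong refl tensor_on_signed_sum[OF fB])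
    also have "\<dots> = (\<Sum>e\<in>?E. (\<Prod>l\<in>B. sg (e l)) * (\<integral>y. tensor_on q B (\<lambda>l. half (e l) l) \<sigma> y \<partial>PiM \<sigma> (\<lambda>_. M)))"
      using half_moment(2)[OF B \<sigma>] by (subst Bochner_Integration.integral_sum) auto
    finally show "(\<Sum>e\<in>?E. (\<Prod>l\<in>B. sg (e l)) * (\<integral>y. tensor_on q B (\<lambda>l. half (e l) l) \<sigma> y \<partial>PiM \<sigma> (\<lambda>_. M))) = block_integral B \<sigma>" ..
  qed
  finally show "(\<integral>\<omega>. (\<Prod>l\<in>B. S l \<omega>) \<partial>P) = (\<Sum>\<sigma>\<in>Part_on q B. block_integral B \<sigma>)" .
qed

section \<open>Factorization over disjoint row sets and the two recursions\<close>

lemma block_integral_Un: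
  assumes L: "L \<subseteq> R" and D: "D \<subseteq> L" and \<sigma>: "\<sigma> \<in> Part_on q D" and \<tau>: "\<tau> \<in> Part_on q (L - D)"
  shows "block_integral L (\<sigma> \<union> \<tau>) = block_integral D \<sigma> * block_integral (L - D) \<tau>"
proof -
  have f: "finite L" "finite D" "finite (L - D)" using finite_sub L D by auto
  note e = tensor_on_Un[OF f(1) D \<sigma> \<tau>, of f]
  show ?thesis
    unfolding block_integral_def e
  proof (rule product_integral_Un_mult)
    show "\<sigma> \<inter> \<tau> = {}" by (rule Part_on_Un_disjoint[OF D \<sigma> \<tau>])
    show "finite \<sigma>" "finite \<tau>"
      by (rule finite_Part_on_elem[OF f(2) \<sigma>], rule finite_Part_on_elem[OF f(3) \<tau>])
    show "integrable (PiM (\<sigma> \<union> \<tau>) (\<lambda>_. M)) (\<lambda>x. tensor_on q D f \<sigma> (restrict x \<sigma>) * tensor_on q (L - D) f \<tau> (restrict x \<tau>))"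
      using integrable_tensor_on[OF L Part_on_Un(1)[OF D \<sigma> \<tau>]] unfolding e[abs_def] .
  qed
qed

lemma sum_block_integral_Un:
  assumes L: "L \<subseteq> R" and D: "D \<subseteq> L" and U: "U \<subseteq> Part_on q D" and V: "V \<subseteq> Part_on q (L - D)"
  shows "(\<Sum>\<rho>\<in>(\<lambda>(\<sigma>, \<tau>). \<sigma> \<union> \<tau>) ` (U \<times> V). block_integral L \<rho>) =
    (\<Sum>\<sigma>\<in>U. block_integral D \<sigma>) * (\<Sum>\<tau>\<in>V. block_integral (L - D) \<tau>)"
proof -
  have "(\<Sum>\<rho>\<in>(\<lambda>(\<sigma>, \<tau>). \<sigma> \<union> \<tau>) ` (U \<times> V). block_integral L \<rho>) = (\<Sum>(\<sigma>, \<tau>)\<in>U \<times> V. block_integral L (\<sigma> \<union> \<tau>))"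
    by (subst sum.reindex[OF inj_on_Un_Part_on[OF D U V]]) (simp add: case_prod_beta')
  also have "\<dots> = (\<Sum>(\<sigma>, \<tau>)\<in>U \<times> V. block_integral D \<sigma> * block_integral (L - D) \<tau>)"
    using U V by (intro sum.cong refl) (auto intro!: block_integral_Un[OF L D])
  also have "\<dots> = (\<Sum>\<sigma>\<in>U. block_integral D \<sigma>) * (\<Sum>\<tau>\<in>V. block_integral (L - D) \<tau>)"
    by (simp add: sum_product sum.cartesian_product)
  finally show ?thesis .
qed

definition moment :: "nat set \<Rightarrow> real" where
  "moment L = (\<integral>\<omega>. (\<Prod>l\<in>L. S l \<omega>) \<partial>P)"

text \<open>Partitions are grouped by the component \<open>C\<close> of the row \<open>l\<close>.
  What remains on \<open>L - C\<close> is unrestricted, so the moment formula, read backwards, turns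
  it into \<open>moment (L - C)\<close>.\<close>

theorem moment_tilde_recursion:
  assumes L: "L \<subseteq> R" and l: "l \<in> L"
  shows "moment L = (\<Sum>C\<in>{C. C \<subseteq> L \<and> l \<in> C}. (\<Sum>\<sigma>\<in>Part_tilde_on q C. block_integral C \<sigma>) * moment (L - C))"
proof -
  have fL: "finite L" using finite_sub[OF L] .
  have "moment L = (\<Sum>\<sigma>\<in>Part_on q L. block_integral L \<sigma>)"
    unfolding moment_def by (rule moment_formula(2)[OF L])
  also have "\<dots> = (\<Sum>C\<in>{C. C \<subseteq> L \<and> l \<in> C}. \<Sum>\<sigma>\<in>{\<sigma> \<in> Part_on q L. row_component q L l \<sigma> = C}. block_integral L \<sigma>)"
    using row_component[OF l] fL finite_Part_on by (intro sum.group[symmetric]) auto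
  also have "\<dots> = (\<Sum>C\<in>{C. C \<subseteq> L \<and> l \<in> C}. (\<Sum>\<sigma>\<in>Part_tilde_on q C. block_integral C \<sigma>) * moment (L - C))"
  proof (intro sum.cong refl)
    fix C assume C: "C \<in> {C. C \<subseteq> L \<and> l \<in> C}"
    have "L - C \<subseteq> R" using L by auto
    from moment_formula(2)[OF this]
    have "(\<Sum>\<tau>\<in>Part_on q (L - C). block_integral (L - C) \<tau>) = moment (L - C)" by (simp add: moment_def)
    moreover have "Part_tilde_on q C \<subseteq> Part_on q C" by (auto simp: Part_tilde_on_def)
    ultimately show "(\<Sum>\<sigma>\<in>{\<sigma> \<in> Part_on q L. row_component q L l \<sigma> = C}. block_integral L \<sigma>) =
        (\<Sum>\<sigma>\<in>Part_tilde_on q C. block_integral C \<sigma>) * moment (L - C)"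
      using C Part_on_component_eq[of l C L q]
        sum_block_integral_Un[OF L, of C "Part_tilde_on q C" "Part_on q (L - C)"] by simp
  qed
  finally show ?thesis .
qed

text \<open>A single row admits only the partition into singletons, so its integral is the mean.
  Rows partitioned into singletons share no variable, so the integral factorizes; the empty case is
  the unit mass on the empty tuple.\<close>

lemma block_integral_singletons:
  assumes E: "E \<subseteq> R"
  shows "block_integral E (singletons (rows q E)) = (\<Prod>l\<in>E. moment {l})"
  using finite_sub[OF E] E
proof (induction E rule: finite_induct)
  case empty
  have "block_integral {} {} = (\<integral>y. 1 \<partial>PiM {} (\<lambda>_ :: nat set. M))"
    unfolding block_integral_def tensor_on_def by simp
  also have "\<dots> = measure (PiM {} (\<lambda>_. M)) {\<lambda>_ :: nat set. undefined}" by (simp add: space_PiM)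
  also have "\<dots> = 1" unfolding measure_def by simp
  finally show ?case by (simp add: singletons_def rows_def)
next
  case (insert l E)
  have eq: "singletons (rows q (insert l E)) = singletons (rows q {l}) \<union> singletons (rows q (insert l E - {l}))"
    using insert(2) by (auto simp: singletons_def rows_def)
  have "moment {l} = block_integral {l} (singletons (rows q {l}))"
    using moment_formula(2)[of "{l}"] insert.prems by (simp add: moment_def Part_on_single_row)
  moreover have "block_integral (insert l E) (singletons (rows q {l}) \<union> singletons (rows q (insert l E - {l}))) =
      block_integral {l} (singletons (rows q {l})) * block_integral (insert l E - {l}) (singletons (rows q (insert l E - {l})))"
    using insert.prems by (intro block_integral_Un singletons_Part_on) auto
  moreover have "insert l E - {l} = E" using insert.hyps by simp
  ultimately show ?case using insert eq by simp
qed

theorem moment_bar_recursion: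
  assumes L: "L \<subseteq> R"
  shows "moment L = (\<Sum>C\<in>Pow L. (\<Sum>\<sigma>\<in>Part_bar_on q C. block_integral C \<sigma>) * (\<Prod>l\<in>L - C. moment {l}))"
proof -
  have fL: "finite L" using finite_sub[OF L] .
  have "moment L = (\<Sum>\<sigma>\<in>Part_on q L. block_integral L \<sigma>)"
    unfolding moment_def by (rule moment_formula(2)[OF L])
  also have "\<dots> = (\<Sum>C\<in>Pow L. \<Sum>\<sigma>\<in>{\<sigma> \<in> Part_on q L. active_rows q L \<sigma> = C}. block_integral L \<sigma>)"
    using fL finite_Part_on by (intro sum.group[symmetric]) (auto simp: active_rows_def)
  also have "\<dots> = (\<Sum>C\<in>Pow L. (\<Sum>\<sigma>\<in>Part_bar_on q C. block_integral C \<sigma>) * (\<Prod>l\<in>L - C. moment {l}))"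
  proof (intro sum.cong refl)
    fix C assume C: "C \<in> Pow L"
    have "Part_bar_on q C \<subseteq> Part_on q C" by (auto simp: Part_bar_on_def)
    moreover have "block_integral (L - C) (singletons (rows q (L - C))) = (\<Prod>l\<in>L - C. moment {l})"
      using L by (intro block_integral_singletons) auto
    ultimately show "(\<Sum>\<sigma>\<in>{\<sigma> \<in> Part_on q L. active_rows q L \<sigma> = C}. block_integral L \<sigma>) =
        (\<Sum>\<sigma>\<in>Part_bar_on q C. block_integral C \<sigma>) * (\<Prod>l\<in>L - C. moment {l})"
      using C Part_on_active_eq[OF fL, of C q] singletons_Part_on[of q "L - C"]
        sum_block_integral_Un[OF L, of C "Part_bar_on q C" "{singletons (rows q (L - C))}"] by simp
  qed
  finally show ?thesis .
qed

text \<open>Centered moments and the sums over \<open>Part_bar_on\<close> both solve the system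
  \<open>moment L = (\<Sum>C\<in>Pow L. x C * (\<Prod>l\<in>L - C. moment {l}))\<close>. It is
  triangular with coefficient 1 at \<open>C = L\<close>, so induction on \<open>L\<close> identifies
  the two solutions.\<close>

theorem centered_moment_formula:
  assumes L: "L \<subseteq> R"
  shows "integrable P (\<lambda>\<omega>. \<Prod>l\<in>L. (S l \<omega> - moment {l}))"
    and "(\<integral>\<omega>. (\<Prod>l\<in>L. (S l \<omega> - moment {l})) \<partial>P) = (\<Sum>\<sigma>\<in>Part_bar_on q L. block_integral L \<sigma>)"
proof -
  have int: "integrable P (\<lambda>\<omega>. \<Prod>l\<in>L. (S l \<omega> - moment {l}))" if L: "L \<subseteq> R" for L
  proof -
    have "(\<Prod>l\<in>L. (S l \<omega> - moment {l})) = (\<Sum>B\<in>Pow L. (\<Prod>l\<in>B. S l \<omega>) * (\<Prod>l\<in>L - B. - moment {l}))" for \<omega>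
      using prod_add[OF finite_sub[OF L], of "\<lambda>l. S l \<omega>" "\<lambda>l. - moment {l}"] by simp
    moreover have "integrable P (\<lambda>\<omega>. \<Sum>B\<in>Pow L. (\<Prod>l\<in>B. S l \<omega>) * (\<Prod>l\<in>L - B. - moment {l}))"
      using L by (intro Bochner_Integration.integrable_sum integrable_mult_left moment_formula(1)) auto
    ultimately show ?thesis by simp
  qed
  then show "integrable P (\<lambda>\<omega>. \<Prod>l\<in>L. (S l \<omega> - moment {l}))" using L .
  let ?c = "\<lambda>L. \<integral>\<omega>. (\<Prod>l\<in>L. (S l \<omega> - moment {l})) \<partial>P" and ?b = "\<lambda>L. \<Sum>\<sigma>\<in>Part_bar_on q L. block_integral L \<sigma>"
  show "?c L = ?b L" using finite_sub[OF L] L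
  proof (induction L rule: finite_psubset_induct)
    case (psubset L)
    \<comment> \<open>Each factor is written as
      \<open>(S l \<omega> - moment {l}) + moment {l}\<close> and the product is expanded.\<close>
    have "moment L = (\<integral>\<omega>. (\<Sum>C\<in>Pow L. (\<Prod>l\<in>C. (S l \<omega> - moment {l})) * (\<Prod>l\<in>L - C. moment {l})) \<partial>P)"
      unfolding moment_def[of L] using prod_add[OF psubset(1), of "\<lambda>l. S l _ - moment {l}" "\<lambda>l. moment {l}"]
      by simp
    also have "\<dots> = (\<Sum>C\<in>Pow L. ?c C * (\<Prod>l\<in>L - C. moment {l}))"
      using psubset.prems by (subst Bochner_Integration.integral_sum) (auto intro!: integrable_mult_left int)
    finally have "(\<Sum>C\<in>Pow L. ?c C * (\<Prod>l\<in>L - C. moment {l})) = (\<Sum>C\<in>Pow L. ?b C * (\<Prod>l\<in>L - C. moment {l}))"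
      using moment_bar_recursion[OF psubset.prems] by simp
    moreover have "Pow L = insert L (Pow L - {L})" by auto
    moreover have "(\<Sum>C\<in>Pow L - {L}. ?c C * (\<Prod>l\<in>L - C. moment {l})) = (\<Sum>C\<in>Pow L - {L}. ?b C * (\<Prod>l\<in>L - C. moment {l}))"
      using psubset by (intro sum.cong refl arg_cong2[where f = times] psubset.IH) auto
    ultimately show ?case
      using psubset(1) sum.insert_remove[of "Pow L" "\<lambda>C. ?c C * (\<Prod>l\<in>L - C. moment {l})" L]
       sum.insert_remove[of "Pow L" "\<lambda>C. ?b C * (\<Prod>l\<in>L - C. moment {l})" L]
      by simp
  qed
qed

end

section \<open>Finiteness of moments\<close>

lemma power_le_power_ennreal:
  fixes c :: ennreal
  assumes "1 \<le> c" "i \<le> j"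
  shows "c ^ i \<le> c ^ j"
proof -
  have "c ^ i * 1 \<le> c ^ i * c ^ (j - i)"
  proof (rule mult_left_mono)
    have "1 \<le> c ^ n" for n
    proof (induction n)
      case (Suc n)
      have "1 * 1 \<le> c * c ^ n" using assms(1) Suc by (intro mult_mono) auto
      then show ?case by simp
    qed simp
    then show "1 \<le> c ^ (j - i)" .
  qed simp
  then show ?thesis using assms(2) by (simp flip: power_add)
qed

text \<open>All factors are replaced by the largest of them and 1. The comparison with 1 permits
  raising the exponent from \<open>card B\<close> to \<open>k\<close>, so one power controls all
  products of at most \<open>k\<close> factors.\<close>

lemma prod_le_one_plus_sum_power:
  fixes t :: "'i \<Rightarrow> ennreal"
  assumes B: "finite B" and k: "card B \<le> k"
  shows "(\<Prod>l\<in>B. t l) \<le> 1 + (\<Sum>l\<in>B. t l ^ k)"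
proof -
  define c where "c = Max (insert 1 (t ` B))"
  have c1: "1 \<le> c" unfolding c_def using B by (intro Max_ge) auto
  have ct: "t l \<le> c" if "l \<in> B" for l unfolding c_def using B that by (intro Max_ge) auto
  have "(\<Prod>l\<in>B. t l) \<le> (\<Prod>l\<in>B. c)" using ct by (intro prod_mono_ennreal)
  also have "\<dots> \<le> c ^ k" using power_le_power_ennreal[OF c1 k] by simp
  also have "\<dots> \<le> 1 + (\<Sum>l\<in>B. t l ^ k)"
  proof -
    have "c \<in> insert 1 (t ` B)" unfolding c_def using B by (intro Max_in) auto
    then consider "c = 1" | l where "l \<in> B" "c = t l" by auto
    then show ?thesis
    proof cases
      case 2
      have "t l ^ k \<le> (\<Sum>l\<in>B. t l ^ k)" using B 2(1) by (intro member_le_sum) auto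
      also have "\<dots> \<le> 1 + \<dots>" by (simp add: add_increasing)
      finally show ?thesis using 2 by simp
    qed simp
  qed
  finally show ?thesis .
qed

text \<open>Recovers the full power from the centered one: \<open>t\<close> is at most twice the
  larger of \<open>\<bar>t - a\<bar>\<close> and \<open>e\<close>, and even \<open>k\<close> removes
  the absolute value. The constant \<open>e\<close> stands in for the mean \<open>a\<close> so that
  the bound can be the same for all truncations.\<close>

lemma power_le_two_power_sum:
  fixes t a e :: real
  assumes "0 \<le> t" "0 \<le> a" "a \<le> e" and k: "even k"
  shows "t ^ k \<le> 2 ^ k * ((t - a) ^ k + e ^ k)"
proof -
  define c where "c = max \<bar>t - a\<bar> e"
  have "t \<le> \<bar>t - a\<bar> + e" using assms by linarith
  moreover have "\<bar>t - a\<bar> \<le> c" "e \<le> c" by (auto simp: c_def)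
  ultimately have "t \<le> 2 * c" by linarith
  then have "t ^ k \<le> (2 * c) ^ k" using assms by (intro power_mono) auto
  also have "\<dots> = 2 ^ k * c ^ k" by (rule power_mult_distrib)
  also have "c ^ k \<le> \<bar>t - a\<bar> ^ k + e ^ k" using assms by (auto simp: c_def max_def)
  finally show ?thesis using power_even_abs[OF k, of "t - a"] by simp
qed

context locally_finite_poisson
begin

text \<open>Height and support are cut at once, so that every tensor of truncations is bounded with
  support of finite measure and all moments exist.\<close>

definition truncation :: "nat \<Rightarrow> ((nat \<Rightarrow> 'a) \<Rightarrow> real) \<Rightarrow> nat \<Rightarrow> (nat \<Rightarrow> 'a) \<Rightarrow> real" where
  "truncation n f N x = min \<bar>f x\<bar> (real N) * indicator (\<Pi>\<^sub>E k\<in>{..<n}. A N) x"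

lemma window_sets: "(\<Pi>\<^sub>E k\<in>J. A N) \<in> sets (PiM J (\<lambda>_. M))" if "finite J"
  using that A_sets by (intro sets_PiM_I_finite) auto

lemma truncation_nonneg: "0 \<le> truncation n f N x" by (simp add: truncation_def)

lemma truncation_le: "truncation n f N x \<le> \<bar>f x\<bar>"
  by (auto simp: truncation_def split: split_indicator)

lemma truncation_le_N: "truncation n f N x \<le> real N"
  by (auto simp: truncation_def split: split_indicator)

lemma truncation_meas:
  "f \<in> borel_measurable (PiM {..<n} (\<lambda>_. M)) \<Longrightarrow> truncation n f N \<in> borel_measurable (PiM {..<n} (\<lambda>_. M))"
  unfolding truncation_def[abs_def] using window_sets[of "{..<n}" N]
  by (intro borel_measurable_times borel_measurable_min borel_measurable_abs borel_measurable_const borel_measurable_indicator) auto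

lemma truncation_mono: "N \<le> N' \<Longrightarrow> truncation n f N x \<le> truncation n f N' x"
proof -
  assume N: "N \<le> N'"
  have "(\<Pi>\<^sub>E k\<in>{..<n}. A N) \<subseteq> (\<Pi>\<^sub>E k\<in>{..<n}. A N')" using A_inc N by (intro PiE_mono) (auto simp: incseq_def)
  then show ?thesis using N unfolding truncation_def
    by (intro mult_mono) (auto split: split_indicator)
qed

lemma truncation_eventually:
  assumes "x \<in> {..<n} \<rightarrow>\<^sub>E space M"
  shows "\<exists>N. \<forall>N'\<ge>N. truncation n f N' x = \<bar>f x\<bar>"
proof -
  have "\<forall>k\<in>{..<n}. \<exists>N. x k \<in> A N" using assms A_UN by (auto simp: PiE_iff)
  then obtain h where h: "\<forall>k\<in>{..<n}. x k \<in> A (h k)" by metis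
  define N where "N = Max (insert (nat \<lceil>\<bar>f x\<bar>\<rceil>) (h ` {..<n}))"
  have "truncation n f N' x = \<bar>f x\<bar>" if "N \<le> N'" for N'
  proof -
    have "nat \<lceil>\<bar>f x\<bar>\<rceil> \<le> N" unfolding N_def by (intro Max_ge) auto
    then have 1: "\<bar>f x\<bar> \<le> real N'" using that by linarith
    have "x k \<in> A N'" if k: "k \<in> {..<n}" for k
    proof -
      have "h k \<le> N" unfolding N_def using k by (intro Max_ge) auto
      then have "A (h k) \<subseteq> A N'" using \<open>N \<le> N'\<close> A_inc by (intro incseqD[OF A_inc]) auto
      then show ?thesis using h k by auto
    qed
    then have "x \<in> (\<Pi>\<^sub>E k\<in>{..<n}. A N')" using assms by (auto simp: PiE_iff)
    then show ?thesis using 1 by (simp add: truncation_def)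
  qed
  then show ?thesis by blast
qed

text \<open>Every block feeds an argument of some row, so a variable outside \<open>A N\<close>
  makes the truncated factor of that row vanish.\<close>

lemma tensor_truncation_bound:
  assumes L: "finite L" and \<sigma>: "\<sigma> \<in> Part_on (\<lambda>_. n) L" and y: "y \<in> extensional \<sigma>"
  shows "tensor_on (\<lambda>_. n) L (\<lambda>_. truncation n f N) \<sigma> y \<le> real N ^ card L * indicator (\<Pi>\<^sub>E B\<in>\<sigma>. A N) y"
proof (cases "y \<in> (\<Pi>\<^sub>E B\<in>\<sigma>. A N)")
  case True
  have "tensor_on (\<lambda>_. n) L (\<lambda>_. truncation n f N) \<sigma> y \<le> (\<Prod>l\<in>L. real N)"
    unfolding tensor_on_def by (intro prod_mono conjI truncation_nonneg truncation_le_N)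
  then show ?thesis using True by simp
next
  case False
  then obtain B where B: "B \<in> \<sigma>" "y B \<notin> A N" using y by (auto simp: PiE_iff)
  obtain k where k: "k \<in> B" using Part_on_block_nonempty[OF \<sigma> B(1)] by auto
  then have "k \<in> rows (\<lambda>_. n) L" using Part_on_block_subset[OF \<sigma> B(1)] by blast
  then obtain l i where li: "l \<in> L" "i < n" "k = offset (\<lambda>_. n) l + i"
    by (auto simp: rows_def mem_row_iff)
  have "partition_on (rows (\<lambda>_. n) L) \<sigma>" using \<sigma> by (simp add: Part_on_def)
  from block_eq[OF this B(1) k] have bk: "block \<sigma> (offset (\<lambda>_. n) l + i) = B" using li by simp
  let ?x = "\<lambda>i\<in>{..<n}. y (block \<sigma> (offset (\<lambda>_. n) l + i))"
  have "?x i \<notin> A N" using li bk B by simp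
  then have "?x \<notin> (\<Pi>\<^sub>E k\<in>{..<n}. A N)" using li(2) by (auto simp: PiE_iff)
  then have "truncation n f N ?x = 0" by (simp add: truncation_def)
  then have "tensor_on (\<lambda>_. n) L (\<lambda>_. truncation n f N) \<sigma> y = 0"
    unfolding tensor_on_def using L li(1) by (intro prod_zero) auto
  then show ?thesis by simp
qed

lemma truncation_moments:
  assumes f: "f \<in> borel_measurable (PiM {..<n} (\<lambda>_. M))"
  shows "U_statistic_moments P M \<eta> A (\<lambda>_. n) (\<lambda>_. truncation n f N) {..<k}"
proof
  show "finite {..<k}" by simp
  show "truncation n f N \<in> borel_measurable (PiM {..<n} (\<lambda>_. M))" by (rule truncation_meas[OF f])
  fix B assume B: "B \<subseteq> {..<k}"
  then have fB: "finite B" using finite_subset by blast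
  have abs: "\<bar>truncation n f N x\<bar> = truncation n f N x" for x using truncation_nonneg by simp
  have "(\<integral>\<^sup>+ y. ennreal (tensor_on (\<lambda>_. n) B (\<lambda>_. truncation n f N) \<sigma> y) \<partial>PiM \<sigma> (\<lambda>_. M)) < \<infinity>"
    if \<sigma>: "\<sigma> \<in> Part_on (\<lambda>_. n) B" for \<sigma>
  proof -
    have f\<sigma>: "finite \<sigma>" by (rule finite_Part_on_elem[OF fB \<sigma>])
    have "(\<integral>\<^sup>+ y. ennreal (tensor_on (\<lambda>_. n) B (\<lambda>_. truncation n f N) \<sigma> y) \<partial>PiM \<sigma> (\<lambda>_. M)) \<le>
      (\<integral>\<^sup>+ y. ennreal (real N ^ card B) * indicator (\<Pi>\<^sub>E B\<in>\<sigma>. A N) y \<partial>PiM \<sigma> (\<lambda>_. M))"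
    proof (rule nn_integral_mono)
      fix y assume "y \<in> space (PiM \<sigma> (\<lambda>_. M))"
      then have "y \<in> extensional \<sigma>" by (auto simp: space_PiM PiE_iff)
      from ennreal_leI[OF tensor_truncation_bound[OF fB \<sigma> this, of f N]]
      have "ennreal (tensor_on (\<lambda>_. n) B (\<lambda>_. truncation n f N) \<sigma> y) \<le> ennreal (real N ^ card B * indicator (\<Pi>\<^sub>E B\<in>\<sigma>. A N) y)" .
      also have "\<dots> = ennreal (real N ^ card B) * indicator (\<Pi>\<^sub>E B\<in>\<sigma>. A N) y"
        by (simp split: split_indicator)
      finally show "ennreal (tensor_on (\<lambda>_. n) B (\<lambda>_. truncation n f N) \<sigma> y) \<le> ennreal (real N ^ card B) * indicator (\<Pi>\<^sub>E B\<in>\<sigma>. A N) y" .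
    qed
    also have "\<dots> = ennreal (real N ^ card B) * emeasure (PiM \<sigma> (\<lambda>_. M)) (\<Pi>\<^sub>E B\<in>\<sigma>. A N)"
      by (rule nn_integral_cmult_indicator[OF window_sets[OF f\<sigma>]])
    also have "\<dots> = ennreal (real N ^ card B) * emeasure M (A N) ^ card \<sigma>"
      using A_sets f\<sigma> by (subst emeasure_PiM) auto
    also have "\<dots> < \<infinity>" using A_fin[of N] by (simp add: ennreal_mult_less_top power_less_top_ennreal less_top)
    finally show ?thesis .
  qed
  then have "(\<Sum>\<sigma>\<in>Part_on (\<lambda>_. n) B. \<integral>\<^sup>+ y. ennreal (tensor_on (\<lambda>_. n) B (\<lambda>_. truncation n f N) \<sigma> y) \<partial>PiM \<sigma> (\<lambda>_. M)) < \<infinity>"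
    using finite_Part_on[OF fB] by simp
  moreover have "(\<integral>\<^sup>+ \<omega>. (\<Prod>l\<in>B. \<integral>\<^sup>+ x. ennreal (truncation n f N x) \<partial>factorial_measure (\<eta> \<omega>) n) \<partial>P) =
    (\<Sum>\<sigma>\<in>Part_on (\<lambda>_. n) B. \<integral>\<^sup>+ y. ennreal (tensor_on (\<lambda>_. n) B (\<lambda>_. truncation n f N) \<sigma> y) \<partial>PiM \<sigma> (\<lambda>_. M))"
    by (rule moment_formula_nonneg[where q = "\<lambda>_. n", OF fB truncation_meas[OF f] truncation_nonneg])
  ultimately show "(\<integral>\<^sup>+ \<omega>. (\<Prod>l\<in>B. \<integral>\<^sup>+ x. ennreal \<bar>truncation n f N x\<bar> \<partial>factorial_measure (\<eta> \<omega>) n) \<partial>P) < \<infinity>"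
    unfolding abs by simp
qed

text \<open>With \<open>k\<close> identical rows the centered moment of order \<open>k\<close> is an
  instance of the centered moment formula. Only partitions in \<open>Part_bar\<close> occur there,
  which is where \<open>fin\<close> applies.\<close>

theorem even_moment_finite:
  fixes f :: "(nat \<Rightarrow> 'a) \<Rightarrow> real"
  assumes f: "integrable (PiM {..<n} (\<lambda>_. M)) f" and k: "even k"
    and fin: "\<And>\<sigma>. \<sigma> \<in> Part_bar k (\<lambda>_. n) \<Longrightarrow>
        (\<integral>\<^sup>+ y. ennreal \<bar>tensor_part k (\<lambda>_. n) (\<lambda>_. f) \<sigma> y\<bar> \<partial>PiM \<sigma> (\<lambda>_. M)) < \<infinity>"
  shows "(\<integral>\<^sup>+ \<omega>. (\<integral>\<^sup>+ x. ennreal \<bar>f x\<bar> \<partial>factorial_measure (\<eta> \<omega>) n) ^ k \<partial>P) < \<infinity>"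
proof -
  have fm: "f \<in> borel_measurable (PiM {..<n} (\<lambda>_. M))" using f by auto
  let ?T = "\<lambda>\<omega>. \<integral>\<^sup>+ x. ennreal \<bar>f x\<bar> \<partial>factorial_measure (\<eta> \<omega>) n"
  let ?t = "\<lambda>N \<omega>. \<integral>\<^sup>+ x. ennreal (truncation n f N x) \<partial>factorial_measure (\<eta> \<omega>) n"
  have tm: "(\<lambda>x. ennreal (truncation n f N x)) \<in> borel_measurable (PiM {..<n} (\<lambda>_. M))" for N
    using truncation_meas[OF fm] by simp
  have ae: "AE \<omega> in P. ?T \<omega> \<noteq> \<infinity>"
  proof (rule nn_integral_PInf_AE)
    show "?T \<in> borel_measurable P" using fm by (intro Campbell(1)) simp
    have "(\<integral>\<^sup>+ \<omega>. ?T \<omega> \<partial>P) = (\<integral>\<^sup>+ x. ennreal \<bar>f x\<bar> \<partial>PiM {..<n} (\<lambda>_. M))"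
      using fm by (intro Campbell(2)) simp
    then show "(\<integral>\<^sup>+ \<omega>. ?T \<omega> \<partial>P) \<noteq> \<infinity>" using f by (simp add: integrable_iff_bounded less_top)
  qed
  have tT: "?t N \<omega> \<le> ?T \<omega>" for N \<omega> by (intro nn_integral_mono ennreal_leI truncation_le)
  have conv: "(\<lambda>N. ?t N \<omega>) \<longlonglongrightarrow> ?T \<omega>" if \<omega>: "\<omega> \<in> space P" for \<omega>
  proof -
    have m: "(\<lambda>x. ennreal (truncation n f N x)) \<in> borel_measurable (factorial_measure (\<eta> \<omega>) n)" for N
      using tm measurable_cong_sets[OF sets_factorial_\<eta>[OF \<omega>] refl] by blast
    have "(SUP N. ennreal (truncation n f N x)) = ennreal \<bar>f x\<bar>" if x: "x \<in> space (factorial_measure (\<eta> \<omega>) n)" for x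
    proof -
      have "x \<in> {..<n} \<rightarrow>\<^sub>E space M" using x space_factorial_\<eta>[OF \<omega>] by simp
      then obtain N where N: "\<forall>N'\<ge>N. truncation n f N' x = \<bar>f x\<bar>" using truncation_eventually by blast
      show ?thesis
      proof (rule antisym)
        show "(SUP N. ennreal (truncation n f N x)) \<le> ennreal \<bar>f x\<bar>"
          by (intro SUP_least ennreal_leI truncation_le)
        show "ennreal \<bar>f x\<bar> \<le> (SUP N. ennreal (truncation n f N x))"
          using N by (intro SUP_upper2[of N]) auto
      qed
    qed
    then have "?T \<omega> = (\<integral>\<^sup>+ x. (SUP N. ennreal (truncation n f N x)) \<partial>factorial_measure (\<eta> \<omega>) n)"
      by (intro nn_integral_cong) simp
    also have "\<dots> = (SUP N. ?t N \<omega>)"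
      using truncation_mono by (intro nn_integral_monotone_convergence_SUP m) (auto simp: incseq_def le_fun_def intro!: ennreal_leI)
    finally have "?T \<omega> = (SUP N. ?t N \<omega>)" .
    moreover have "incseq (\<lambda>N. ?t N \<omega>)"
      using truncation_mono by (auto simp: incseq_def intro!: nn_integral_mono ennreal_leI)
    ultimately show ?thesis using LIMSEQ_SUP by metis
  qed
  \<comment> \<open>By \<open>Campbell\<close>, \<open>e\<close> bounds the means of all truncated
    statistics; \<open>K\<close> will bound their centered moments. Neither depends on
    \<open>N\<close>.\<close>
  define e where "e = (\<integral>x. \<bar>f x\<bar> \<partial>PiM {..<n} (\<lambda>_. M))"
  define K where "K = (\<Sum>\<sigma>\<in>Part_bar_on (\<lambda>_. n) {..<k}. \<integral>y. \<bar>tensor_on (\<lambda>_. n) {..<k} (\<lambda>_. f) \<sigma> y\<bar> \<partial>PiM \<sigma> (\<lambda>_. M))"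
  have bound: "(\<integral>\<^sup>+ \<omega>. (?t N \<omega>) ^ k \<partial>P) \<le> ennreal (2 ^ k * (K + e ^ k))" for N
  proof -
    interpret U: U_statistic_moments P M \<eta> A "\<lambda>_. n" "\<lambda>_. truncation n f N" "{..<k}"
      by (rule truncation_moments[OF fm])
    define s where "s = U_statistic \<eta> n (truncation n f N)"
    define a where "a = (\<integral>\<omega>. s \<omega> \<partial>P)"
    have s_nonneg: "0 \<le> s \<omega>" for \<omega>
      unfolding s_def U_statistic_def by (intro integral_nonneg_AE AE_I2 truncation_nonneg)
    have s_eq: "AE \<omega> in P. ennreal (s \<omega>) = ?t N \<omega>"
      using ae AE_space
    proof eventually_elim
      case (elim \<omega>)
      have "?t N \<omega> < \<infinity>" using elim by (intro le_less_trans[OF tT]) (simp add: less_top)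
      moreover have m: "truncation n f N \<in> borel_measurable (factorial_measure (\<eta> \<omega>) n)"
        using truncation_meas[OF fm] measurable_cong_sets[OF sets_factorial_\<eta>[OF elim(2)] refl] by blast
      ultimately have "integrable (factorial_measure (\<eta> \<omega>) n) (truncation n f N)"
        using truncation_nonneg by (intro integrableI_nonneg AE_I2) auto
      then show ?case unfolding s_def U_statistic_def
        using truncation_nonneg by (intro nn_integral_eq_integral[symmetric] AE_I2) auto
    qed
    \<comment> \<open>For \<open>k = 0\<close> the interpretation \<open>U\<close> has no rows, so
      measurability is taken from an instance with one row.\<close>
    have s_meas: "s \<in> borel_measurable P"
    proof (cases "k = 0")
      case True
      interpret U1: U_statistic_moments P M \<eta> A "\<lambda>_. n" "\<lambda>_. truncation n f N" "{..<1}"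
        by (rule truncation_moments[OF fm])
      show ?thesis using U1.S_meas[of 0] by (simp add: s_def)
    next
      case False
      then show ?thesis using U.S_meas[of 0] by (simp add: s_def)
    qed
    have Es: "(\<integral>\<^sup>+ \<omega>. ennreal (s \<omega>) \<partial>P) \<le> ennreal e"
    proof -
      have "(\<integral>\<^sup>+ \<omega>. ennreal (s \<omega>) \<partial>P) = (\<integral>\<^sup>+ \<omega>. ?t N \<omega> \<partial>P)" by (rule nn_integral_cong_AE[OF s_eq])
      also have "\<dots> = (\<integral>\<^sup>+ x. ennreal (truncation n f N x) \<partial>PiM {..<n} (\<lambda>_. M))" by (rule Campbell(2)[OF tm])
      also have "\<dots> \<le> (\<integral>\<^sup>+ x. ennreal \<bar>f x\<bar> \<partial>PiM {..<n} (\<lambda>_. M))" by (intro nn_integral_mono ennreal_leI truncation_le)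
      also have "\<dots> = ennreal e" unfolding e_def using f by (intro nn_integral_eq_integral) auto
      finally show ?thesis .
    qed
    have e0: "0 \<le> e" unfolding e_def by simp
    have s_int: "integrable P s"
      using Es s_nonneg s_meas by (intro integrableI_nonneg AE_I2) (auto simp: le_less_trans)
    have a: "0 \<le> a" "a \<le> e"
    proof -
      show "0 \<le> a" unfolding a_def using s_nonneg by simp
      have "ennreal a = (\<integral>\<^sup>+ \<omega>. ennreal (s \<omega>) \<partial>P)"
        unfolding a_def using s_int s_nonneg by (intro nn_integral_eq_integral[symmetric]) auto
      then have "ennreal a \<le> ennreal e" using Es by argo
      then show "a \<le> e" using e0 by (simp only: ennreal_le_iff)
    qed
    have mom: "U.moment {l} = a" for l by (simp add: U.moment_def a_def s_def)
    note cm = U.centered_moment_formula[OF order.refl]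
    have int_pow: "integrable P (\<lambda>\<omega>. (s \<omega> - a) ^ k)"
      using cm(1) by (simp add: mom s_def)
    have "(\<integral>\<omega>. (s \<omega> - a) ^ k \<partial>P) = (\<Sum>\<sigma>\<in>Part_bar_on (\<lambda>_. n) {..<k}. U.block_integral {..<k} \<sigma>)"
      using cm(2) by (simp add: mom s_def)
    also have "\<dots> \<le> K" unfolding K_def
    proof (rule sum_mono)
      fix \<sigma> assume \<sigma>: "\<sigma> \<in> Part_bar_on (\<lambda>_. n) {..<k}"
      then have \<sigma>': "\<sigma> \<in> Part_on (\<lambda>_. n) {..<k}" by (simp add: Part_bar_on_def)
      have m: "tensor_on (\<lambda>_. n) {..<k} (\<lambda>_. f) \<sigma> \<in> borel_measurable (PiM \<sigma> (\<lambda>_. M))"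
        by (rule measurable_tensor_on[OF fm \<sigma>'])
      have i: "integrable (PiM \<sigma> (\<lambda>_. M)) (tensor_on (\<lambda>_. n) {..<k} (\<lambda>_. f) \<sigma>)"
        using fin[of \<sigma>] \<sigma> m by (intro integrableI_bounded) (auto simp: Part_bar_eq tensor_part_eq)
      show "U.block_integral {..<k} \<sigma> \<le> (\<integral>y. \<bar>tensor_on (\<lambda>_. n) {..<k} (\<lambda>_. f) \<sigma> y\<bar> \<partial>PiM \<sigma> (\<lambda>_. M))"
        unfolding U.block_integral_def
      proof (rule integral_mono)
        show "integrable (PiM \<sigma> (\<lambda>_. M)) (tensor_on (\<lambda>_. n) {..<k} (\<lambda>_. truncation n f N) \<sigma>)"
          by (rule U.integrable_tensor_on[OF order.refl \<sigma>'])
        show "integrable (PiM \<sigma> (\<lambda>_. M)) (\<lambda>y. \<bar>tensor_on (\<lambda>_. n) {..<k} (\<lambda>_. f) \<sigma> y\<bar>)" using i by (rule integrable_abs)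
        show "tensor_on (\<lambda>_. n) {..<k} (\<lambda>_. truncation n f N) \<sigma> y \<le> \<bar>tensor_on (\<lambda>_. n) {..<k} (\<lambda>_. f) \<sigma> y\<bar>" for y
          unfolding tensor_on_def abs_prod by (intro prod_mono conjI truncation_nonneg truncation_le)
      qed
    qed
    finally have EK: "(\<integral>\<omega>. (s \<omega> - a) ^ k \<partial>P) \<le> K" .
    have i2: "integrable P (\<lambda>\<omega>. 2 ^ k * ((s \<omega> - a) ^ k + e ^ k))"
      using int_pow by (intro integrable_mult_right Bochner_Integration.integrable_add) auto
    have "(\<integral>\<^sup>+ \<omega>. (?t N \<omega>) ^ k \<partial>P) = (\<integral>\<^sup>+ \<omega>. ennreal (s \<omega> ^ k) \<partial>P)"
      by (rule nn_integral_cong_AE, use s_eq in eventually_elim) (metis ennreal_power s_nonneg)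
    also have "\<dots> \<le> (\<integral>\<^sup>+ \<omega>. ennreal (2 ^ k * ((s \<omega> - a) ^ k + e ^ k)) \<partial>P)"
      using power_le_two_power_sum[OF s_nonneg a k] by (intro nn_integral_mono ennreal_leI)
    also have "\<dots> = ennreal (\<integral>\<omega>. 2 ^ k * ((s \<omega> - a) ^ k + e ^ k) \<partial>P)"
      using i2 k e0 by (intro nn_integral_eq_integral AE_I2) (auto simp: zero_le_even_power)
    also have "(\<integral>\<omega>. 2 ^ k * ((s \<omega> - a) ^ k + e ^ k) \<partial>P) = 2 ^ k * ((\<integral>\<omega>. (s \<omega> - a) ^ k \<partial>P) + e ^ k)"
      using int_pow by (simp add: prob_space)
    also have "ennreal \<dots> \<le> ennreal (2 ^ k * (K + e ^ k))"
      using EK by (intro ennreal_leI mult_left_mono) auto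
    finally show ?thesis .
  qed
  \<comment> \<open>Fatou passes the uniform bound to the limit. The pathwise limit of the powers is
    taken in the reals, \<open>?T\<close> being almost surely finite.\<close>
  have "(\<integral>\<^sup>+ \<omega>. (?T \<omega>) ^ k \<partial>P) \<le> (\<integral>\<^sup>+ \<omega>. liminf (\<lambda>N. (?t N \<omega>) ^ k) \<partial>P)"
  proof (rule nn_integral_mono_AE, use ae AE_space in eventually_elim)
    fix \<omega> assume \<omega>: "?T \<omega> \<noteq> \<infinity>" "\<omega> \<in> space P"
    define r where "r = enn2real (?T \<omega>)"
    have tr: "?t N \<omega> = ennreal (enn2real (?t N \<omega>))" for N
      using \<omega>(1) by (intro ennreal_enn2real[symmetric] le_less_trans[OF tT]) (simp add: less_top)
    have Tr: "?T \<omega> = ennreal r" unfolding r_def using \<omega>(1) by (simp add: less_top)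
    have "(\<lambda>N. enn2real (?t N \<omega>)) \<longlonglongrightarrow> r"
      using conv[OF \<omega>(2)] unfolding Tr by (intro tendsto_enn2real) (simp_all add: r_def)
    then have "(\<lambda>N. ennreal (enn2real (?t N \<omega>) ^ k)) \<longlonglongrightarrow> ennreal (r ^ k)"
      by (intro tendsto_ennrealI tendsto_power)
    moreover have "ennreal (enn2real (?t N \<omega>) ^ k) = (?t N \<omega>) ^ k" for N
      by (subst (2) tr) (simp add: ennreal_power)
    moreover have "ennreal (r ^ k) = (?T \<omega>) ^ k" unfolding Tr by (simp add: ennreal_power r_def)
    ultimately have "(\<lambda>N. (?t N \<omega>) ^ k) \<longlonglongrightarrow> (?T \<omega>) ^ k" by simp
    then show "(?T \<omega>) ^ k \<le> liminf (\<lambda>N. (?t N \<omega>) ^ k)"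
      by (simp add: lim_imp_Liminf)
  qed
  also have "\<dots> \<le> liminf (\<lambda>N. \<integral>\<^sup>+ \<omega>. (?t N \<omega>) ^ k \<partial>P)"
    by (intro nn_integral_liminf borel_measurable_power_ennreal Campbell(1)[OF tm])
  also have "\<dots> \<le> ennreal (2 ^ k * (K + e ^ k))"
    using bound by (intro Liminf_le) auto
  finally show ?thesis by (simp add: le_less_trans)
qed

end

section \<open>Cumulants from joint moments\<close>

text \<open>The Leibniz rule for \<open>\<partial>\<phi> = (\<partial> ln \<phi>) \<phi>\<close> expresses the mixed derivatives \<open>\<partial>\<^sub>B ln \<phi>\<close> through
  \<open>F B = \<partial>\<^sub>B \<phi>\<close>: the first differentiation, in the direction \<open>Max B\<close>, always hits the factor \<open>\<partial> ln \<phi>\<close>.\<close>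

function log_derivative :: "(nat set \<Rightarrow> complex) \<Rightarrow> nat set \<Rightarrow> complex" where
  "log_derivative F B = (if finite B \<and> B \<noteq> {} then
     (F B - (\<Sum>C\<in>{C. C \<subset> B \<and> Max B \<in> C}. log_derivative F C * F (B - C))) / F {} else 0)"
  by pat_completeness auto
termination
  by (relation "Wellfounded.measure (\<lambda>(F, B). card B)") (auto intro: psubset_card_mono)

declare log_derivative.simps [simp del]

lemma log_derivative_eq:
  "finite B \<Longrightarrow> B \<noteq> {} \<Longrightarrow> log_derivative F B =
     (F B - (\<Sum>C\<in>{C. C \<subset> B \<and> Max B \<in> C}. log_derivative F C * F (B - C))) / F {}"
  by (subst log_derivative.simps) simp

lemma log_derivative_singleton: "log_derivative F {l} = F {l} / F {}"
proof -
  have "{C. C \<subset> {l} \<and> l \<in> C} = {}" by auto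
  moreover have "log_derivative F {l} = (F {l} - (\<Sum>C\<in>{C. C \<subset> {l} \<and> l \<in> C}. log_derivative F C * F ({l} - C))) / F {}"
    using log_derivative_eq[of "{l}" F] by (simp only: Max_singleton finite.emptyI finite_insert simp_thms insert_not_empty)
  ultimately show ?thesis by (simp only: sum.empty diff_zero)
qed

text \<open>A proper subset of \<open>insert k B\<close> containing \<open>Max B\<close> is
  \<open>B\<close> itself, a proper subset of \<open>B\<close>, or such a subset with
  \<open>k\<close> added. The right side is what the quotient rule produces from the recursion for
  \<open>B\<close>; \<open>k < Max B\<close> keeps the distinguished element unchanged.\<close>

lemma log_derivative_insert:
  assumes B: "finite B" "B \<noteq> {}" and k: "k \<notin> B" "k < Max B"
  shows "log_derivative F (insert k B) =
     (F (insert k B) - (\<Sum>C\<in>{C. C \<subset> B \<and> Max B \<in> C}.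
        log_derivative F (insert k C) * F (B - C) + log_derivative F C * F (insert k (B - C)))
      - log_derivative F B * F {k}) / F {}"
proof -
  let ?l = "Max B" and ?X = "{C. C \<subset> B \<and> Max B \<in> C}" and ?G = "\<lambda>C. log_derivative F C * F (insert k B - C)"
  have lB: "?l \<in> B" using B by (rule Max_in)
  have Mx: "Max (insert k B) = ?l" using B k by (simp add: max_def)
  have fX: "finite ?X" using B by (auto intro: finite_subset[of _ "Pow B"])
  have sub: "{C. C \<subset> insert k B \<and> ?l \<in> C} = insert B ?X \<union> insert k ` ?X"
  proof (intro set_eqI iffI)
    fix C assume "C \<in> {C. C \<subset> insert k B \<and> ?l \<in> C}"
    then have C: "C \<subset> insert k B" "?l \<in> C" by auto
    show "C \<in> insert B ?X \<union> insert k ` ?X"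
    proof (cases "k \<in> C")
      case True
      have "C - {k} \<in> ?X" using C True lB k(1) by auto
      then have "insert k (C - {k}) \<in> insert k ` ?X" by (rule imageI)
      then show ?thesis using True by (simp add: insert_absorb)
    next
      case False
      then show ?thesis using C by blast
    qed
  next
    fix C assume "C \<in> insert B ?X \<union> insert k ` ?X"
    then show "C \<in> {C. C \<subset> insert k B \<and> ?l \<in> C}" using k lB by auto
  qed
  have inj: "inj_on (insert k) ?X" using k(1) by (auto simp: inj_on_def)
  have "(\<Sum>C\<in>{C. C \<subset> insert k B \<and> ?l \<in> C}. ?G C) = (\<Sum>C\<in>insert B ?X. ?G C) + (\<Sum>C\<in>insert k ` ?X. ?G C)"
    unfolding sub using fX k(1) by (intro sum.union_disjoint) auto
  also have "(\<Sum>C\<in>insert B ?X. ?G C) = ?G B + (\<Sum>C\<in>?X. ?G C)" using fX by (intro sum.insert) auto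
  also have "?G B = log_derivative F B * F {k}" using k(1) by (simp add: insert_Diff_if)
  also have "(\<Sum>C\<in>?X. ?G C) = (\<Sum>C\<in>?X. log_derivative F C * F (insert k (B - C)))"
    using k(1) by (intro sum.cong refl) (auto simp: insert_Diff_if)
  also have "(\<Sum>C\<in>insert k ` ?X. ?G C) = (\<Sum>C\<in>?X. log_derivative F (insert k C) * F (B - C))"
    using k(1) by (subst sum.reindex[OF inj]) (auto intro!: sum.cong)
  finally show ?thesis
    using B by (simp add: log_derivative_eq Mx sum.distrib algebra_simps)
qed

text \<open>\<open>log_derivative\<close> follows the recursion \<open>rec\<close> with
  \<open>l = Max B\<close>, up to powers of the imaginary unit. The cardinalities of
  \<open>C\<close> and \<open>B - C\<close> add up to that of \<open>B\<close>, so the common factor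
  \<open>\<i> ^ card B\<close> splits off.\<close>

lemma log_derivative_moments:
  fixes mom K :: "nat set \<Rightarrow> real"
  assumes F: "\<And>B. B \<subseteq> R \<Longrightarrow> F B = \<i> ^ card B * complex_of_real (mom B)" and m0: "mom {} = 1"
    and rec: "\<And>B l. B \<subseteq> R \<Longrightarrow> l \<in> B \<Longrightarrow> mom B = (\<Sum>C\<in>{C. C \<subseteq> B \<and> l \<in> C}. K C * mom (B - C))"
    and B: "finite B" "B \<subseteq> R" "B \<noteq> {}"
  shows "log_derivative F B = \<i> ^ card B * complex_of_real (K B)"
  using B
proof (induction B rule: finite_psubset_induct)
  case (psubset B)
  let ?X = "{C. C \<subset> B \<and> Max B \<in> C}"
  have fX: "finite ?X" using psubset by (auto intro: finite_subset[of _ "Pow B"])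
  have lB: "Max B \<in> B" using psubset by (intro Max_in) auto
  have "{C. C \<subseteq> B \<and> Max B \<in> C} = insert B ?X" using lB by auto
  then have "mom B = K B + (\<Sum>C\<in>?X. K C * mom (B - C))"
    using rec[OF psubset.prems(1) lB] fX m0 by simp
  then have "complex_of_real (mom B) = complex_of_real (K B) + (\<Sum>C\<in>?X. complex_of_real (K C) * complex_of_real (mom (B - C)))"
    by simp
  moreover have "(\<Sum>C\<in>?X. log_derivative F C * F (B - C)) = (\<Sum>C\<in>?X. \<i> ^ card B * (complex_of_real (K C) * complex_of_real (mom (B - C))))"
  proof (intro sum.cong refl)
    fix C assume C: "C \<in> ?X"
    have "log_derivative F C = \<i> ^ card C * complex_of_real (K C)" using C psubset by (intro psubset.IH) auto
    moreover have "B - C \<subseteq> R" using psubset.prems by auto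
    then have "F (B - C) = \<i> ^ card (B - C) * complex_of_real (mom (B - C))" by (rule F)
    moreover have "card B = card C + card (B - C)"
      using C psubset(1) by (metis (no_types, lifting) card_Diff_subset card_mono finite_subset le_add_diff_inverse mem_Collect_eq psubset_imp_subset)
    ultimately show "log_derivative F C * F (B - C) = \<i> ^ card B * (complex_of_real (K C) * complex_of_real (mom (B - C)))"
      by (simp add: power_add)
  qed
  ultimately show ?case
    using psubset.prems F[of B] F[of "{}"] m0 psubset.hyps
    by (simp add: log_derivative_eq flip: sum_distrib_left) (simp add: algebra_simps)
qed

text \<open>Only products of distinct variables are required to be integrable; they suffice because
  a mixed derivative uses each direction once.\<close>

locale joint_moments = prob_space Q for Q :: "'w measure" +
  fixes X :: "nat \<Rightarrow> 'w \<Rightarrow> real" and m :: nat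
  assumes prod_integrable: "\<And>B. B \<subseteq> {..<m} \<Longrightarrow> integrable Q (\<lambda>\<omega>. \<Prod>l\<in>B. X l \<omega>)"
begin

section \<open>Differentiation of the characteristic function under the integral\<close>

definition lin :: "(nat \<Rightarrow> real) \<Rightarrow> 'w \<Rightarrow> real" where
  "lin t \<omega> = (\<Sum>j<m. t j * X j \<omega>)"

text \<open>\<open>cf {}\<close> is the characteristic function; \<open>cf B\<close> will turn out
  to be its mixed derivative in the directions of \<open>B\<close>.\<close>

definition cf :: "nat set \<Rightarrow> (nat \<Rightarrow> real) \<Rightarrow> complex" where
  "cf B t = (\<integral>\<omega>. (\<Prod>l\<in>B. \<i> * complex_of_real (X l \<omega>)) * iexp (lin t \<omega>) \<partial>Q)"

lemma X_int: "l < m \<Longrightarrow> integrable Q (X l)"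
  using prod_integrable[of "{l}"] by simp

lemma X_meas: "l < m \<Longrightarrow> X l \<in> borel_measurable Q"
  using X_int by auto

lemma lin_meas: "lin t \<in> borel_measurable Q"
  unfolding lin_def[abs_def] using X_meas by (intro borel_measurable_sum borel_measurable_times) auto

lemma prodX_meas: "B \<subseteq> {..<m} \<Longrightarrow> (\<lambda>\<omega>. \<Prod>l\<in>B. \<i> * complex_of_real (X l \<omega>)) \<in> borel_measurable Q"
  using X_meas by (intro borel_measurable_prod borel_measurable_times borel_measurable_const borel_measurable_of_real) auto

lemma iexp_lin_meas: "(\<lambda>\<omega>. iexp (lin t \<omega>)) \<in> borel_measurable Q"
  using lin_meas[of t] by measurable

lemma norm_prodX: "norm (\<Prod>l\<in>B. \<i> * complex_of_real (X l \<omega>)) = \<bar>\<Prod>l\<in>B. X l \<omega>\<bar>"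
  by (simp add: prod_norm[symmetric] norm_mult abs_prod)

lemma cf_integrable:
  assumes B: "B \<subseteq> {..<m}"
  shows "integrable Q (\<lambda>\<omega>. (\<Prod>l\<in>B. \<i> * complex_of_real (X l \<omega>)) * iexp (lin t \<omega>))"
proof (rule Bochner_Integration.integrable_bound[OF prod_integrable[OF B]])
  show "(\<lambda>\<omega>. (\<Prod>l\<in>B. \<i> * complex_of_real (X l \<omega>)) * iexp (lin t \<omega>)) \<in> borel_measurable Q"
    by (intro borel_measurable_times prodX_meas[OF B] iexp_lin_meas)
qed (simp add: norm_mult norm_prodX)

lemma lin_upd:
  assumes k: "k < m"
  shows "lin (u(k := s)) \<omega> = lin (u(k := s0)) \<omega> + (s - s0) * X k \<omega>"
proof -
  have "lin (u(k := s)) \<omega> = s * X k \<omega> + (\<Sum>j\<in>{..<m} - {k}. u j * X j \<omega>)" for s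
    unfolding lin_def using k by (subst sum.remove[of _ k]) (auto intro!: sum.cong)
  then show ?thesis by (simp add: algebra_simps)
qed

text \<open>Dominated convergence for the first-order remainder of \<open>iexp\<close>. Its linear
  bound gives a majorant whose integrability is the moment over \<open>insert k B\<close>; its
  quadratic bound gives pointwise convergence, but as a majorant it would require a second moment in
  \<open>X k\<close>.\<close>

lemma cf_deriv:
  assumes B: "B \<subseteq> {..<m}" and k: "k < m" "k \<notin> B"
  shows "((\<lambda>s. cf B (u(k := s))) has_vector_derivative cf (insert k B) (u(k := s0))) (at s0)"
proof -
  let ?p = "\<lambda>\<omega>. \<Prod>l\<in>B. \<i> * complex_of_real (X l \<omega>)"
  let ?r = "\<lambda>h \<omega>. \<bar>\<Prod>l\<in>B. X l \<omega>\<bar> * (norm (iexp (h * X k \<omega>) - 1 - \<i> * complex_of_real (h * X k \<omega>)) / \<bar>h\<bar>)"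
  have fB: "finite B" using B finite_subset by blast
  have kB: "insert k B \<subseteq> {..<m}" using B k by auto
  have diff: "cf B (u(k := s0 + h)) - cf B (u(k := s0)) - h *\<^sub>R cf (insert k B) (u(k := s0)) =
    (\<integral>\<omega>. ?p \<omega> * iexp (lin (u(k := s0)) \<omega>) * (iexp (h * X k \<omega>) - 1 - \<i> * complex_of_real (h * X k \<omega>)) \<partial>Q)" for h
  proof -
    have "cf B (u(k := s0 + h)) - cf B (u(k := s0)) - h *\<^sub>R cf (insert k B) (u(k := s0)) =
      (\<integral>\<omega>. ?p \<omega> * iexp (lin (u(k := s0 + h)) \<omega>) - ?p \<omega> * iexp (lin (u(k := s0)) \<omega>)
        - h *\<^sub>R ((\<Prod>l\<in>insert k B. \<i> * complex_of_real (X l \<omega>)) * iexp (lin (u(k := s0)) \<omega>)) \<partial>Q)"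
      unfolding cf_def using cf_integrable[OF B] cf_integrable[OF kB] by simp
    also have "\<dots> = (\<integral>\<omega>. ?p \<omega> * iexp (lin (u(k := s0)) \<omega>) * (iexp (h * X k \<omega>) - 1 - \<i> * complex_of_real (h * X k \<omega>)) \<partial>Q)"
    proof (intro Bochner_Integration.integral_cong refl)
      fix \<omega>
      have "iexp (lin (u(k := s0 + h)) \<omega>) = iexp (lin (u(k := s0)) \<omega>) * iexp (h * X k \<omega>)"
        unfolding lin_upd[OF k(1), of u "s0 + h" \<omega> s0] by (simp add: exp_add ring_distribs)
      moreover have "(\<Prod>l\<in>insert k B. \<i> * complex_of_real (X l \<omega>)) = \<i> * complex_of_real (X k \<omega>) * ?p \<omega>"
        using fB k(2) by simp
      ultimately show "?p \<omega> * iexp (lin (u(k := s0 + h)) \<omega>) - ?p \<omega> * iexp (lin (u(k := s0)) \<omega>)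
        - h *\<^sub>R ((\<Prod>l\<in>insert k B. \<i> * complex_of_real (X l \<omega>)) * iexp (lin (u(k := s0)) \<omega>)) =
        ?p \<omega> * iexp (lin (u(k := s0)) \<omega>) * (iexp (h * X k \<omega>) - 1 - \<i> * complex_of_real (h * X k \<omega>))"
        by (simp add: scaleR_conv_of_real algebra_simps)
    qed
    finally show ?thesis .
  qed
  have i1: "norm (iexp y - 1 - \<i> * complex_of_real y) \<le> 2 * \<bar>y\<bar>" for y
    using iexp_approx2[of y 1] by (simp add: algebra_simps)
  have i2: "norm (iexp y - 1 - \<i> * complex_of_real y) \<le> \<bar>y\<bar>\<^sup>2 / 2" for y
    using iexp_approx1[of y 1] by (simp add: algebra_simps power2_eq_square)
  have Xk: "X k \<in> borel_measurable Q" by (rule X_meas[OF k(1)])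
  have pm: "(\<lambda>\<omega>. \<Prod>l\<in>B. X l \<omega>) \<in> borel_measurable Q" using prod_integrable[OF B] by auto
  have rm: "?r h \<in> borel_measurable Q" for h using Xk pm by measurable
  have bnd: "norm (?r h \<omega>) \<le> 2 * \<bar>\<Prod>l\<in>insert k B. X l \<omega>\<bar>" if "h \<noteq> 0" for h \<omega>
  proof -
    have "norm (iexp (h * X k \<omega>) - 1 - \<i> * complex_of_real (h * X k \<omega>)) / \<bar>h\<bar> \<le> 2 * \<bar>h * X k \<omega>\<bar> / \<bar>h\<bar>"
      by (intro divide_right_mono i1) simp
    also have "\<dots> = 2 * \<bar>X k \<omega>\<bar>" using that by (simp add: abs_mult)
    finally have "?r h \<omega> \<le> \<bar>\<Prod>l\<in>B. X l \<omega>\<bar> * (2 * \<bar>X k \<omega>\<bar>)" by (intro mult_left_mono) auto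
    then show ?thesis using fB k(2) by (simp add: abs_mult algebra_simps)
  qed
  have dom: "integrable Q (\<lambda>\<omega>. 2 * \<bar>\<Prod>l\<in>insert k B. X l \<omega>\<bar>)"
    using prod_integrable[OF kB] by (intro integrable_mult_right integrable_abs)
  have lim: "((\<lambda>h. \<integral>\<omega>. ?r h \<omega> \<partial>Q) \<longlongrightarrow> 0) (at 0)"
    unfolding tendsto_at_iff_sequentially
  proof (intro allI impI)
    fix h :: "nat \<Rightarrow> real" assume h: "\<forall>i. h i \<in> UNIV - {0}" "h \<longlonglongrightarrow> 0"
    have "(\<lambda>i. \<integral>\<omega>. ?r (h i) \<omega> \<partial>Q) \<longlonglongrightarrow> (\<integral>\<omega>. 0 \<partial>Q)"
    proof (rule integral_dominated_convergence[OF _ rm dom])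
      show "AE \<omega> in Q. (\<lambda>i. ?r (h i) \<omega>) \<longlonglongrightarrow> 0"
      proof (rule AE_I2)
        fix \<omega>
        define z where "z = (\<lambda>i. norm (iexp (h i * X k \<omega>) - 1 - \<i> * complex_of_real (h i * X k \<omega>)) / \<bar>h i\<bar>)"
        have z: "norm (z i) \<le> \<bar>h i\<bar> * (\<bar>X k \<omega>\<bar>\<^sup>2 / 2)" for i
        proof -
          have "z i \<le> (\<bar>h i * X k \<omega>\<bar>\<^sup>2 / 2) / \<bar>h i\<bar>"
            unfolding z_def by (intro divide_right_mono i2) simp
          also have "\<dots> = \<bar>h i\<bar> * (\<bar>X k \<omega>\<bar>\<^sup>2 / 2)" using h(1) by (simp add: abs_mult power2_eq_square field_simps)
          finally show ?thesis by (simp add: z_def)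
        qed
        have "(\<lambda>i. \<bar>h i\<bar> * (\<bar>X k \<omega>\<bar>\<^sup>2 / 2)) \<longlonglongrightarrow> 0"
          using h(2) by (intro tendsto_mult_left_zero tendsto_rabs_zero)
        from Lim_null_comparison[OF eventuallyI[of "\<lambda>i. norm (z i) \<le> \<bar>h i\<bar> * (\<bar>X k \<omega>\<bar>\<^sup>2 / 2)", OF z] this]
        have "z \<longlonglongrightarrow> 0" .
        then show "(\<lambda>i. ?r (h i) \<omega>) \<longlonglongrightarrow> 0" unfolding z_def by (rule tendsto_mult_right_zero)
      qed
      show "AE \<omega> in Q. norm (?r (h i) \<omega>) \<le> 2 * \<bar>\<Prod>l\<in>insert k B. X l \<omega>\<bar>" for i
        using bnd h(1) by (intro AE_I2) auto
    qed simp
    then show "((\<lambda>h. \<integral>\<omega>. ?r h \<omega> \<partial>Q) \<circ> h) \<longlonglongrightarrow> 0" by (simp add: comp_def)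
  qed
  have "((\<lambda>h. norm (cf B (u(k := s0 + h)) - cf B (u(k := s0)) - h *\<^sub>R cf (insert k B) (u(k := s0))) / norm h) \<longlongrightarrow> 0) (at 0)"
  proof (rule Lim_null_comparison[OF _ lim])
    show "\<forall>\<^sub>F h in at 0. norm (norm (cf B (u(k := s0 + h)) - cf B (u(k := s0)) - h *\<^sub>R cf (insert k B) (u(k := s0))) / norm h) \<le> (\<integral>\<omega>. ?r h \<omega> \<partial>Q)"
      unfolding eventually_at_filter
    proof (intro always_eventually allI impI)
      fix h :: real assume h: "h \<noteq> 0"
      let ?d = "\<lambda>\<omega>. ?p \<omega> * iexp (lin (u(k := s0)) \<omega>) * (iexp (h * X k \<omega>) - 1 - \<i> * complex_of_real (h * X k \<omega>))"
      have "norm (\<integral>\<omega>. ?d \<omega> \<partial>Q) \<le> (\<integral>\<omega>. norm (?d \<omega>) \<partial>Q)" by (rule integral_norm_bound)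
      also have "\<dots> = (\<integral>\<omega>. \<bar>h\<bar> * ?r h \<omega> \<partial>Q)"
        using h by (intro Bochner_Integration.integral_cong refl) (simp add: norm_mult norm_prodX)
      also have "\<dots> = \<bar>h\<bar> * (\<integral>\<omega>. ?r h \<omega> \<partial>Q)" by (rule integral_mult_right_zero)
      finally have "norm (\<integral>\<omega>. ?d \<omega> \<partial>Q) / \<bar>h\<bar> \<le> (\<integral>\<omega>. ?r h \<omega> \<partial>Q)" using h by (simp add: field_simps)
      then show "norm (norm (cf B (u(k := s0 + h)) - cf B (u(k := s0)) - h *\<^sub>R cf (insert k B) (u(k := s0))) / norm h) \<le> (\<integral>\<omega>. ?r h \<omega> \<partial>Q)"
        unfolding diff by simp
    qed
  qed
  then show ?thesis
    unfolding has_vector_derivative_def has_derivative_at by (auto intro: bounded_linear_scaleR_left)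
qed

abbreviation "logd B t \<equiv> log_derivative (\<lambda>B. cf B t) B"

text \<open>Induction along the recursion: all \<open>C\<close> in the sum contain
  \<open>Max B\<close>, hence have the same maximum, and the induction hypothesis applies. The
  quotient rule then produces the right side of \<open>log_derivative_insert\<close>.\<close>

lemma logd_deriv:
  assumes "finite B" "B \<subseteq> {..<m}" "B \<noteq> {}" "k \<notin> B" "k < Max B" "cf {} (u(k := s0)) \<noteq> 0"
  shows "((\<lambda>s. logd B (u(k := s))) has_vector_derivative logd (insert k B) (u(k := s0))) (at s0)"
  using assms
proof (induction B rule: finite_psubset_induct)
  case (psubset B)
  let ?X = "{C. C \<subset> B \<and> Max B \<in> C}" and ?u = "\<lambda>s. u(k := s)"
  let ?N = "\<lambda>s. cf B (?u s) - (\<Sum>C\<in>?X. logd C (?u s) * cf (B - C) (?u s))"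
  let ?N' = "cf (insert k B) (?u s0) - (\<Sum>C\<in>?X. logd (insert k C) (?u s0) * cf (B - C) (?u s0)
    + logd C (?u s0) * cf (insert k (B - C)) (?u s0))"
  have MB: "Max B \<in> B" using psubset by (intro Max_in) auto
  have km: "k < m" using psubset.prems MB by auto
  have IH: "((\<lambda>s. logd C (?u s)) has_vector_derivative logd (insert k C) (?u s0)) (at s0)" if C: "C \<in> ?X" for C
  proof -
    have "Max C = Max B"
      using C psubset.hyps by (intro Max_eqI) (auto intro: finite_subset Max_ge)
    then show ?thesis using C psubset.prems by (intro psubset.IH) auto
  qed
  have N: "(?N has_vector_derivative ?N') (at s0)"
  proof (intro has_vector_derivative_diff has_vector_derivative_sum)
    show "((\<lambda>s. cf B (?u s)) has_vector_derivative cf (insert k B) (?u s0)) (at s0)"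
      using psubset.prems km by (intro cf_deriv) auto
    fix C assume C: "C \<in> ?X"
    have D: "((\<lambda>s. cf (B - C) (?u s)) has_vector_derivative cf (insert k (B - C)) (?u s0)) (at s0)"
      using psubset.prems km by (intro cf_deriv) auto
    from has_vector_derivative_mult[OF IH[OF C] D]
    show "((\<lambda>s. logd C (?u s) * cf (B - C) (?u s)) has_vector_derivative
       logd (insert k C) (?u s0) * cf (B - C) (?u s0) + logd C (?u s0) * cf (insert k (B - C)) (?u s0)) (at s0)"
      by (simp add: add.commute)
  qed
  have D0: "((\<lambda>s. cf {} (?u s)) has_vector_derivative cf {k} (?u s0)) (at s0)"
    using km by (intro cf_deriv) auto
  have nz: "cf {} (?u s0) \<noteq> 0" using psubset.prems(5) by (simp add: fun_upd_def)
  have lB: "logd B (?u s) = ?N s / cf {} (?u s)" for s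
    using psubset.hyps psubset.prems by (intro log_derivative_eq) auto
  have "((\<lambda>s. ?N s / cf {} (?u s)) has_derivative
     (\<lambda>h. ((h *\<^sub>R ?N') * cf {} (?u s0) - ?N s0 * (h *\<^sub>R cf {k} (?u s0))) / (cf {} (?u s0) * cf {} (?u s0)))) (at s0)"
    using N D0 nz unfolding has_vector_derivative_def by (rule has_derivative_divide')
  moreover have "((h *\<^sub>R ?N') * cf {} (?u s0) - ?N s0 * (h *\<^sub>R cf {k} (?u s0))) / (cf {} (?u s0) * cf {} (?u s0)) =
     h *\<^sub>R logd (insert k B) (?u s0)" for h
  proof -
    have ins: "logd (insert k B) (?u s0) = (?N' - logd B (?u s0) * cf {k} (?u s0)) / cf {} (?u s0)"
      by (rule log_derivative_insert[where F = "\<lambda>B. cf B (?u s0)", OF psubset.hyps psubset.prems(2-4)])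
    define N1 N0 F0 Fk where "N1 = ?N'" and "N0 = ?N s0" and "F0 = cf {} (?u s0)" and "Fk = cf {k} (?u s0)"
    have "F0 \<noteq> 0" using nz by (simp add: F0_def)
    then have "((h *\<^sub>R N1) * F0 - N0 * (h *\<^sub>R Fk)) / (F0 * F0) = h *\<^sub>R ((N1 - N0 / F0 * Fk) / F0)"
      by (simp add: scaleR_conv_of_real field_simps)
    then show ?thesis unfolding ins lB N1_def N0_def F0_def Fk_def .
  qed
  ultimately show ?case unfolding lB has_vector_derivative_def by simp
qed

text \<open>On this set the characteristic function differs from 1 by less than 1, so it is nonzero
  and avoids the cut of the principal logarithm. Only finitely many coordinates enter, so the set is
  open in the product topology.\<close>

definition nbhd :: "(nat \<Rightarrow> real) set" where
  "nbhd = {t. (\<Sum>j<m. \<bar>t j\<bar> * (\<integral>\<omega>. \<bar>X j \<omega>\<bar> \<partial>Q)) < 1}"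

lemma open_nbhd: "open nbhd"
  unfolding nbhd_def by (intro open_Collect_less continuous_intros continuous_on_product_coordinates)

lemma open_nbhd_line: "open {s. u(k := s) \<in> nbhd}"
proof -
  have "continuous_on UNIV (\<lambda>s. \<bar>(u(k := s)) j\<bar> * (\<integral>\<omega>. \<bar>X j \<omega>\<bar> \<partial>Q))" for j
    by (cases "j = k") (auto intro!: continuous_intros)
  then have "continuous_on UNIV (\<lambda>s. \<Sum>j<m. \<bar>(u(k := s)) j\<bar> * (\<integral>\<omega>. \<bar>X j \<omega>\<bar> \<partial>Q))" by (intro continuous_on_sum)
  then show ?thesis unfolding nbhd_def mem_Collect_eq by (intro open_Collect_less continuous_on_const)
qed

lemma zero_in_nbhd: "(\<lambda>_. 0) \<in> nbhd" by (simp add: nbhd_def)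

lemma cf_nbhd:
  assumes "t \<in> nbhd"
  shows "0 < Re (cf {} t)"
proof -
  have ci: "integrable Q (\<lambda>\<omega>. iexp (lin t \<omega>))" using cf_integrable[of "{}" t] by simp
  have "cf {} t - 1 = (\<integral>\<omega>. iexp (lin t \<omega>) - 1 \<partial>Q)"
    unfolding cf_def using ci by (simp add: prob_space)
  also have "norm \<dots> \<le> (\<integral>\<omega>. norm (iexp (lin t \<omega>) - 1) \<partial>Q)" by (rule integral_norm_bound)
  also have "\<dots> \<le> (\<integral>\<omega>. (\<Sum>j<m. \<bar>t j\<bar> * \<bar>X j \<omega>\<bar>) \<partial>Q)"
  proof (rule integral_mono)
    show "integrable Q (\<lambda>\<omega>. norm (iexp (lin t \<omega>) - 1))" using ci by (intro integrable_norm) auto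
    show "integrable Q (\<lambda>\<omega>. \<Sum>j<m. \<bar>t j\<bar> * \<bar>X j \<omega>\<bar>)"
      using X_int by (intro Bochner_Integration.integrable_sum integrable_mult_right integrable_abs) auto
    fix \<omega>
    have "norm (iexp (lin t \<omega>) - 1) \<le> \<bar>lin t \<omega>\<bar>" using iexp_approx1[of "lin t \<omega>" 0] by simp
    also have "\<dots> \<le> (\<Sum>j<m. \<bar>t j\<bar> * \<bar>X j \<omega>\<bar>)" unfolding lin_def by (rule order.trans[OF sum_abs]) (simp add: abs_mult)
    finally show "norm (iexp (lin t \<omega>) - 1) \<le> (\<Sum>j<m. \<bar>t j\<bar> * \<bar>X j \<omega>\<bar>)" .
  qed
  also have "\<dots> = (\<Sum>j<m. \<bar>t j\<bar> * (\<integral>\<omega>. \<bar>X j \<omega>\<bar> \<partial>Q))"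
    using X_int by (subst Bochner_Integration.integral_sum) (auto intro: integrable_mult_right integrable_abs)
  also have "\<dots> < 1" using assms by (simp add: nbhd_def)
  finally have "norm (cf {} t - 1) < 1" .
  moreover have "\<bar>Re (cf {} t - 1)\<bar> \<le> norm (cf {} t - 1)" by (rule abs_Re_le_cmod)
  ultimately show ?thesis by simp
qed

text \<open>\<open>mixed_partial\<close> uses the highest remaining direction first, so the
  directions already used form \<open>{n..<m}\<close> and each new one lies below their maximum.
  \<open>n < m\<close> excludes the very start: \<open>log_derivative\<close> of the empty set is 0,
  not the logarithm.\<close>

lemma mixed_partial_logd:
  assumes "n < m" "\<And>t. t \<in> nbhd \<Longrightarrow> g t = logd {n..<m} t"
  shows "mixed_partial_exists n g (\<lambda>_. 0) \<and> mixed_partial n g (\<lambda>_. 0) = logd {..<m} (\<lambda>_. 0)"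
  using assms
proof (induction n arbitrary: g)
  case 0
  then show ?case using zero_in_nbhd by (simp add: atLeast0LessThan)
next
  case (Suc n)
  have "((\<lambda>s. g (u(n := s))) has_vector_derivative logd {n..<m} u) (at (u n))" if u: "u \<in> nbhd" for u
  proof -
    have ins: "insert n {Suc n..<m} = {n..<m}" using Suc.prems(1) by auto
    have "Max {Suc n..<m} \<in> {Suc n..<m}" using Suc.prems(1) by (intro Max_in) auto
    then have "n < Max {Suc n..<m}" by simp
    moreover have "cf {} (u(n := u n)) \<noteq> 0" using cf_nbhd[OF u] by auto
    ultimately have d: "((\<lambda>s. logd {Suc n..<m} (u(n := s))) has_vector_derivative logd (insert n {Suc n..<m}) (u(n := u n))) (at (u n))"
      using Suc.prems(1) by (intro logd_deriv) auto
    have "((\<lambda>s. g (u(n := s))) has_vector_derivative logd (insert n {Suc n..<m}) (u(n := u n))) (at (u n))"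
      by (rule has_vector_derivative_transform_within_open[OF d open_nbhd_line[of u n]])
        (use u in \<open>auto intro!: Suc.prems(2)[symmetric]\<close>)
    then show ?thesis unfolding ins by simp
  qed
  then have d: "(\<lambda>s. g (u(n := s))) differentiable at (u n)" "partial_deriv n g u = logd {n..<m} u" if "u \<in> nbhd" for u
    using that by (auto simp: partial_deriv_def vector_derivative_at intro: differentiableI_vector)
  have "\<forall>\<^sub>F u in nhds (\<lambda>_. 0). (\<lambda>s. g (u(n := s))) differentiable at (u n)"
    using d(1) open_nbhd zero_in_nbhd by (auto simp: eventually_nhds)
  moreover have "mixed_partial_exists n (partial_deriv n g) (\<lambda>_. 0) \<and>
      mixed_partial n (partial_deriv n g) (\<lambda>_. 0) = logd {..<m} (\<lambda>_. 0)"
    using Suc.prems(1) d(2) by (intro Suc.IH) auto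
  ultimately show ?case by simp
qed

lemma log_char_eq: "log_char Q m X t = Ln (cf {} t)"
  by (simp add: log_char_def cf_def lin_def)

theorem cumulant_exists_eq:
  assumes m: "1 \<le> m"
    and rec: "\<And>B l. B \<subseteq> {..<m} \<Longrightarrow> l \<in> B \<Longrightarrow>
      (\<integral>\<omega>. (\<Prod>l\<in>B. X l \<omega>) \<partial>Q) = (\<Sum>C\<in>{C. C \<subseteq> B \<and> l \<in> C}. K C * (\<integral>\<omega>. (\<Prod>l\<in>B - C. X l \<omega>) \<partial>Q))"
  shows "cumulant_exists Q m X" and "cumulant Q m X = complex_of_real (K {..<m})"
proof -
  obtain n where n: "m = Suc n" using m by (cases m) auto
  let ?g = "log_char Q m X"
  \<comment> \<open>The first derivative comes from the chain rule for \<open>Ln\<close>; it is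
    \<open>log_derivative\<close> of a singleton, from where \<open>mixed_partial_logd\<close> takes
    over.\<close>
  have "((\<lambda>s. ?g (u(n := s))) has_vector_derivative logd {n..<m} u) (at (u n))" if u: "u \<in> nbhd" for u
  proof -
    have c: "((\<lambda>s. cf {} (u(n := s))) has_vector_derivative cf {n} u) (at (u n))"
      using cf_deriv[of "{}" n u "u n"] n by simp
    have "cf {} u \<notin> \<real>\<^sub>\<le>\<^sub>0" using cf_nbhd[OF u] by (auto simp: complex_nonpos_Reals_iff)
    then have l: "(Ln has_field_derivative inverse (cf {} u)) (at (cf {} (u(n := u n))))"
      by (simp add: has_field_derivative_Ln)
    have "((Ln \<circ> (\<lambda>s. cf {} (u(n := s)))) has_vector_derivative cf {n} u * inverse (cf {} u)) (at (u n))"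
      by (rule field_vector_diff_chain_at[OF c l])
    moreover have "{n..<m} = {n}" using n by auto
    ultimately show ?thesis by (simp add: comp_def log_char_eq[abs_def] log_derivative_singleton field_simps)
  qed
  then have d: "(\<lambda>s. ?g (u(n := s))) differentiable at (u n)" "partial_deriv n ?g u = logd {n..<m} u" if "u \<in> nbhd" for u
    using that by (auto simp: partial_deriv_def vector_derivative_at intro: differentiableI_vector)
  have "\<forall>\<^sub>F u in nhds (\<lambda>_. 0). (\<lambda>s. ?g (u(n := s))) differentiable at (u n)"
    using d(1) open_nbhd zero_in_nbhd by (auto simp: eventually_nhds)
  moreover have mp: "mixed_partial_exists n (partial_deriv n ?g) (\<lambda>_. 0) \<and>
      mixed_partial n (partial_deriv n ?g) (\<lambda>_. 0) = logd {..<m} (\<lambda>_. 0)"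
    using d(2) n by (intro mixed_partial_logd) auto
  moreover have "mixed_partial_exists m ?g (\<lambda>_. 0) \<longleftrightarrow> (\<forall>\<^sub>F u in nhds (\<lambda>_. 0). (\<lambda>s. ?g (u(n := s))) differentiable at (u n))
    \<and> mixed_partial_exists n (partial_deriv n ?g) (\<lambda>_. 0)"
    unfolding mixed_partial_exists.simps(2)[of n, folded n] by simp
  ultimately show "cumulant_exists Q m X" unfolding cumulant_exists_def by blast
  let ?mom = "\<lambda>B. \<integral>\<omega>. (\<Prod>l\<in>B. X l \<omega>) \<partial>Q"
  have F: "cf B (\<lambda>_. 0) = \<i> ^ card B * complex_of_real (?mom B)" if "B \<subseteq> {..<m}" for B
  proof -
    have "cf B (\<lambda>_. 0) = (\<integral>\<omega>. \<i> ^ card B * complex_of_real (\<Prod>l\<in>B. X l \<omega>) \<partial>Q)"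
      unfolding cf_def lin_def by (simp add: prod.distrib)
    also have "\<dots> = \<i> ^ card B * complex_of_real (?mom B)"
      by (simp only: integral_mult_right_zero integral_complex_of_real)
    finally show ?thesis .
  qed
  have "logd {..<m} (\<lambda>_. 0) = \<i> ^ card {..<m} * complex_of_real (K {..<m})"
    by (rule log_derivative_moments[where mom = ?mom and R = "{..<m}"]) (use F rec n in \<open>auto simp: prob_space\<close>)
  moreover have "mixed_partial m ?g (\<lambda>_. 0) = mixed_partial n (partial_deriv n ?g) (\<lambda>_. 0)"
    unfolding mixed_partial.simps(2)[of n, folded n] ..
  ultimately have "cumulant Q m X = (- \<i>) ^ m * (\<i> ^ m * complex_of_real (K {..<m}))"
    using mp by (simp add: cumulant_def)
  also have "\<dots> = complex_of_real (K {..<m})"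
    by (simp add: mult.assoc[symmetric] power_mult_distrib[symmetric])
  finally show "cumulant Q m X = complex_of_real (K {..<m})" .
qed

end

section \<open>Passage to the completion\<close>

text \<open>Preimages under \<open>f\<close> and \<open>g\<close> agree outside a null set, and the
  completion contains every subset of that null set.\<close>

lemma measurable_completion_cong_AE:
  assumes g: "g \<in> measurable M N" and ae: "AE x in M. f x = g x" and sp: "\<And>x. x \<in> space M \<Longrightarrow> f x \<in> space N"
  shows "f \<in> measurable (completion M) N"
proof (rule measurableI)
  fix B assume B: "B \<in> sets N"
  obtain Z where Z: "Z \<in> null_sets M" "{x \<in> space M. f x \<noteq> g x} \<subseteq> Z"
    using ae by (auto elim!: AE_E simp: null_sets_def)
  have "f -` B \<inter> space M = (g -` B \<inter> space M - Z) \<union> (f -` B \<inter> space M \<inter> Z)" using Z(2) by auto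
  moreover have "g -` B \<inter> space M - Z \<in> sets M" using measurable_sets[OF g B] Z(1) by auto
  ultimately have "f -` B \<inter> space M \<in> sets (completion M)"
    using Z(1) by (intro sets_completionI[of _ "g -` B \<inter> space M - Z" "f -` B \<inter> space M \<inter> Z" Z]) auto
  then show "f -` B \<inter> space (completion M) \<in> sets (completion M)" by simp
qed (simp add: sp)

lemma completion_cong_AE_integral:
  fixes f g :: "'w \<Rightarrow> real"
  assumes g: "integrable M g" and ae: "AE x in M. f x = g x"
  shows "integrable (completion M) f" and "(\<integral>x. f x \<partial>completion M) = (\<integral>x. g x \<partial>M)"
proof -
  have gm: "g \<in> borel_measurable M" using g by auto
  have fm: "f \<in> borel_measurable (completion M)"
    by (rule measurable_completion_cong_AE[OF gm ae]) simp
  have gc: "integrable (completion M) g" using g gm by (simp add: integrable_completion)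
  have ae': "AE x in completion M. f x = g x" using ae by (rule AE_completion)
  show "integrable (completion M) f"
    using gc fm ae' by (subst integrable_cong_AE[OF fm _ ae']) auto
  have "(\<integral>x. f x \<partial>completion M) = (\<integral>x. g x \<partial>completion M)"
    using gc by (intro integral_cong_AE fm ae') auto
  then show "(\<integral>x. f x \<partial>completion M) = (\<integral>x. g x \<partial>M)" using gm by (simp add: integral_completion)
qed

theorem theorem3p7:
  fixes P :: "'w measure" and M :: "'a measure" and \<eta> :: "'w \<Rightarrow> 'a measure"
    and m mt :: nat and q :: "nat \<Rightarrow> nat"
    and f :: "nat \<Rightarrow> (nat \<Rightarrow> 'a) \<Rightarrow> real"
    and S :: "nat \<Rightarrow> 'w \<Rightarrow> real"
  assumes poisson: "poisson_process P M \<eta>"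
    and m_pos: "1 \<le> m"
    and mt: "m \<le> mt" "even mt"
    and q_pos: "\<And>l. l < m \<Longrightarrow> 1 \<le> q l"
    and f_L1: "\<And>l. l < m \<Longrightarrow> f l \<in> L1_sym M (q l)"
    and fin_bar: "\<And>i \<sigma>. i < m \<Longrightarrow> \<sigma> \<in> Part_bar mt (\<lambda>_. q i) \<Longrightarrow>
        (\<integral>\<^sup>+ y. ennreal \<bar>tensor_part mt (\<lambda>_. q i) (\<lambda>_. f i) \<sigma> y\<bar> \<partial>PiM \<sigma> (\<lambda>_. M)) < \<infinity>"
    and fin_tilde: "\<And>\<sigma>. \<sigma> \<in> Part_tilde m q \<Longrightarrow>
        (\<integral>\<^sup>+ y. ennreal \<bar>tensor_part m q f \<sigma> y\<bar> \<partial>PiM \<sigma> (\<lambda>_. M)) < \<infinity>"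
    and S_def: "\<And>l. l < m \<Longrightarrow> S l = U_statistic \<eta> (q l) (f l)"
  shows
    (* well-definedness of all quantities in the two formulas, then the formulas *)
    "(\<forall>l<m. AE \<omega> in P. integrable (factorial_measure (\<eta> \<omega>) (q l)) (f l)) \<and>
     (\<forall>l<m. integrable (completion P) (S l)) \<and>
     integrable (completion P) (\<lambda>\<omega>. \<Prod>l<m. (S l \<omega> - (\<integral>\<omega>'. S l \<omega>' \<partial>completion P))) \<and>
     (\<forall>\<sigma>\<in>Part_bar m q. integrable (PiM \<sigma> (\<lambda>_. M)) (tensor_part m q f \<sigma>)) \<and>
     cumulant_exists (completion P) m S \<and>
     (\<integral>\<omega>. (\<Prod>l<m. (S l \<omega> - (\<integral>\<omega>'. S l \<omega>' \<partial>completion P))) \<partial>completion P) =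
       (\<Sum>\<sigma>\<in>Part_bar m q. \<integral>y. tensor_part m q f \<sigma> y \<partial>PiM \<sigma> (\<lambda>_. M)) \<and>
     cumulant (completion P) m S =
       complex_of_real (\<Sum>\<sigma>\<in>Part_tilde m q. \<integral>y. tensor_part m q f \<sigma> y \<partial>PiM \<sigma> (\<lambda>_. M))"
proof -
  \<comment> \<open>All computations are done for the regular version \<open>\<eta>'\<close>. The
    statistics of \<eta> agree with those of \<open>\<eta>'\<close> only almost surely, so the
    results are carried over to the completion.\<close>
  obtain \<eta>' A where "locally_finite_poisson P M \<eta>' A" and ae: "AE \<omega> in P. \<eta>' \<omega> = \<eta> \<omega>"
    using poisson_process_locally_finite[OF poisson] by blast
  then interpret L: locally_finite_poisson P M \<eta>' A by simp
  have f_int: "integrable (PiM {..<q l} (\<lambda>_. M)) (f l)" if "l < m" for l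
    using f_L1[OF that] by (simp add: L1_sym_def)
  let ?T = "\<lambda>l \<omega>. \<integral>\<^sup>+ x. ennreal \<bar>f l x\<bar> \<partial>factorial_measure (\<eta>' \<omega>) (q l)"
  have T_meas: "?T l \<in> borel_measurable P" if "l < m" for l
    using f_int[OF that] by (intro L.Campbell(1)) auto
  interpret U: U_statistic_moments P M \<eta>' A q f "{..<m}"
  proof
    show "finite {..<m}" by simp
    show "f l \<in> borel_measurable (PiM {..<q l} (\<lambda>_. M))" if "l \<in> {..<m}" for l
      using f_int[of l] that by auto
    fix B assume B: "B \<subseteq> {..<m}"
    \<comment> \<open>The number of factors is at most \<open>m\<close>, hence at most
      \<open>mt\<close>, so moments of order \<open>mt\<close> dominate all these products.\<close>
    then have fB: "finite B" "card B \<le> mt"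
      using card_mono[OF _ B] mt finite_subset[OF B] by auto
    have "(\<integral>\<^sup>+ \<omega>. (\<Prod>l\<in>B. ?T l \<omega>) \<partial>P) \<le> (\<integral>\<^sup>+ \<omega>. 1 + (\<Sum>l\<in>B. ?T l \<omega> ^ mt) \<partial>P)"
      by (intro nn_integral_mono prod_le_one_plus_sum_power fB)
    also have "\<dots> = 1 + (\<Sum>l\<in>B. \<integral>\<^sup>+ \<omega>. ?T l \<omega> ^ mt \<partial>P)"
    proof -
      have m: "(\<lambda>\<omega>. ?T l \<omega> ^ mt) \<in> borel_measurable P" if "l \<in> B" for l
        using T_meas[of l] B that by (intro borel_measurable_power_ennreal) auto
      have "(\<integral>\<^sup>+ \<omega>. 1 + (\<Sum>l\<in>B. ?T l \<omega> ^ mt) \<partial>P) = (\<integral>\<^sup>+ \<omega>. 1 \<partial>P) + (\<integral>\<^sup>+ \<omega>. (\<Sum>l\<in>B. ?T l \<omega> ^ mt) \<partial>P)"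
        using m by (intro nn_integral_add borel_measurable_sum) auto
      then show ?thesis using nn_integral_sum[OF m] by (simp add: L.emeasure_space_1)
    qed
    also have "\<dots> < \<infinity>"
    proof -
      have "(\<integral>\<^sup>+ \<omega>. ?T l \<omega> ^ mt \<partial>P) < \<infinity>" if "l \<in> B" for l
      proof -
        have l: "l < m" using B that by auto
        show ?thesis by (rule L.even_moment_finite[OF f_int[OF l] mt(2) fin_bar[OF l]])
      qed
      then show ?thesis using fB by simp
    qed
    finally show "(\<integral>\<^sup>+ \<omega>. (\<Prod>l\<in>B. ?T l \<omega>) \<partial>P) < \<infinity>" .
  qed
  let ?Q = "completion P"
  have "AE \<omega> in P. S l \<omega> = U_statistic \<eta>' (q l) (f l) \<omega>" if "l < m" for l
    using ae by eventually_elim (simp add: S_def[OF that] U_statistic_def)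
  then have ae_all: "AE \<omega> in P. \<forall>l\<in>{..<m}. S l \<omega> = U_statistic \<eta>' (q l) (f l) \<omega>"
    by (subst AE_finite_all) auto
  have prod_S: "integrable ?Q (\<lambda>\<omega>. \<Prod>l\<in>B. S l \<omega>)" "(\<integral>\<omega>. (\<Prod>l\<in>B. S l \<omega>) \<partial>?Q) = U.moment B"
    if B: "B \<subseteq> {..<m}" for B
  proof -
    have "AE \<omega> in P. (\<Prod>l\<in>B. S l \<omega>) = (\<Prod>l\<in>B. U_statistic \<eta>' (q l) (f l) \<omega>)"
      using ae_all by eventually_elim (use B in \<open>auto intro!: prod.cong\<close>)
    from completion_cong_AE_integral[OF U.moment_formula(1)[OF B] this]
    show "integrable ?Q (\<lambda>\<omega>. \<Prod>l\<in>B. S l \<omega>)" "(\<integral>\<omega>. (\<Prod>l\<in>B. S l \<omega>) \<partial>?Q) = U.moment B"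
      by (simp_all add: U.moment_def)
  qed
  have ES: "(\<integral>\<omega>. S l \<omega> \<partial>?Q) = U.moment {l}" if "l < m" for l
    using prod_S(2)[of "{l}"] that by simp
  have centered_eq: "(\<Prod>l<m. (S l \<omega> - (\<integral>\<omega>'. S l \<omega>' \<partial>?Q))) = (\<Prod>l<m. (S l \<omega> - U.moment {l}))" for \<omega>
    using ES by (intro prod.cong) auto
  have "AE \<omega> in P. (\<Prod>l<m. (S l \<omega> - U.moment {l})) = (\<Prod>l<m. (U_statistic \<eta>' (q l) (f l) \<omega> - U.moment {l}))"
    using ae_all by eventually_elim (auto intro!: prod.cong)
  note centered = completion_cong_AE_integral[OF U.centered_moment_formula(1)[OF order.refl] this,
      unfolded U.centered_moment_formula(2)[OF order.refl]]
  have block: "U.block_integral {..<m} \<sigma> = (\<integral>y. tensor_part m q f \<sigma> y \<partial>PiM \<sigma> (\<lambda>_. M))" for \<sigma>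
    by (simp add: U.block_integral_def tensor_part_eq)
  interpret J: joint_moments ?Q S m
  proof -
    have "prob_space ?Q" by (rule prob_spaceI) (simp add: L.emeasure_space_1)
    then show "joint_moments ?Q S m" using prod_S(1) by (simp add: joint_moments_def joint_moments_axioms_def)
  qed
  \<comment> \<open>The connected sums are the coefficients in the recursion of the moments, so the
    value at the full row set is the cumulant.\<close>
  let ?K = "\<lambda>C. \<Sum>\<sigma>\<in>Part_tilde_on q C. U.block_integral C \<sigma>"
  have rec: "(\<integral>\<omega>. (\<Prod>l\<in>B. S l \<omega>) \<partial>?Q) = (\<Sum>C\<in>{C. C \<subseteq> B \<and> l \<in> C}. ?K C * (\<integral>\<omega>. (\<Prod>l\<in>B - C. S l \<omega>) \<partial>?Q))"
    if B: "B \<subseteq> {..<m}" "l \<in> B" for B l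
  proof -
    have "(\<integral>\<omega>. (\<Prod>l\<in>B - C. S l \<omega>) \<partial>?Q) = U.moment (B - C)" for C using B by (intro prod_S(2)) auto
    then show ?thesis using U.moment_tilde_recursion[OF B] prod_S(2)[OF B(1)] by simp
  qed
  show ?thesis
  proof (intro conjI allI impI ballI)
    show "AE \<omega> in P. integrable (factorial_measure (\<eta> \<omega>) (q l)) (f l)" if "l < m" for l
      using ae U.integrable_f_AE[of l, OF lessThan_iff[THEN iffD2, OF that]] by eventually_elim simp
    show "integrable ?Q (S l)" if "l < m" for l using prod_S(1)[of "{l}"] that by simp
    show "integrable ?Q (\<lambda>\<omega>. \<Prod>l<m. (S l \<omega> - (\<integral>\<omega>'. S l \<omega>' \<partial>?Q)))"
      unfolding centered_eq by (rule centered(1))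
    show "integrable (PiM \<sigma> (\<lambda>_. M)) (tensor_part m q f \<sigma>)" if "\<sigma> \<in> Part_bar m q" for \<sigma>
      using that U.integrable_tensor_on[OF order.refl, of \<sigma>]
      by (simp add: tensor_part_eq Part_bar_eq Part_bar_on_def)
    show "cumulant_exists ?Q m S" by (rule J.cumulant_exists_eq(1)[OF m_pos rec])
    show "(\<integral>\<omega>. (\<Prod>l<m. (S l \<omega> - (\<integral>\<omega>'. S l \<omega>' \<partial>?Q))) \<partial>?Q) =
       (\<Sum>\<sigma>\<in>Part_bar m q. \<integral>y. tensor_part m q f \<sigma> y \<partial>PiM \<sigma> (\<lambda>_. M))"
      unfolding centered_eq centered(2) Part_bar_eq block ..
    show "cumulant ?Q m S = complex_of_real (\<Sum>\<sigma>\<in>Part_tilde m q. \<integral>y. tensor_part m q f \<sigma> y \<partial>PiM \<sigma> (\<lambda>_. M))"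
      using J.cumulant_exists_eq(2)[OF m_pos rec] unfolding Part_tilde_eq[OF m_pos] block .
  qed
qed

end
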